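(* Let $q$ be a prime power and let $f(x_1, \ldots, x_n) \in \mathbb{F}_q[x_1, \ldots, x_n]$ be a (not necessarily homogeneous) polynomial of total degree $d$ which is absolutely irreducible (irreducible over $\overline{\mathbb{F}_q}$). For $(\mathbf{v}, \mathbf{w}, \mathbf{z}) = (v_1, \ldots, v_n, w_2, \ldots, w_n, z_2, \ldots, z_n) \in \mathbb{F}_q^{3n-2}$ define \[f_{\mathbf{v}, \mathbf{w}, \mathbf{z}}(X,Y) = f(X + v_1, w_2X + z_2 Y + v_2, \ldots, w_n X + z_n Y + v_n) \in \mathbb{F}_q[X,Y].\] (i) There exist at most $\frac18 \left(3 d^{4} - 2 d^{3} + 13 d^{2} + 2 d\right)q^{3n-3}$ tuples $(\mathbf{v}, \mathbf{w}, \mathbf{z}) \in \mathbb{F}_q^{3n-2}$ such that $f_{\mathbf{v}, \mathbf{w}, \mathbf{z}}$ is not absolutely irreducible. (ii) Fix a positive integer $D < d$. Then there exist at most \[\frac{d}{8} \left(-D^{4} + 4 D^{3} d - 6 D^{3} + 12 D^{2} d - 11 D^{2} + 8 D d - 6 D + 16 d\right)q^{3n-3}\] tuples $(\mathbf{v}, \mathbf{w}, \mathbf{z}) \in \mathbb{F}_q^{3n-2}$ for which $f_{\mathbf{v}, \mathbf{w}, \mathbf{z}}$ has an irreducible factor of degree at most $D$ over $\overline{\mathbb{F}_q}$. *)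

theory Defs
  imports
    "HOL-Algebra.Algebraic_Closure_Type"
    "HOL-Library.Poly_Mapping"
    "HOL-Library.FuncSet"
    "HOL-Library.Cardinality"
begin

text \<open>
  Polynomials over \<open>'a\<close> in the variables \<open>x\<^sub>i\<close>, \<open>i :: 'i\<close>: finitely supported maps from exponent
  vectors to coefficients, with the convolution product of \<^theory>\<open>HOL-Library.Poly_Mapping\<close>.
\<close>

type_synonym ('i, 'a) mpoly = "('i \<Rightarrow>\<^sub>0 nat) \<Rightarrow>\<^sub>0 'a"

definition Const :: "'a::zero \<Rightarrow> ('i, 'a) mpoly" where
  "Const c = Poly_Mapping.single 0 c"

definition Var :: "'i \<Rightarrow> ('i, 'a::zero_neq_one) mpoly" where
  "Var i = Poly_Mapping.single (Poly_Mapping.single i 1) 1"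

definition monom_degree :: "('i \<Rightarrow>\<^sub>0 nat) \<Rightarrow> nat" where
  "monom_degree m = (\<Sum>i\<in>Poly_Mapping.keys m. Poly_Mapping.lookup m i)"

text \<open>The zero polynomial gets total degree \<open>0\<close>.\<close>

definition total_degree :: "('i, 'a::zero) mpoly \<Rightarrow> nat" where
  "total_degree p = Max (insert 0 (monom_degree ` Poly_Mapping.keys p))"

definition substitute ::
  "('i \<Rightarrow> ('j, 'a) mpoly) \<Rightarrow> ('i, 'a::comm_semiring_1) mpoly \<Rightarrow> ('j, 'a) mpoly" where
  "substitute s p =
    (\<Sum>m\<in>Poly_Mapping.keys p. Const (Poly_Mapping.lookup p m) *
      (\<Prod>i\<in>Poly_Mapping.keys m. s i ^ Poly_Mapping.lookup m i))"

definition to_closure :: "('i, 'a::field) mpoly \<Rightarrow> ('i, 'a alg_closure) mpoly" where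
  "to_closure p = Poly_Mapping.map to_ac p"

text \<open>
  The qualified name selects the type-class notion of irreducibility; the unqualified one may be
  read as the carrier-based constant of \<^theory>\<open>HOL-Algebra.Divisibility\<close>.
\<close>

definition absolutely_irreducible :: "('i, 'a::field) mpoly \<Rightarrow> bool" where
  "absolutely_irreducible p \<longleftrightarrow> comm_semiring_1_class.irreducible (to_closure p)"

definition has_abs_irreducible_factor_upto :: "nat \<Rightarrow> ('i, 'a::field) mpoly \<Rightarrow> bool" where
  "has_abs_irreducible_factor_upto D p \<longleftrightarrow>
    (\<exists>g. comm_semiring_1_class.irreducible g \<and> g dvd to_closure p \<and> total_degree g \<le> D)"

datatype xy = XVar | YVar

text \<open>
  The index \<open>k\<close> plays the role of the first coordinate: \<open>x\<^sub>k\<close> is replaced by \<open>X + v\<^sub>k\<close>, every other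
  \<open>x\<^sub>i\<close> by \<open>w\<^sub>i X + z\<^sub>i Y + v\<^sub>i\<close>.
\<close>

definition plane_section ::
  "'n \<Rightarrow> ('n, 'a) mpoly \<Rightarrow> ('n \<Rightarrow> 'a) \<times> ('n \<Rightarrow> 'a) \<times> ('n \<Rightarrow> 'a) \<Rightarrow> (xy, 'a::field) mpoly" where
  "plane_section k f = (\<lambda>(v, w, z).
    substitute (\<lambda>i. if i = k then Var XVar + Const (v i)
                    else Const (w i) * Var XVar + Const (z i) * Var YVar + Const (v i)) f)"

text \<open>
  The families \<open>w\<close> and \<open>z\<close> are indexed by the coordinates other than \<open>k\<close>; the extensional function
  space fixes their irrelevant value at \<open>k\<close>, so that each tuple is counted exactly once.
\<close>

definition section_params :: "'n \<Rightarrow> (('n \<Rightarrow> 'a) \<times> ('n \<Rightarrow> 'a) \<times> ('n \<Rightarrow> 'a)) set" where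
  "section_params k = UNIV \<times> ((UNIV - {k}) \<rightarrow>\<^sub>E UNIV) \<times> ((UNIV - {k}) \<rightarrow>\<^sub>E UNIV)"

end

theory Submission
  imports Defs "Jordan_Normal_Form.Char_Poly" "HOL-Computational_Algebra.Formal_Power_Series"
begin

text \<open>
  Work over the algebraic closure \<open>K\<close>. The line \<open>v + X (1, w)\<close> is good if \<open>f\<close> restricted to it has degree
  \<open>d\<close> and only simple roots. The bad \<open>(v, w)\<close> are zeros of a discriminant times a leading coefficient,
  a nonzero polynomial of degree at most \<open>(2 d - 1) d + d = 2 d\<^sup>2\<close>; nonvanishing uses that the generic
  restriction of \<open>f\<close> is prime and that \<open>f\<close> is not a \<open>p\<close>-th power.

  On a good line every root \<open>\<zeta>\<close> lifts to a power series root \<open>\<phi>(Y)\<close> of the plane section, whose \<open>j\<close>-th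
  coefficient is a polynomial of degree at most \<open>j\<close> in \<open>z\<close>. A factor \<open>g(X, Y)\<close> of total degree at most
  \<open>D\<close> through \<open>(\<zeta>, 0)\<close> satisfies \<open>g(\<phi>(Y), Y) = 0\<close>, a linear dependence between the series \<open>\<phi>\<^sup>i Y\<^sup>j\<close>,
  \<open>i + j \<le> D\<close>. For generic \<open>z\<close> these are independent even modulo a power of \<open>Y\<close> of exponent \<open>d D + 1\<close>,
  because the resultant of the irreducible section with \<open>g\<close> has \<open>Y\<close>-degree at most \<open>d D\<close>. So a nonzero
  minor vanishes at each bad \<open>z\<close>, and the Schwartz-Zippel lemma counts them. For (i) a single root
  suffices with \<open>D = d - 1\<close>; for (ii) all \<open>d\<close> roots are needed.
\<close>

hide_const (open) UnivPoly.coeff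
no_notation fps_nth (infixl "$" 75)

text \<open>Discriminant, resultant and minor are nonzero because an irreducible factor can be
  cancelled from a product, so irreducible polynomials must first be shown prime. Primality is then
  carried along invertible substitutions: once enough of the base point, the direction or
  \<open>z\<close> is indeterminate, restricting \<open>f\<close> is only a change of coordinates.

  The plane section with symbolic \<open>z\<close> is not such an image, since \<open>z\<close>
  occurs only in the products \<open>z_i Y\<close>. Setting \<open>Y = 1\<close> restores the change
  of coordinates. The same coupling grades the construction: each power of \<open>Y\<close> carries
  the same degree in \<open>z\<close>, so row \<open>r\<close> of a minor has entries of degree at
  most \<open>r\<close>, and distinct rows bounded by \<open>d D\<close> keep its total degree
  small.

  Both final bounds are \<open>2 d^2\<close> for the lines plus a minor bound for the planes. In (i)
  one of two complementary factors passes through any prescribed root. In (ii) the root met by a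
  small factor is not known in advance, so the minor bound is paid once for each of the
  \<open>d\<close> roots.\<close>

abbreviation "lookup \<equiv> Poly_Mapping.lookup"
abbreviation "keys \<equiv> Poly_Mapping.keys"
abbreviation "single \<equiv> Poly_Mapping.single"

section \<open>Evaluation homomorphisms\<close>

definition mon_eval :: "('i \<Rightarrow> 'b::comm_monoid_mult) \<Rightarrow> ('i \<Rightarrow>\<^sub>0 nat) \<Rightarrow> 'b" where
  "mon_eval s m = (\<Prod>i\<in>keys m. s i ^ lookup m i)"

definition meval :: "('c::zero \<Rightarrow> 'b::comm_ring_1) \<Rightarrow> ('i \<Rightarrow> 'b) \<Rightarrow> ('i, 'c) mpoly \<Rightarrow> 'b" where
  "meval c s p = (\<Sum>m\<in>keys p. c (lookup p m) * mon_eval s m)"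

lemma mon_eval_superset:
  assumes "finite A" "keys m \<subseteq> A"
  shows "mon_eval s m = (\<Prod>i\<in>A. s i ^ lookup m i)"
  unfolding mon_eval_def by (rule prod.mono_neutral_left) (use assms in \<open>auto simp: in_keys_iff\<close>)

lemma mon_eval_add: "mon_eval s (m + m') = mon_eval s m * mon_eval s m'"
proof -
  let ?A = "keys m \<union> keys m'"
  have "keys (m + m') \<subseteq> ?A" by (rule Poly_Mapping.keys_add)
  then show ?thesis
    by (simp add: mon_eval_superset[of ?A] lookup_add power_add prod.distrib)
qed

lemma mon_eval_0 [simp]: "mon_eval s 0 = 1"
  by (simp add: mon_eval_def)

lemma mon_eval_single [simp]: "mon_eval s (single i n) = s i ^ n"
  by (simp add: mon_eval_def)

lemma (in comm_monoid_mult_hom) hom_mon_eval: "hom (mon_eval s m) = mon_eval (\<lambda>i. hom (s i)) m"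
  by (simp add: mon_eval_def hom_distribs)

lemma mpoly_as_sum: "p = (\<Sum>m\<in>keys p. single m (lookup p m))"
  by (rule poly_mapping_eqI) (auto simp: lookup_sum lookup_single when_def in_keys_iff)

lemma mpoly_induct [case_names single add]:
  assumes "\<And>m c. P (single m c)" "\<And>p q. P p \<Longrightarrow> P q \<Longrightarrow> P (p + q)"
  shows "P (p :: 'i \<Rightarrow>\<^sub>0 'a::comm_monoid_add)"
proof -
  have "P (\<Sum>m\<in>A. single m (c m))" if "finite A" for A and c :: "'i \<Rightarrow> 'a"
    using that
  proof induction
    case empty
    then show ?case using assms(1)[of undefined 0] by simp
  qed (auto intro: assms)
  from this[OF finite_keys, of "lookup p" p] show ?thesis by (simp flip: mpoly_as_sum)
qed

context comm_ring_hom
begin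

lemma meval_single [simp]: "meval hom s (single m a) = hom a * mon_eval s m"
  by (simp add: meval_def)

lemma meval_add: "meval hom s (p + q) = meval hom s p + meval hom s q"
  unfolding meval_def
  by (rule setsum_keys_plus_distrib) (auto simp: hom_distribs algebra_simps)

lemma meval_0 [simp]: "meval hom s 0 = 0"
  by (simp add: meval_def)

lemma meval_mult: "meval hom s (p * q) = meval hom s p * meval hom s q"
proof (induction p rule: mpoly_induct)
  case (single m a)
  show ?case
  proof (induction q rule: mpoly_induct)
    case (single m' b)
    show ?case by (simp add: mult_single hom_distribs mon_eval_add algebra_simps)
  qed (simp add: algebra_simps meval_add)
qed (simp add: algebra_simps meval_add)

lemma meval_hom: "comm_ring_hom (meval hom s)"
proof unfold_locales
  show "meval hom s 1 = 1"
    using meval_single[of s 0 1] by (simp flip: single_one)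
qed (simp_all add: meval_add meval_mult)

lemma meval_Const [simp]: "meval hom s (Const a) = hom a"
  by (simp add: Const_def)

lemma meval_Var [simp]: "meval hom s (Var i) = s i"
  by (simp add: Var_def)

end

lemma Const_hom: "comm_ring_hom (Const :: 'c::comm_ring_1 \<Rightarrow> ('i, 'c) mpoly)"
  by unfold_locales (simp_all add: Const_def single_add mult_single single_one)

lemma single_single_eq: "single (single i n) a = Const a * Var i ^ n" for a :: "'c::comm_ring_1"
proof (induction n)
  case 0
  then show ?case by (simp add: Const_def)
next
  case (Suc n)
  have "single (single i (Suc n)) a = single (single i n) a * Var i"
    by (simp add: mult_single Var_def flip: single_add)
  then show ?case by (simp add: Suc.IH)
qed

lemma single_eq_Const_mon_eval: "single m a = Const a * mon_eval Var m" for a :: "'c::comm_ring_1"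
proof (induction m arbitrary: a rule: mpoly_induct)
  case (single i n)
  show ?case by (simp add: single_single_eq)
next
  case (add p q)
  have "single (p + q) a = single p 1 * single q a"
    by (simp add: mult_single)
  then show ?case using add(1)[of 1] add(2)[of a] by (simp add: mon_eval_add algebra_simps Const_def)
qed

lemma hom_eq_meval:
  fixes h :: "('i, 'c::comm_ring_1) mpoly \<Rightarrow> 'b::comm_ring_1"
  assumes "comm_ring_hom h"
  shows "h p = meval (\<lambda>a. h (Const a)) (\<lambda>i. h (Var i)) p"
proof -
  interpret comm_ring_hom h by fact
  have "h p = (\<Sum>m\<in>keys p. h (single m (lookup p m)))"
    using arg_cong[OF mpoly_as_sum[of p], of h] by (simp only: hom_sum)
  then show ?thesis
    unfolding meval_def by (simp add: single_eq_Const_mon_eval hom_distribs hom_mon_eval)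
qed

lemma hom_ext:
  fixes h :: "('i, 'c::comm_ring_1) mpoly \<Rightarrow> 'b::comm_ring_1"
  assumes "comm_ring_hom h" "comm_ring_hom h'"
    and "\<And>a. h (Const a) = h' (Const a)" "\<And>i. h (Var i) = h' (Var i)"
  shows "h = h'"
  proof
  fix p
  show "h p = h' p"
    using hom_eq_meval[OF assms(1), of p] hom_eq_meval[OF assms(2), of p] by (simp add: assms(3,4))
qed

lemma comm_ring_hom_comp: "comm_ring_hom g \<Longrightarrow> comm_ring_hom h \<Longrightarrow> comm_ring_hom (\<lambda>x. h (g x))"
  by (simp add: comm_ring_hom_def ring_hom_def semiring_hom_def comm_monoid_add_hom_def monoid_add_hom_def
    monoid_mult_hom_def zero_hom_def one_hom_def semigroup_add_hom_def semigroup_mult_hom_def plus_hom_def times_hom_def)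

lemma comm_ring_hom_id: "comm_ring_hom (\<lambda>x. x)"
  by unfold_locales auto

lemma map_poly_hom: "comm_ring_hom h \<Longrightarrow> comm_ring_hom (map_poly h)"
proof -
  assume "comm_ring_hom h"
  then interpret map_poly_comm_ring_hom h by (simp add: map_poly_comm_ring_hom_def)
  show ?thesis by unfold_locales
qed

lemma const_poly_hom: "comm_ring_hom (\<lambda>a. [:a:])"
  by unfold_locales auto

lemma poly_at_hom: "comm_ring_hom (\<lambda>p. poly p a)"
  by unfold_locales

lemma meval_comp:
  assumes "comm_ring_hom c" "comm_ring_hom h"
  shows "h (meval c s p) = meval (\<lambda>a. h (c a)) (\<lambda>i. h (s i)) p"
proof -
  interpret c: comm_ring_hom c by fact
  show ?thesis
    by (subst hom_eq_meval[OF comm_ring_hom_comp[OF c.meval_hom assms(2)]]) simp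
qed

lemma meval_id: "meval Const Var p = p" for p :: "('i, 'c::comm_ring_1) mpoly"
proof -
  show ?thesis
    using hom_eq_meval[OF comm_ring_hom_id, of p] by simp
qed

lemma prime_elem_iso:
  fixes h :: "'a::comm_ring_1 \<Rightarrow> 'b::comm_ring_1"
  assumes "comm_ring_hom h" "comm_ring_hom g" "\<And>x. g (h x) = x" "\<And>y. h (g y) = y" "prime_elem p"
  shows "prime_elem (h p)"
proof -
  interpret h: comm_ring_hom h by fact
  interpret g: comm_ring_hom g by fact
  have *: "h p dvd b \<longleftrightarrow> p dvd g b" for b
    using h.hom_dvd[of p "g b"] g.hom_dvd[of "h p" b] assms(3,4) by auto
  show ?thesis
    unfolding prime_elem_def
  proof (intro conjI allI impI)
    show "h p \<noteq> 0" using assms(3)[of p] assms(5) by (auto simp: prime_elem_def)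
    show "\<not> (h p) dvd 1" using assms(5) unfolding * by (simp add: prime_elem_def)
    fix a b assume "h p dvd a * b"
    then show "h p dvd a \<or> h p dvd b"
      using assms(5) unfolding * by (simp add: g.hom_mult prime_elem_dvd_mult_iff)
  qed
qed

lemma irreducible_iso:
  fixes h :: "'a::comm_ring_1 \<Rightarrow> 'b::comm_ring_1"
  assumes "comm_ring_hom h" "comm_ring_hom g" "\<And>x. g (h x) = x" "\<And>y. h (g y) = y"
    "irreducible p"
  shows "irreducible (h p)"
proof -
  interpret h: comm_ring_hom h by fact
  interpret g: comm_ring_hom g by fact
  have u: "b dvd 1 \<longleftrightarrow> (g b) dvd 1" for b
    using h.hom_dvd_1[of "g b"] g.hom_dvd_1[of b] assms(4) by auto
  show ?thesis
    unfolding comm_semiring_1_class.irreducible_def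
  proof (intro conjI allI impI)
    show "h p \<noteq> 0" using assms(3)[of p] assms(5) by (auto simp: comm_semiring_1_class.irreducible_def)
    show "\<not> (h p) dvd 1" using assms(3,5) u by (simp add: comm_semiring_1_class.irreducible_def)
    fix a b assume "h p = a * b"
    then have "p = g a * g b" using arg_cong[of "h p" "a * b" g] assms(3)[of p] by (simp add: g.hom_mult)
    then show "a dvd 1 \<or> b dvd 1"
      using assms(5) unfolding u[of a] u[of b] comm_semiring_1_class.irreducible_def by blast
  qed
qed

section \<open>Gauss's lemma over a subring\<close>

text \<open>
  In the application \<open>C\<close> consists of the polynomials in the first \<open>N\<close> variables inside a
  polynomial ring in infinitely many variables: this allows an induction on \<open>N\<close> within one type.
\<close>

locale factorial_subring =
  fixes C :: "'a::idom set"
  assumes zero_mem: "0 \<in> C" and one_mem: "1 \<in> C"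
    and add_mem: "a \<in> C \<Longrightarrow> b \<in> C \<Longrightarrow> a + b \<in> C"
    and mult_mem: "a \<in> C \<Longrightarrow> b \<in> C \<Longrightarrow> a * b \<in> C"
    and uminus_mem: "a \<in> C \<Longrightarrow> - a \<in> C"
    and factor_mem: "a * b \<in> C \<Longrightarrow> a * b \<noteq> 0 \<Longrightarrow> a \<in> C"
    and factorization: "c \<in> C \<Longrightarrow> c \<noteq> 0 \<Longrightarrow>
      \<exists>ps. (\<forall>p\<in>set ps. p \<in> C \<and> p \<noteq> 0 \<and> (\<forall>a\<in>C. \<forall>b\<in>C. p dvd a * b \<longrightarrow> p dvd a \<or> p dvd b)) \<and> c = prod_list ps"
begin

definition Cprime :: "'a \<Rightarrow> bool" where
  "Cprime p \<longleftrightarrow> p \<in> C \<and> p \<noteq> 0 \<and> (\<forall>a\<in>C. \<forall>b\<in>C. p dvd a * b \<longrightarrow> p dvd a \<or> p dvd b)"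

definition CX :: "'a poly set" where
  "CX = {P. \<forall>i. coeff P i \<in> C}"

lemma sum_mem: "(\<And>i. i \<in> A \<Longrightarrow> f i \<in> C) \<Longrightarrow> sum f A \<in> C"
  by (induction A rule: infinite_finite_induct) (auto intro: zero_mem add_mem)

lemma CX_add: "P \<in> CX \<Longrightarrow> Q \<in> CX \<Longrightarrow> P + Q \<in> CX"
  by (auto simp: CX_def intro: add_mem)

lemma CX_uminus: "P \<in> CX \<Longrightarrow> - P \<in> CX"
  by (auto simp: CX_def intro: uminus_mem)

lemma CX_diff: "P \<in> CX \<Longrightarrow> Q \<in> CX \<Longrightarrow> P - Q \<in> CX"
  using CX_add[of P "- Q"] CX_uminus[of Q] by simp

lemma CX_mult: "P \<in> CX \<Longrightarrow> Q \<in> CX \<Longrightarrow> P * Q \<in> CX"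
  by (auto simp: CX_def coeff_mult intro!: sum_mem mult_mem)

lemma CX_smult: "c \<in> C \<Longrightarrow> P \<in> CX \<Longrightarrow> smult c P \<in> CX"
  by (auto simp: CX_def intro!: mult_mem)

lemma CX_monom: "c \<in> C \<Longrightarrow> monom c n \<in> CX"
  by (auto simp: CX_def intro!: zero_mem)

lemma CX_coeff: "P \<in> CX \<Longrightarrow> coeff P i \<in> C"
  by (auto simp: CX_def)

lemma mem_quotient: "p * x \<in> C \<Longrightarrow> p \<in> C \<Longrightarrow> p \<noteq> 0 \<Longrightarrow> x \<in> C"
  using factor_mem[of x p] zero_mem by (cases "x = 0") (auto simp: mult.commute)

lemma CX_quotient: "smult p P \<in> CX \<Longrightarrow> p \<in> C \<Longrightarrow> p \<noteq> 0 \<Longrightarrow> P \<in> CX"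
  by (auto simp: CX_def intro: mem_quotient)

text \<open>Gauss's lemma in prime form. If \<open>i\<close> and \<open>j\<close> are the first
  positions where \<open>A\<close> and \<open>B\<close> have a coefficient not divisible by
  \<open>p\<close>, then in the coefficient of \<open>A * B\<close> at \<open>i + j\<close> every
  term but the product of these two is a multiple of \<open>p\<close>.\<close>

lemma Cprime_poly:
  assumes p: "Cprime p" and AB: "A \<in> CX" "B \<in> CX" and dvd: "[:p:] dvd A * B"
  shows "[:p:] dvd A \<or> [:p:] dvd B"
proof (rule ccontr)
  assume "\<not> ?thesis"
  then have nA: "\<exists>i. \<not> p dvd coeff A i" and nB: "\<exists>i. \<not> p dvd coeff B i"
    by (auto simp: const_poly_dvd_iff)
  define i where "i = (LEAST i. \<not> p dvd coeff A i)"
  define j where "j = (LEAST i. \<not> p dvd coeff B i)"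
  have i: "\<not> p dvd coeff A i" and j: "\<not> p dvd coeff B j"
    unfolding i_def j_def using LeastI_ex[OF nA] LeastI_ex[OF nB] by auto
  have i': "p dvd coeff A l" if "l < i" for l using that not_less_Least unfolding i_def by blast
  have j': "p dvd coeff B l" if "l < j" for l using that not_less_Least unfolding j_def by blast
  have "p dvd (\<Sum>l\<le>i+j. coeff A l * coeff B (i + j - l))"
    using dvd by (auto simp: const_poly_dvd_iff coeff_mult)
  also have "(\<Sum>l\<le>i+j. coeff A l * coeff B (i + j - l)) = coeff A i * coeff B j
    + (\<Sum>l\<in>{..i+j}-{i}. coeff A l * coeff B (i + j - l))"
    by (subst sum.remove[of _ i]) auto
  finally have "p dvd coeff A i * coeff B j + (\<Sum>l\<in>{..i+j}-{i}. coeff A l * coeff B (i + j - l))" .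
  moreover have "p dvd (\<Sum>l\<in>{..i+j}-{i}. coeff A l * coeff B (i + j - l))"
  proof (rule dvd_sum)
    fix l assume "l \<in> {..i+j}-{i}"
    then have "l < i \<or> i + j - l < j" by auto
    then show "p dvd coeff A l * coeff B (i + j - l)" using i' j' by auto
  qed
  ultimately have "p dvd coeff A i * coeff B j" using dvd_add_left_iff by blast
  then show False using p i j CX_coeff AB unfolding Cprime_def by blast
qed

text \<open>The prime factors of \<open>c\<close> are removed one at a time: by
  \<open>Cprime_poly\<close> each divides \<open>B\<close> or \<open>E\<close> and is cancelled
  there. This does the work of primitive parts without a fraction field.\<close>

lemma smult_split:
  assumes "c \<in> C" "c \<noteq> 0" "smult c A = B * E" "A \<in> CX" "B \<in> CX" "E \<in> CX"
  shows "\<exists>a b B' E'. a \<in> C \<and> b \<in> C \<and> c = a * b \<and> B = smult a B' \<and> E = smult b E' \<and> A = B' * E' \<and> B' \<in> CX \<and> E' \<in> CX"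
proof -
  have "\<exists>a b B' E'. a \<in> C \<and> b \<in> C \<and> prod_list ps = a * b \<and> B = smult a B' \<and> E = smult b E' \<and> A = B' * E' \<and> B' \<in> CX \<and> E' \<in> CX"
    if "\<forall>p\<in>set ps. Cprime p" "smult (prod_list ps) A = B * E" "B \<in> CX" "E \<in> CX" for ps B E
    using that
  proof (induction ps arbitrary: B E)
    case Nil
    then show ?case by (intro exI[of _ 1] exI[of _ B] exI[of _ E]) (auto simp: one_mem)
  next
    case (Cons p ps)
    have pC: "p \<in> C" "p \<noteq> 0" and pr: "Cprime p" using Cons.prems by (auto simp: Cprime_def)
    have "smult p (smult (prod_list ps) A) = B * E" using Cons.prems by simp
    then have "[:p:] dvd B * E" by (intro dvdI[of _ _ "smult (prod_list ps) A"]) (simp add: mult.commute)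
    then consider "[:p:] dvd B" | "[:p:] dvd E" using Cprime_poly[OF pr] Cons.prems by blast
    then show ?case
    proof cases
      case 1
      then obtain B1 where B1: "B = smult p B1" by (auto simp: dvd_def)
      have B1C: "B1 \<in> CX" using CX_quotient B1 pC Cons.prems by blast
      have "smult p (smult (prod_list ps) A) = smult p (B1 * E)" using Cons.prems B1 by simp
      then have "smult (prod_list ps) A = B1 * E" using pC by (simp add: smult_cancel)
      from Cons.IH[OF _ this B1C] obtain a b B' E' where
        "a \<in> C" "b \<in> C" "prod_list ps = a * b" "B1 = smult a B'" "E = smult b E'" "A = B' * E'" "B' \<in> CX" "E' \<in> CX"
        using Cons.prems by auto
      then show ?thesis using B1 pC
        by (intro exI[of _ "p * a"] exI[of _ b] exI[of _ B'] exI[of _ E']) (auto intro: mult_mem)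
    next
      case 2
      then obtain E1 where E1: "E = smult p E1" by (auto simp: dvd_def)
      have E1C: "E1 \<in> CX" using CX_quotient E1 pC Cons.prems by blast
      have "smult p (smult (prod_list ps) A) = smult p (B * E1)" using Cons.prems E1 by simp
      then have "smult (prod_list ps) A = B * E1" using pC by (simp add: smult_cancel)
      from Cons.IH[OF _ this _ E1C] obtain a b B' E' where
        "a \<in> C" "b \<in> C" "prod_list ps = a * b" "B = smult a B'" "E1 = smult b E'" "A = B' * E'" "B' \<in> CX" "E' \<in> CX"
        using Cons.prems by auto
      then show ?thesis using E1 pC
        by (intro exI[of _ a] exI[of _ "p * b"] exI[of _ B'] exI[of _ E']) (auto intro: mult_mem)
    qed
  qed
  moreover obtain ps where "\<forall>p\<in>set ps. Cprime p" "c = prod_list ps"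
    using factorization[OF assms(1,2)] by (auto simp: Cprime_def)
  ultimately show ?thesis using assms by blast
qed

lemma pseudo_division:
  assumes "Q \<in> CX" "Q \<noteq> 0" "P \<in> CX"
  shows "\<exists>k A B. A \<in> CX \<and> B \<in> CX \<and> smult (lead_coeff Q ^ k) P = A * Q + B \<and> (B = 0 \<or> degree B < degree Q)"
  using assms(3)
proof (induction "degree P" arbitrary: P rule: less_induct)
  case less
  show ?case
  proof (cases "P = 0 \<or> degree P < degree Q")
    case True
    then show ?thesis using less.prems
      by (intro exI[of _ 0] exI[of _ P]) (auto simp: CX_def zero_mem)
  next
    case False
    define M where "M = monom (lead_coeff P) (degree P - degree Q)"
    define R where "R = smult (lead_coeff Q) P - M * Q"
    have MC: "M \<in> CX" unfolding M_def by (rule CX_monom[OF CX_coeff[OF less.prems]])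
    have RC: "R \<in> CX" unfolding R_def
      using MC assms less.prems by (intro CX_diff CX_smult CX_mult) (auto intro: CX_coeff)
    show ?thesis
    proof (cases "R = 0")
      case True
      then show ?thesis using MC
        by (intro exI[of _ 1] exI[of _ M] exI[of _ 0]) (auto simp: R_def CX_def zero_mem)
    next
      case R0: False
      have "degree R \<le> degree P"
        unfolding R_def M_def using False
        by (intro degree_diff_le degree_smult_le order_trans[OF degree_mult_le])
          (auto intro!: order_trans[OF add_mono[OF degree_monom_le order_refl]])
      moreover have "coeff R (degree P) = 0"
        unfolding R_def M_def using False by (simp add: coeff_monom_mult)
      ultimately have "degree R < degree P \<or> degree P = 0 \<and> R = 0"
        using R0 by (metis leading_coeff_0_iff nless_le)
      then have "degree R < degree P" using R0 by auto
      from less.hyps[OF this RC] obtain k A B where *: "A \<in> CX" "B \<in> CX"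
        "smult (lead_coeff Q ^ k) R = A * Q + B" "B = 0 \<or> degree B < degree Q" by blast
      have "smult (lead_coeff Q ^ Suc k) P = smult (lead_coeff Q ^ k) (R + M * Q)"
        unfolding R_def by (simp add: mult.commute)
      also have "\<dots> = (A + smult (lead_coeff Q ^ k) M) * Q + B"
        using * by (simp add: smult_add_right algebra_simps)
      finally have "smult (lead_coeff Q ^ Suc k) P = (A + smult (lead_coeff Q ^ k) M) * Q + B" .
      moreover have "lead_coeff Q ^ k \<in> C"
        by (induction k) (auto intro: one_mem mult_mem CX_coeff assms)
      ultimately show ?thesis using *(1,2,4) MC
        by (intro exI[of _ "Suc k"] exI[of _ "A + smult (lead_coeff Q ^ k) M"] exI[of _ B])
          (auto intro: CX_add CX_smult)
    qed
  qed
qed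

lemma power_mem: "c \<in> C \<Longrightarrow> c ^ k \<in> C"
  by (induction k) (auto intro: one_mem mult_mem)

text \<open>The \<open>U\<close> for which \<open>P\<close> divides \<open>U * H\<close> form an
  ideal containing \<open>P\<close> and \<open>G\<close>. By pseudo-division a nonzero member
  \<open>R\<close> of least degree divides \<open>P\<close> and \<open>G\<close> up to constants.
  Irreducibility of \<open>P\<close> leaves two cases: \<open>R\<close> is a constant, and
  \<open>P\<close> divides \<open>H\<close>; or \<open>R\<close> is a constant multiple of
  \<open>P\<close>, and \<open>P\<close> divides \<open>G\<close>. Cofactors are kept in
  \<open>CX\<close> because constants factor into primes only inside \<open>C\<close>.\<close>

lemma gauss_irreducible_imp_prime:
  assumes P: "irreducible P" "P \<in> CX" "degree P > 0"
    and GH: "G \<in> CX" "H \<in> CX" "K \<in> CX" "G * H = P * K"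
  shows "P dvd G \<or> P dvd H"
proof -
  define J where "J = {U \<in> CX. U \<noteq> 0 \<and> (\<exists>V\<in>CX. U * H = P * V)}"
  have P0: "P \<noteq> 0" using P by auto
  have "P \<in> J" using P GH P0 by (auto simp: J_def)
  define e where "e = (LEAST e. \<exists>R\<in>J. degree R = e)"
  have "\<exists>R\<in>J. degree R = e"
    unfolding e_def by (rule LeastI_ex) (use \<open>P \<in> J\<close> in blast)
  then obtain R where R: "R \<in> J" "degree R = e" by blast
  have min: "e \<le> degree U" if "U \<in> J" for U
    unfolding e_def using that by (auto intro: Least_le)
  have RC: "R \<in> CX" and R0: "R \<noteq> 0" using R by (auto simp: J_def)
  obtain VR where VR: "VR \<in> CX" "R * H = P * VR" using R by (auto simp: J_def)
  have divR: "\<exists>c A. c \<in> C \<and> c \<noteq> 0 \<and> A \<in> CX \<and> smult c U = A * R" if U: "U \<in> CX" "V \<in> CX" "U * H = P * V" for U V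
  proof -
    obtain k A B where *: "A \<in> CX" "B \<in> CX" "smult (lead_coeff R ^ k) U = A * R + B" "B = 0 \<or> degree B < degree R"
      using pseudo_division[OF RC R0 U(1)] by blast
    have "B = smult (lead_coeff R ^ k) U - A * R" using *(3) by simp
    then have "B * H = smult (lead_coeff R ^ k) (U * H) - A * (R * H)"
      by (simp only:) (simp add: algebra_simps)
    also have "\<dots> = P * (smult (lead_coeff R ^ k) V - A * VR)"
      unfolding U(3) VR(2) by (simp add: algebra_simps)
    finally have "B * H = P * (smult (lead_coeff R ^ k) V - A * VR)" .
    moreover have lkC: "lead_coeff R ^ k \<in> C" using RC by (intro power_mem CX_coeff)
    moreover from this have "smult (lead_coeff R ^ k) V - A * VR \<in> CX"
      using * VR U by (intro CX_diff CX_mult CX_smult)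
    ultimately have "B \<in> J" if "B \<noteq> 0" using *(2) that unfolding J_def by blast
    then have "B = 0" using *(4) min[of B] R(2) by linarith
    then show ?thesis using * R0 lkC
      by (intro exI[of _ "lead_coeff R ^ k"] exI[of _ A]) auto
  qed
  obtain c A where cA: "c \<in> C" "c \<noteq> 0" "A \<in> CX" "smult c P = A * R"
    using divR[of P H] P GH by (auto simp: mult.commute)
  obtain a b A' R' where s: "a \<in> C" "b \<in> C" "c = a * b" "A = smult a A'" "R = smult b R'" "P = A' * R'" "A' \<in> CX" "R' \<in> CX"
    using smult_split[OF cA(1,2,4) P(2) cA(3) RC] by blast
  have unit_dvd: "P dvd E" if E: "smult r E = P * Q" "r \<in> C" "r \<noteq> 0" "E \<in> CX" "Q \<in> CX" for E Q r
  proof -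
    obtain x y P' Q' where *: "x \<in> C" "P = smult x P'" "E = P' * Q'"
      using smult_split[OF E(2,3,1,4) P(2) E(5)] by blast
    have "P = [:x:] * P'" using * by simp
    then have "[:x:] dvd 1 \<or> P' dvd 1" using P(1) irreducibleD by blast
    then have "[:x:] dvd 1"
    proof
      assume "P' dvd 1"
      then have "degree P' = 0" by (auto simp: is_unit_poly_iff)
      then have "degree P = 0" using * by simp
      then show ?thesis using P by simp
    qed
    then obtain y where "1 = [:x:] * y" by (auto simp: dvd_def)
    have "P * y = ([:x:] * y) * P'" unfolding \<open>P = [:x:] * P'\<close> by (simp only: ac_simps)
    then have "P' = P * y" unfolding \<open>1 = [:x:] * y\<close>[symmetric] by simp
    then have "P dvd P'" by (rule dvdI)
    then show ?thesis unfolding \<open>E = P' * Q'\<close> by (rule dvd_mult2)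
  qed
  have "A' dvd 1 \<or> R' dvd 1" using P(1) s(6) irreducibleD by blast
  then show ?thesis
  proof
    assume "R' dvd 1"
    then have "degree R' = 0" by (auto simp: is_unit_poly_iff)
    then have "degree R = 0" using s by simp
    then obtain r where r: "R = [:r:]" by (metis degree_eq_zeroE)
    have "r \<in> C" "r \<noteq> 0" using CX_coeff[OF RC, of 0] R0 r by auto
    moreover have "smult r H = P * VR" using VR r by simp
    ultimately have "P dvd H" using unit_dvd GH VR by blast
    then show ?thesis by blast
  next
    assume "A' dvd 1"
    then obtain a' where a': "A' = [:a':]" "a' dvd 1" by (auto simp: is_unit_poly_iff)
    then obtain a'' where "1 = a' * a''" by (auto simp: dvd_def)
    then have R'P: "R' = smult a'' P" unfolding s(6) a'(1) by (simp add: mult.commute)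
    obtain u B where uB: "u \<in> C" "u \<noteq> 0" "B \<in> CX" "smult u G = B * R"
      using divR[of G K] GH by blast
    have "smult u G = P * smult (b * a'') B" using uB(4) unfolding s(5) R'P by (simp add: mult.commute)
    moreover have "smult (b * a'') B \<in> CX"
    proof -
      have a'C: "a' \<in> C" using CX_coeff[OF s(7), of 0] a' by simp
      then have "a'' \<in> C" using factor_mem[of a'' a'] one_mem \<open>1 = a' * a''\<close>
        by (metis mult.commute zero_neq_one)
      then show ?thesis using s uB by (intro CX_smult mult_mem)
    qed
    ultimately have "P dvd G" using unit_dvd uB GH by blast
    then show ?thesis by blast
  qed
qed

end

section \<open>Unique factorization in countably many variables\<close>

lemma poly_hom_ext:
  fixes h :: "'a::comm_ring_1 poly \<Rightarrow> 'b::comm_ring_1"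
  assumes "comm_ring_hom h" "comm_ring_hom h'"
    and "\<And>a. h [:a:] = h' [:a:]" "h [:0, 1:] = h' [:0, 1:]"
  shows "h = h'"
proof
  interpret h: comm_ring_hom h by fact
  interpret h': comm_ring_hom h' by fact
  fix p
  show "h p = h' p"
  proof (induction p rule: pCons_induct)
    case (pCons a p)
    have "pCons a p = [:a:] + [:0, 1:] * p" by simp
    then show ?case using pCons assms(3,4) by (metis h.hom_add h.hom_mult h'.hom_add h'.hom_mult)
  qed simp
qed

definition plift :: "('a::comm_ring_1 \<Rightarrow> 'b::comm_ring_1) \<Rightarrow> 'b \<Rightarrow> 'a poly \<Rightarrow> 'b" where
  "plift h x p = poly (map_poly h p) x"

lemma plift_hom: "comm_ring_hom h \<Longrightarrow> comm_ring_hom (plift h x)"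
  unfolding plift_def by (intro comm_ring_hom_comp[OF map_poly_hom poly_at_hom])

lemma plift_0 [simp]: "plift h x 0 = 0"
  by (simp add: plift_def)

lemma (in comm_ring_hom) plift_pCons [simp]: "plift hom x (pCons a p) = hom a + x * plift hom x p"
  by (simp add: plift_def map_poly_pCons_hom)

lemma meval_hom: "comm_ring_hom c \<Longrightarrow> comm_ring_hom (meval c s)"
  by (rule comm_ring_hom.meval_hom)

lemma meval_Const': "comm_ring_hom c \<Longrightarrow> meval c s (Const a) = c a"
  by (rule comm_ring_hom.meval_Const)

lemma meval_Var': "comm_ring_hom c \<Longrightarrow> meval c s (Var i) = s i"
  by (rule comm_ring_hom.meval_Var)

lemma Const_poly_hom: "comm_ring_hom (\<lambda>a. [:Const a :: ('i, 'c::comm_ring_1) mpoly:])"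
  by (rule comm_ring_hom_comp[OF Const_hom const_poly_hom])

text \<open>
  Substituting \<open>T x\<^sub>i\<close> for \<open>x\<^sub>i\<close>, \<open>i \<in> S\<close>, turns degrees in the variables \<open>S\<close> into the degree in \<open>T\<close>.
\<close>

definition scale :: "'i set \<Rightarrow> ('i, 'c::comm_ring_1) mpoly \<Rightarrow> ('i, 'c) mpoly poly" where
  "scale S = meval (\<lambda>a. [:Const a:]) (\<lambda>i. if i \<in> S then [:0, Var i:] else [:Var i:])"

lemma scale_hom: "comm_ring_hom (scale S)"
  unfolding scale_def by (rule meval_hom[OF Const_poly_hom])

lemma scale_add: "scale S (p + q) = scale S p + scale S q"
  by (simp add: scale_def comm_ring_hom.meval_add[OF Const_poly_hom])

lemma scale_mult: "scale S (p * q) = scale S p * scale S q"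
  by (simp add: scale_def comm_ring_hom.meval_mult[OF Const_poly_hom])

lemma scale_0 [simp]: "scale S 0 = 0"
  by (simp add: scale_def comm_ring_hom.meval_0[OF Const_poly_hom])

text \<open>The equation \<open>kill S p = p\<close> encodes that \<open>p\<close> is free of the
  variables in \<open>S\<close>; as the fixed points of a ring endomorphism these polynomials form a
  subring inside the same type.\<close>

definition kill :: "'i set \<Rightarrow> ('i, 'c::comm_ring_1) mpoly \<Rightarrow> ('i, 'c) mpoly" where
  "kill S = meval Const (\<lambda>i. if i \<in> S then 0 else Var i)"

lemma kill_hom: "comm_ring_hom (kill S)"
  unfolding kill_def by (rule meval_hom[OF Const_hom])

lemma kill_Const [simp]: "kill S (Const a) = Const a"
  by (simp add: kill_def meval_Const' Const_hom)

lemma kill_Var [simp]: "kill S (Var i) = (if i \<in> S then 0 else Var i)"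
  by (simp add: kill_def meval_Var' Const_hom)

lemma kill_0 [simp]: "kill S 0 = 0"
  by (simp add: kill_def comm_ring_hom.meval_0[OF Const_hom])

lemma kill_mult: "kill S (p * q) = kill S p * kill S q"
  by (simp add: kill_def comm_ring_hom.meval_mult[OF Const_hom])

lemma poly_scale_1: "poly (scale S p) 1 = p"
proof -
  have "(\<lambda>p. poly (scale S p) 1) = (\<lambda>p. p)"
    by (rule hom_ext[OF comm_ring_hom_comp[OF scale_hom poly_at_hom] comm_ring_hom_id])
      (auto simp: scale_def meval_Const' meval_Var' Const_poly_hom)
  then show ?thesis by (rule fun_cong)
qed

lemma poly_scale_0: "poly (scale S p) 0 = kill S p"
proof -
  have "(\<lambda>p. poly (scale S p) 0) = kill S"
    by (rule hom_ext[OF comm_ring_hom_comp[OF scale_hom poly_at_hom] kill_hom])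
      (auto simp: scale_def kill_def meval_Const' meval_Var' Const_poly_hom Const_hom)
  then show ?thesis by (rule fun_cong)
qed

lemma scale_kill: "scale S (kill S p) = [:kill S p:]"
proof -
  have "(\<lambda>p. scale S (kill S p)) = (\<lambda>p. [:kill S p:])"
    by (rule hom_ext[OF comm_ring_hom_comp[OF kill_hom scale_hom] comm_ring_hom_comp[OF kill_hom const_poly_hom]])
      (auto simp: scale_def kill_def meval_Const' meval_Var' Const_poly_hom Const_hom comm_ring_hom.meval_0)
  then show ?thesis by (rule fun_cong)
qed

text \<open>\<open>scale S\<close> turns the product into a constant in \<open>T\<close>. Degrees in
  \<open>T\<close> add, so \<open>scale S g\<close> is constant as well and its values
  \<open>g\<close> at \<open>1\<close> and \<open>kill S g\<close> at \<open>0\<close>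
  agree.\<close>

lemma kill_factor:
  fixes g h :: "('i::linorder, 'c::idom) mpoly"
  assumes "kill S (g * h) = g * h" "g * h \<noteq> 0"
  shows "kill S g = g"
proof -
  interpret comm_ring_hom "scale S" by (rule scale_hom)
  have "scale S g * scale S h = [:g * h:]"
    using scale_kill[of S "g * h"] assms(1) by (simp add: hom_mult)
  moreover from this assms have "scale S g \<noteq> 0" "scale S h \<noteq> 0" by auto
  ultimately have "degree (scale S g) = 0" by (metis add_is_0 degree_mult_eq degree_pCons_0)
  then obtain a where "scale S g = [:a:]" by (metis degree_eq_zeroE)
  then show ?thesis using poly_scale_1[of S g] poly_scale_0[of S g] by simp
qed

section \<open>Total degree as a univariate degree\<close>

lemma mon_eval_poly: "mon_eval (\<lambda>i. [:0, s i:]) m = monom (mon_eval s m) (monom_degree m)"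
proof -
  have "[:0, s i:] ^ n = monom (s i ^ n) n" for i n
    by (metis monom_0 monom_Suc monom_power One_nat_def mult_1)
  then have "mon_eval (\<lambda>i. [:0, s i:]) m = (\<Prod>i\<in>keys m. monom (s i ^ lookup m i) (lookup m i))"
    by (simp add: mon_eval_def)
  also have "\<dots> = monom (mon_eval s m) (monom_degree m)"
    unfolding mon_eval_def monom_degree_def
    by (induction rule: infinite_finite_induct) (auto simp: mult_monom monom_0)
  finally show ?thesis .
qed

lemma scale_single: "scale UNIV (single m a) = monom (single m a) (monom_degree m)"
proof -
  have "scale UNIV (single m a) = [:Const a:] * monom (mon_eval Var m) (monom_degree m)"
    unfolding scale_def by (simp add: comm_ring_hom.meval_single[OF Const_poly_hom] mon_eval_poly)
  then show ?thesis by (simp add: smult_monom single_eq_Const_mon_eval[of m a])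
qed

lemma lookup_coeff_scale:
  "lookup (coeff (scale UNIV p) j) m = (if monom_degree m = j then lookup p m else 0)"
proof (induction p rule: mpoly_induct)
  case (single m' c)
  then show ?case by (auto simp: scale_single lookup_single when_def)
next
  case (add p q)
  then show ?case by (simp add: scale_add lookup_add)
qed

text \<open>As a degree in \<open>T\<close>, the total degree inherits additivity on products from
  univariate polynomials.\<close>

definition tdeg :: "('i, 'c::comm_ring_1) mpoly \<Rightarrow> nat" where
  "tdeg p = degree (scale UNIV p)"

lemma scale_eq_0_iff: "scale S p = 0 \<longleftrightarrow> p = 0"
  using poly_scale_1[of S p] by auto

lemma monom_degree_le_tdeg: "m \<in> keys p \<Longrightarrow> monom_degree m \<le> tdeg p"
  unfolding tdeg_def
  by (rule le_degree) (metis lookup_coeff_scale lookup_zero in_keys_iff)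

lemma tdeg_eq_total_degree: "tdeg p = total_degree p"
proof (rule antisym)
  have fin: "finite (insert 0 (monom_degree ` keys p))" by simp
  show "total_degree p \<le> tdeg p"
    unfolding total_degree_def using fin by (subst Max_le_iff) (auto intro: monom_degree_le_tdeg)
  show "tdeg p \<le> total_degree p"
    unfolding tdeg_def
  proof (rule degree_le, intro allI impI, rule poly_mapping_eqI)
    fix j m assume "total_degree p < j"
    moreover have "monom_degree m \<le> total_degree p" if "m \<in> keys p"
      unfolding total_degree_def using that fin by (auto intro: Max_ge)
    ultimately have "monom_degree m \<noteq> j \<or> lookup p m = 0"
      by (metis in_keys_iff leD)
    then show "lookup (coeff (scale UNIV p) j) m = lookup 0 m"
      by (auto simp: lookup_coeff_scale)
  qed
qed

lemma tdeg_mult: "p \<noteq> 0 \<Longrightarrow> q \<noteq> 0 \<Longrightarrow> tdeg (p * q) = tdeg p + tdeg q" for p q :: "('i::linorder, 'c::idom) mpoly"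
  by (simp add: tdeg_def scale_mult degree_mult_eq scale_eq_0_iff)

lemma kill_UNIV: "\<exists>c. kill UNIV p = Const c"
proof -
  have "kill UNIV = (\<lambda>p. Const (meval (\<lambda>a. a) (\<lambda>_. 0) p))"
    by (rule hom_ext[OF kill_hom comm_ring_hom_comp[OF meval_hom[OF comm_ring_hom_id] Const_hom]])
      (auto simp: kill_def meval_Const' meval_Var' Const_hom comm_ring_hom_id comm_ring_hom.meval_0, simp add: Const_def)
  then show ?thesis by metis
qed

lemma tdeg_0_imp_Const: "tdeg p = 0 \<Longrightarrow> \<exists>c. p = Const c"
  unfolding tdeg_def
  by (metis degree_eq_zeroE kill_UNIV poly_scale_0 poly_scale_1 poly_const_conv)

lemma Const_unit: "c \<noteq> 0 \<Longrightarrow> Const c dvd 1" for c :: "'c::field"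
  by (rule dvdI[of _ _ "Const (inverse c)"]) (simp add: Const_def mult_single single_one)

text \<open>
  The isomorphism of \<open>K[x\<^sub>0, x\<^sub>1, \<dots>]\<close> with its own univariate polynomial ring that sends \<open>x\<^sub>0\<close> to
  the new indeterminate and \<open>x\<close>\<open>\<^sub>i\<^sub>+\<^sub>1\<close> to \<open>x\<^sub>i\<close>.
\<close>

definition Theta :: "(nat, 'c::comm_ring_1) mpoly \<Rightarrow> (nat, 'c) mpoly poly" where
  "Theta = meval (\<lambda>a. [:Const a:]) (\<lambda>j. case j of 0 \<Rightarrow> [:0, 1:] | Suc i \<Rightarrow> [:Var i:])"

definition Theta_inv :: "(nat, 'c::comm_ring_1) mpoly poly \<Rightarrow> (nat, 'c) mpoly" where
  "Theta_inv = plift (meval Const (\<lambda>i. Var (Suc i))) (Var 0)"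

lemma Theta_hom: "comm_ring_hom Theta"
  unfolding Theta_def by (rule meval_hom[OF Const_poly_hom])

lemma Theta_inv_hom: "comm_ring_hom Theta_inv"
  unfolding Theta_inv_def by (rule plift_hom[OF meval_hom[OF Const_hom]])

lemma Theta_Const [simp]: "Theta (Const a) = [:Const a:]"
  by (simp add: Theta_def meval_Const' Const_poly_hom)

lemma Theta_Var0 [simp]: "Theta (Var 0) = [:0, 1:]"
  by (simp add: Theta_def meval_Var' Const_poly_hom)

lemma Theta_Var_Suc [simp]: "Theta (Var (Suc i)) = [:Var i:]"
  by (simp add: Theta_def meval_Var' Const_poly_hom)

lemma Theta_inv_Theta [simp]: "Theta_inv (Theta p) = p"
proof -
  interpret h: comm_ring_hom "meval Const (\<lambda>i. Var (Suc i)) :: (nat, 'a) mpoly \<Rightarrow> (nat, 'a) mpoly"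
    by (rule meval_hom[OF Const_hom])
  have "(\<lambda>p. Theta_inv (Theta p)) = (\<lambda>p::(nat, 'a) mpoly. p)"
    by (rule hom_ext[OF comm_ring_hom_comp[OF Theta_hom Theta_inv_hom] comm_ring_hom_id])
      (auto simp: Theta_def Theta_inv_def meval_Const' meval_Var' Const_poly_hom Const_hom comm_ring_hom.meval_0[OF Const_hom] split: nat.splits)
  then show ?thesis by (rule fun_cong)
qed

lemma Theta_Theta_inv [simp]: "Theta (Theta_inv P) = P"
proof -
  interpret h: comm_ring_hom "meval Const (\<lambda>i. Var (Suc i)) :: (nat, 'a) mpoly \<Rightarrow> (nat, 'a) mpoly"
    by (rule meval_hom[OF Const_hom])
  have 1: "(\<lambda>p. Theta (meval Const (\<lambda>i. Var (Suc i)) p)) = (\<lambda>p::(nat, 'a) mpoly. [:p:])"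
    by (rule hom_ext[OF comm_ring_hom_comp[OF h.comm_ring_hom_axioms Theta_hom] const_poly_hom])
      (auto simp: Theta_def meval_Const' meval_Var' Const_poly_hom Const_hom)
  have "(\<lambda>p. Theta (Theta_inv p)) = (\<lambda>p::(nat, 'a) mpoly poly. p)"
    by (rule poly_hom_ext[OF comm_ring_hom_comp[OF Theta_inv_hom Theta_hom] comm_ring_hom_id])
      (simp_all add: Theta_inv_def fun_cong[OF 1] Theta_Var0)
  then show ?thesis by (rule fun_cong)
qed

lemma Theta_kill: "Theta (kill {Suc N..} p) = map_poly (kill {N..}) (Theta p)"
proof -
  interpret k: comm_ring_hom "kill {N..} :: (nat, 'a) mpoly \<Rightarrow> (nat, 'a) mpoly" by (rule kill_hom)
  interpret Th: comm_ring_hom "Theta :: (nat, 'a) mpoly \<Rightarrow> _" by (rule Theta_hom)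
  have "Theta (kill {Suc N..} (Var i :: (nat, 'a) mpoly)) = map_poly (kill {N..}) (Theta (Var i))" for i :: nat
    by (cases i) (auto simp: k.map_poly_pCons_hom)
  then have "(\<lambda>p. Theta (kill {Suc N..} p)) = (\<lambda>p::(nat, 'a) mpoly. map_poly (kill {N..}) (Theta p))"
    by (intro hom_ext comm_ring_hom_comp[OF kill_hom Theta_hom] comm_ring_hom_comp[OF Theta_hom map_poly_hom[OF kill_hom]])
      (auto simp: k.map_poly_pCons_hom)
  then show ?thesis by (rule fun_cong)
qed

lemma kill_cofinite: "\<exists>N. \<forall>M\<ge>N. kill {M..} p = p" for p :: "(nat, 'c::comm_ring_1) mpoly"
proof (induction p rule: mpoly_induct)
  case (single m c)
  obtain N where N: "\<forall>i\<in>keys m. i < N"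
    by (metis finite_keys finite_nat_set_iff_bounded)
  have "kill {M..} (single m c) = single m c" if "M \<ge> N" for M
  proof -
    have "mon_eval (\<lambda>i. if i \<in> {M..} then 0 else Var i) m = (mon_eval Var m :: (nat, 'c) mpoly)"
      unfolding mon_eval_def using N that by (intro prod.cong) auto
    then show ?thesis
      by (simp only: kill_def comm_ring_hom.meval_single[OF Const_hom] single_eq_Const_mon_eval[of m c, symmetric])
  qed
  then show ?case by blast
next
  case (add p q)
  then obtain N N' where "\<forall>M\<ge>N. kill {M..} p = p" "\<forall>M\<ge>N'. kill {M..} q = q" by blast
  then show ?case
    by (intro exI[of _ "max N N'"]) (auto simp: kill_def comm_ring_hom.meval_add[OF Const_hom])
qed

text \<open>Units satisfy this condition too, so a factorization may list its unit among the
  primes.\<close>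

definition prime_on :: "nat \<Rightarrow> (nat, 'c::comm_ring_1) mpoly \<Rightarrow> bool" where
  "prime_on N f \<longleftrightarrow> (\<forall>g h. kill {N..} g = g \<longrightarrow> kill {N..} h = h \<longrightarrow> f dvd g * h \<longrightarrow> f dvd g \<or> f dvd h)"

lemma prime_on_factorization:
  fixes c :: "(nat, 'c::field) mpoly"
  assumes "\<And>f :: (nat, 'c) mpoly. kill {N..} f = f \<Longrightarrow> irreducible f \<Longrightarrow> prime_on N f"
    and "kill {N..} c = c" "c \<noteq> 0"
  shows "\<exists>ps. (\<forall>p\<in>set ps. kill {N..} p = p \<and> p \<noteq> 0 \<and> prime_on N p) \<and> c = prod_list ps"
  using assms(2,3)
proof (induction "tdeg c" arbitrary: c rule: less_induct)
  case less
  consider "c dvd 1" | "irreducible c" |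
    a b where "c = a * b" "\<not> a dvd 1" "\<not> b dvd 1"
    using less.prems by (auto simp: comm_semiring_1_class.irreducible_def)
  then show ?case
  proof cases
    case 1
    then have "prime_on N c" unfolding prime_on_def by (meson dvd_trans one_dvd)
    then show ?thesis using less.prems by (intro exI[of _ "[c]"]) auto
  next
    case 2
    then show ?thesis using less.prems assms(1) by (intro exI[of _ "[c]"]) auto
  next
    case (3 a b)
    have ab: "a \<noteq> 0" "b \<noteq> 0" using less.prems 3 by auto
    have pos: "tdeg a > 0" "tdeg b > 0"
      using 3 ab tdeg_0_imp_Const[of a] tdeg_0_imp_Const[of b] Const_unit
      by (metis bot_nat_0.not_eq_extremum Const_def single_zero)+
    have lt: "tdeg a < tdeg c" "tdeg b < tdeg c"
      using tdeg_mult[OF ab] pos 3 by auto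
    have ka: "kill {N..} a = a" using kill_factor[of "{N..}" a b] less.prems 3 by simp
    have kb: "kill {N..} b = b" using kill_factor[of "{N..}" b a] less.prems 3 by (simp add: mult.commute)
    from less.hyps[OF lt(1) ka ab(1)] less.hyps[OF lt(2) kb ab(2)] obtain ps qs where
      "\<forall>p\<in>set ps. kill {N..} p = p \<and> p \<noteq> 0 \<and> prime_on N p" "a = prod_list ps"
      "\<forall>p\<in>set qs. kill {N..} p = p \<and> p \<noteq> 0 \<and> prime_on N p" "b = prod_list qs" by blast
    then show ?thesis using 3 by (intro exI[of _ "ps @ qs"]) auto
  qed
qed

lemma factorial_subring_kill:
  assumes "\<And>f :: (nat, 'c::field) mpoly. kill {N..} f = f \<Longrightarrow> irreducible f \<Longrightarrow> prime_on N f"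
  shows "factorial_subring {g :: (nat, 'c) mpoly. kill {N..} g = g}"
proof -
  interpret comm_ring_hom "kill {N..} :: (nat, 'c) mpoly \<Rightarrow> _" by (rule kill_hom)
  show ?thesis
  proof
    fix c :: "(nat, 'c) mpoly" assume "c \<in> {g. kill {N..} g = g}" "c \<noteq> 0"
    then have "kill {N..} c = c" by simp
    from prime_on_factorization[OF assms this \<open>c \<noteq> 0\<close>]
    show "\<exists>ps. (\<forall>p\<in>set ps. p \<in> {g. kill {N..} g = g} \<and> p \<noteq> 0 \<and>
          (\<forall>a\<in>{g. kill {N..} g = g}. \<forall>b\<in>{g. kill {N..} g = g}. p dvd a * b \<longrightarrow> p dvd a \<or> p dvd b)) \<and>
         c = prod_list ps"
      by (simp add: prime_on_def)
  next
    fix a b :: "(nat, 'c) mpoly"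
    assume "a * b \<in> {g. kill {N..} g = g}" "a * b \<noteq> 0"
    then show "a \<in> {g. kill {N..} g = g}" using kill_factor by blast
  qed (auto simp: hom_add hom_mult hom_uminus)
qed

text \<open>\<open>Theta\<close> makes \<open>x_0\<close> the indeterminate and leaves coefficients
  in \<open>N\<close> variables, which form a factorial subring by the induction hypothesis. A
  constant image of \<open>f\<close> is a prime constant and is handled by
  \<open>Cprime_poly\<close>; an image of positive degree by
  \<open>gauss_irreducible_imp_prime\<close>. For \<open>N = 0\<close> only constants remain, and
  none is irreducible.\<close>

lemma irreducible_imp_prime_on:
  fixes f :: "(nat, 'c::field) mpoly"
  assumes "kill {N..} f = f" "irreducible f"
  shows "prime_on N f"
  using assms
proof (induction N arbitrary: f)
  case 0
  have "{0..} = (UNIV :: nat set)" by auto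
  then obtain c where c: "f = Const c" using 0 kill_UNIV[of f] by auto
  have "f \<noteq> 0" "\<not> f dvd 1" using 0 by (auto simp: comm_semiring_1_class.irreducible_def)
  moreover from this have "c \<noteq> 0" using c by (auto simp: Const_def)
  then have "(Const c :: (nat, 'c) mpoly) dvd 1" by (rule Const_unit)
  ultimately show ?case using c by blast
next
  case (Suc N)
  interpret factorial_subring "{g :: (nat, 'c) mpoly. kill {N..} g = g}"
    by (rule factorial_subring_kill[OF Suc.IH])
  interpret Th: comm_ring_hom "Theta :: (nat, 'c) mpoly \<Rightarrow> _" by (rule Theta_hom)
  interpret Ti: comm_ring_hom "Theta_inv :: (nat, 'c) mpoly poly \<Rightarrow> _" by (rule Theta_inv_hom)
  interpret k: comm_ring_hom "kill {N..} :: (nat, 'c) mpoly \<Rightarrow> _" by (rule kill_hom)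
  have CX_Theta: "Theta p \<in> CX" if "kill {Suc N..} p = p" for p :: "(nat, 'c) mpoly"
  proof -
    have "map_poly (kill {N..}) (Theta p) = Theta p" using Theta_kill[of N p] that by simp
    then have "kill {N..} (coeff (Theta p) i) = coeff (Theta p) i" for i
      using k.coeff_map_poly_hom[of "Theta p" i] by simp
    then show ?thesis by (simp add: CX_def)
  qed
  have dvd_Theta: "f dvd g" if "Theta f dvd Theta g" for g
    using Ti.hom_dvd[OF that] by simp
  have irr: "irreducible (Theta f)"
    by (rule irreducible_iso[OF Theta_hom Theta_inv_hom]) (simp_all add: Suc.prems)
  show ?case
    unfolding prime_on_def
  proof (intro allI impI)
    fix g h :: "(nat, 'c) mpoly"
    assume g: "kill {Suc N..} g = g" and h: "kill {Suc N..} h = h" and "f dvd g * h"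
    then obtain k where k: "g * h = f * k" by (auto simp: dvd_def)
    show "f dvd g \<or> f dvd h"
    proof (cases "g * h = 0")
      case False
      have "kill {Suc N..} (g * h) = g * h"
        using g h by (simp add: kill_mult)
      then have "kill {Suc N..} k = k"
        using kill_factor[of "{Suc N..}" k f] False k by (simp add: mult.commute)
      then have mem: "Theta f \<in> CX" "Theta g \<in> CX" "Theta h \<in> CX" "Theta k \<in> CX"
        using CX_Theta g h Suc.prems by auto
      have eq: "Theta g * Theta h = Theta f * Theta k" using arg_cong[OF k, of Theta] by (simp only: Th.hom_mult)
      show ?thesis
      proof (cases "degree (Theta f) = 0")
        case True
        then obtain p where p: "Theta f = [:p:]" by (metis degree_eq_zeroE)
        have pC: "kill {N..} p = p" using CX_coeff[OF mem(1), of 0] p by simp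
        have "irreducible p"
        proof (rule comm_semiring_1_class.irreducibleI)
          show "p \<noteq> 0" "\<not> p dvd 1" using irr p by (auto simp: comm_semiring_1_class.irreducible_def is_unit_const_poly_iff)
          fix a b assume "p = a * b"
          then have "[:p:] = [:a:] * [:b:]" by simp
          then have "[:a:] dvd 1 \<or> [:b:] dvd 1" using comm_semiring_1_class.irreducibleD[OF irr[unfolded p]] by blast
          then show "a dvd 1 \<or> b dvd 1" by (simp add: is_unit_const_poly_iff)
        qed
        then have "Cprime p"
          using Suc.IH[OF pC] pC by (auto simp: Cprime_def prime_on_def)
        moreover have "[:p:] dvd Theta g * Theta h" unfolding eq p by (rule dvd_triv_left)
        ultimately have "Theta f dvd Theta g \<or> Theta f dvd Theta h"
          unfolding p using Cprime_poly[OF _ mem(2,3)] by blast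
        then show ?thesis using dvd_Theta by blast
      next
        case False
        then have "degree (Theta f) > 0" by simp
        from gauss_irreducible_imp_prime[OF irr mem(1) this mem(2,3,4) eq]
        show ?thesis using dvd_Theta by blast
      qed
    qed auto
  qed
qed

theorem irreducible_imp_prime_mpoly:
  fixes f :: "(nat, 'c::field) mpoly"
  assumes "irreducible f"
  shows "prime_elem f"
  unfolding prime_elem_def
proof (intro conjI allI impI)
  show "f \<noteq> 0" "\<not> f dvd 1" using assms by (auto simp: comm_semiring_1_class.irreducible_def)
  fix g h assume dvd: "f dvd g * h"
  obtain N1 N2 N3 where "\<forall>M\<ge>N1. kill {M..} f = f" "\<forall>M\<ge>N2. kill {M..} g = g" "\<forall>M\<ge>N3. kill {M..} h = h"
    using kill_cofinite by metis
  then have k: "kill {N1+N2+N3..} f = f" "kill {N1+N2+N3..} g = g" "kill {N1+N2+N3..} h = h" by auto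
  show "f dvd g \<or> f dvd h"
    using irreducible_imp_prime_on[OF k(1) assms] k dvd unfolding prime_on_def by blast
qed

section \<open>Filtrations and Sylvester determinants\<close>

abbreviation degree_upto :: "int \<Rightarrow> 'a::zero poly set" where
  "degree_upto n \<equiv> {p. \<forall>i. int i > n \<longrightarrow> coeff p i = 0}"

abbreviation flat_poly :: "('b \<Rightarrow> 'a::zero set) \<Rightarrow> 'b \<Rightarrow> 'a poly set" where
  "flat_poly F n \<equiv> {P. \<forall>i. coeff P i \<in> F n}"

abbreviation graded_poly :: "(int \<Rightarrow> 'a::zero set) \<Rightarrow> int \<Rightarrow> 'a poly set" where
  "graded_poly F n \<equiv> {P. \<forall>i. coeff P i \<in> F (n - int i)}"

abbreviation graded_fps :: "(int \<Rightarrow> 'a::zero set) \<Rightarrow> int \<Rightarrow> 'a fps set" where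
  "graded_fps F n \<equiv> {P. \<forall>i. fps_nth P i \<in> F (n + int i)}"

text \<open>Degree bounds throughout are memberships in some \<open>F n\<close>. The levels are
  integers because passing to the \<open>i\<close>-th coefficient lowers the level by
  \<open>i\<close>, possibly below zero, where a filtration by degree contains only
  \<open>0\<close>.\<close>

locale filtration =
  fixes F :: "int \<Rightarrow> 'a::comm_ring_1 set"
  assumes zero: "0 \<in> F n"
    and one: "1 \<in> F 0"
    and add: "a \<in> F n \<Longrightarrow> b \<in> F n \<Longrightarrow> a + b \<in> F n"
    and uminus: "a \<in> F n \<Longrightarrow> - a \<in> F n"
    and mult: "a \<in> F m \<Longrightarrow> b \<in> F n \<Longrightarrow> a * b \<in> F (m + n)"
    and mono: "m \<le> n \<Longrightarrow> F m \<subseteq> F n"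
begin

lemma sum: "(\<And>x. x \<in> A \<Longrightarrow> f x \<in> F n) \<Longrightarrow> sum f A \<in> F n"
  by (induction A rule: infinite_finite_induct) (auto intro: zero add)

lemma prod: "(\<And>x. x \<in> A \<Longrightarrow> f x \<in> F (w x)) \<Longrightarrow> prod f A \<in> F (sum w A)"
  by (induction A rule: infinite_finite_induct) (auto intro: one mult)

lemma power: "a \<in> F n \<Longrightarrow> a ^ k \<in> F (int k * n)"
proof (induction k)
  case (Suc k)
  then show ?case using mult[of a n "a ^ k" "int k * n"] by (simp add: algebra_simps)
qed (simp add: one)

text \<open>In the Leibniz formula each permutation meets every row weight and every column weight
  exactly once, so all its products lie in the same level.\<close>

lemma det:
  assumes "A \<in> carrier_mat n n" "\<And>i j. i < n \<Longrightarrow> j < n \<Longrightarrow> A $$ (i, j) \<in> F (r i + c j)"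
  shows "det A \<in> F ((\<Sum>i<n. r i) + (\<Sum>j<n. c j))"
  unfolding det_def'[OF assms(1)]
proof (rule sum)
  fix p assume "p \<in> {p. p permutes {0..<n}}"
  then have p: "p permutes {0..<n}" by simp
  have "(\<Prod>i = 0..<n. A $$ (i, p i)) \<in> F (\<Sum>i=0..<n. r i + c (p i))"
    by (rule prod) (use assms(2) permutes_in_image[OF p] in auto)
  also have "(\<Sum>i=0..<n. r i + c (p i)) = (\<Sum>i<n. r i) + (\<Sum>j<n. c j)"
    unfolding sum.distrib using sum.permute[OF p, of c] by (simp add: atLeast0LessThan o_def)
  finally show "signof p * (\<Prod>i = 0..<n. A $$ (i, p i)) \<in> F ((\<Sum>i<n. r i) + (\<Sum>j<n. c j))"
    by (auto simp: sign_def intro: uminus)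
qed

lemma poly_filtration: "filtration (graded_poly F)"
proof
  fix P Q m n
  assume P: "P \<in> graded_poly F m" and Q: "Q \<in> graded_poly F n"
  have "(\<Sum>j\<le>i. coeff P j * coeff Q (i - j)) \<in> F (m + n - int i)" for i
  proof (rule sum)
    fix j assume "j \<in> {..i}"
    then have "m - int j + (n - int (i - j)) = m + n - int i" by (simp add: of_nat_diff)
    moreover have "coeff P j * coeff Q (i - j) \<in> F (m - int j + (n - int (i - j)))"
      by (rule mult) (use P Q in auto)
    ultimately show "coeff P j * coeff Q (i - j) \<in> F (m + n - int i)" by (simp only:)
  qed
  then show "P * Q \<in> graded_poly F (m + n)" by (simp add: coeff_mult)
next
  show "1 \<in> graded_poly F 0" using one zero by (auto simp: coeff_1)
next
  fix m n :: int assume "m \<le> n"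
  then have "F (m - int i) \<subseteq> F (n - int i)" for i by (intro mono) simp
  then show "graded_poly F m \<subseteq> graded_poly F n" by blast
qed (auto intro: zero add uminus)

lemma fps_filtration: "filtration (graded_fps F)"
proof
  fix P Q m n
  assume P: "P \<in> graded_fps F m" and Q: "Q \<in> graded_fps F n"
  have "(\<Sum>j=0..i. fps_nth P j * fps_nth Q (i - j)) \<in> F (m + n + int i)" for i
  proof (rule sum)
    fix j assume "j \<in> {0..i}"
    then have "m + int j + (n + int (i - j)) = m + n + int i" by (simp add: of_nat_diff)
    moreover have "fps_nth P j * fps_nth Q (i - j) \<in> F (m + int j + (n + int (i - j)))"
      by (rule mult) (use P Q in auto)
    ultimately show "fps_nth P j * fps_nth Q (i - j) \<in> F (m + n + int i)" by (simp only:)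
  qed
  then show "P * Q \<in> graded_fps F (m + n)" by (simp add: fps_mult_nth)
next
  show "1 \<in> graded_fps F 0" using one zero by auto
next
  fix m n :: int assume "m \<le> n"
  then have "F (m + int i) \<subseteq> F (n + int i)" for i by (intro mono) simp
  then show "graded_fps F m \<subseteq> graded_fps F n" by blast
qed (auto intro: zero add uminus)

end

lemma degree_filtration: "filtration (degree_upto :: int \<Rightarrow> 'a::comm_ring_1 poly set)"
proof
  fix P Q :: "'a poly" and m n
  assume PQ: "P \<in> degree_upto m" "Q \<in> degree_upto n"
  have "(\<Sum>j\<le>i. coeff P j * coeff Q (i - j)) = 0" if "int i > m + n" for i
  proof (rule sum.neutral, rule ballI)
    fix j assume j: "j \<in> {..i}"
    then have "int j > m \<or> int (i - j) > n" using that by auto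
    then show "coeff P j * coeff Q (i - j) = 0" using PQ by auto
  qed
  then show "P * Q \<in> degree_upto (m + n)" by (auto simp: coeff_mult)
qed (auto simp: coeff_1)

section \<open>Sylvester matrices and the resultant\<close>

definition coeff_mat :: "nat \<Rightarrow> (nat \<Rightarrow> 'a::zero poly) \<Rightarrow> 'a mat" where
  "coeff_mat N q = mat N N (\<lambda>(i, l). coeff (q l) i)"

lemma coeff_mat_carrier [simp]: "coeff_mat N q \<in> carrier_mat N N"
  by (simp add: coeff_mat_def)

lemma coeff_mat_mult_vec:
  fixes q :: "nat \<Rightarrow> 'a::comm_ring_1 poly"
  assumes "i < N" "v \<in> carrier_vec N"
  shows "(coeff_mat N q *\<^sub>v v) $ i = coeff (\<Sum>l<N. smult (v $ l) (q l)) i"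
  using assms by (simp add: coeff_mat_def scalar_prod_def coeff_sum atLeast0LessThan mult.commute)

lemma sum_smult_eqI:
  fixes q :: "nat \<Rightarrow> 'a::comm_ring_1 poly"
  assumes "\<And>l. l < N \<Longrightarrow> degree (q l) < N" "v \<in> carrier_vec N"
    and "\<And>i. i < N \<Longrightarrow> (coeff_mat N q *\<^sub>v v) $ i = coeff p i" "degree p < N"
  shows "(\<Sum>l<N. smult (v $ l) (q l)) = p"
proof (rule poly_eqI)
  fix i
  show "coeff (\<Sum>l<N. smult (v $ l) (q l)) i = coeff p i"
  proof (cases "i < N")
    case True
    then show ?thesis using assms(3)[of i] coeff_mat_mult_vec[OF True assms(2)] by simp
  next
    case False
    then have "coeff (q l) i = 0" if "l < N" for l
      using assms(1)[OF that] by (intro coeff_eq_0) auto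
    moreover have "coeff p i = 0" using False assms(4) by (intro coeff_eq_0) auto
    ultimately show ?thesis by (simp add: coeff_sum)
  qed
qed

text \<open>Cramer's rule: the matrix sends the first column of its adjugate to the determinant
  times the first unit vector, which is the coefficient vector of a constant polynomial.\<close>

lemma coeff_mat_det_comb:
  fixes q :: "nat \<Rightarrow> 'a::comm_ring_1 poly"
  assumes "\<And>l. l < N \<Longrightarrow> degree (q l) < N" "N > 0"
  shows "\<exists>v. (\<Sum>l<N. smult (v l) (q l)) = [:det (coeff_mat N q):]"
proof -
  let ?A = "coeff_mat N q"
  define v where "v = col (adj_mat ?A) 0"
  have adj: "adj_mat ?A \<in> carrier_mat N N" "?A * adj_mat ?A = det ?A \<cdot>\<^sub>m 1\<^sub>m N"
    using adj_mat[OF coeff_mat_carrier] by auto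
  have v: "v \<in> carrier_vec N" using adj assms by (auto simp: v_def)
  have "(\<Sum>l<N. smult (v $ l) (q l)) = [:det ?A:]"
  proof (rule sum_smult_eqI[OF assms(1) v])
    fix i assume i: "i < N"
    have "(?A *\<^sub>v v) $ i = (?A * adj_mat ?A) $$ (i, 0)"
      using i adj(1) assms(2) by (simp add: v_def coeff_mat_def)
    then show "(?A *\<^sub>v v) $ i = coeff [:det ?A:] i"
      using i assms(2) by (simp add: adj(2) coeff_pCons split: nat.splits)
  qed (use assms in auto)
  then show ?thesis by blast
qed

lemma coeff_mat_det_0:
  fixes q :: "nat \<Rightarrow> 'a::idom poly"
  assumes "\<And>l. l < N \<Longrightarrow> degree (q l) < N" "N > 0" "det (coeff_mat N q) = 0"
  shows "\<exists>v. (\<exists>l<N. v l \<noteq> 0) \<and> (\<Sum>l<N. smult (v l) (q l)) = 0"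
proof -
  obtain v where v: "v \<in> carrier_vec N" "v \<noteq> 0\<^sub>v N" "coeff_mat N q *\<^sub>v v = 0\<^sub>v N"
    using assms(3) det_0_iff_vec_prod_zero[OF coeff_mat_carrier] by blast
  have "(\<Sum>l<N. smult (v $ l) (q l)) = 0"
    by (rule sum_smult_eqI[OF assms(1) v(1)]) (use v assms in auto)
  moreover have "\<exists>l<N. v $ l \<noteq> 0" using v by (metis carrier_vecD eq_vecI index_zero_vec)
  ultimately show ?thesis by blast
qed

text \<open>The columns of the Sylvester matrix: first the shifts of \<open>P\<close>, then those of
  \<open>G\<close>. Up to sign, \<open>sylvester_det\<close> is the resultant.\<close>

definition sylvester_poly :: "'a::comm_ring_1 poly \<Rightarrow> 'a poly \<Rightarrow> nat \<Rightarrow> 'a poly" where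
  "sylvester_poly P G l = (if l < degree G then monom 1 l * P else monom 1 (l - degree G) * G)"

definition sylvester_det :: "'a::comm_ring_1 poly \<Rightarrow> 'a poly \<Rightarrow> 'a" where
  "sylvester_det P G = det (coeff_mat (degree P + degree G) (sylvester_poly P G))"

lemma sylvester_poly_degree:
  fixes P G :: "'a::idom poly"
  assumes "l < degree P + degree G"
  shows "degree (sylvester_poly P G l) < degree P + degree G"
proof -
  have "degree (monom 1 k * Q) \<le> k + degree Q" for k and Q :: "'a poly"
    by (rule order_trans[OF degree_mult_le]) (simp add: degree_monom_eq)
  from this[of l P] this[of "l - degree G" G] show ?thesis
    using assms by (auto simp: sylvester_poly_def)
qed

lemma sum_lessThan_split: "(\<Sum>l<a + b. f l) = (\<Sum>l<b. f l) + (\<Sum>l<a. f (l + b))"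
  for f :: "nat \<Rightarrow> 'a::comm_monoid_add"
  by (induction a) (auto simp: algebra_simps)

lemma sylvester_poly_sum:
  "(\<Sum>l<degree P + degree G. smult (v l) (sylvester_poly P G l)) =
    (\<Sum>l<degree G. monom (v l) l) * P + (\<Sum>l<degree P. monom (v (l + degree G)) l) * G"
proof -
  have "(\<Sum>l<degree P + degree G. smult (v l) (sylvester_poly P G l)) =
    (\<Sum>l<degree G. smult (v l) (sylvester_poly P G l)) + (\<Sum>l<degree P. smult (v (l + degree G)) (sylvester_poly P G (l + degree G)))"
    by (rule sum_lessThan_split)
  also have "\<dots> = (\<Sum>l<degree G. monom (v l) l * P) + (\<Sum>l<degree P. monom (v (l + degree G)) l * G)"
    by (intro arg_cong2[where f="(+)"] sum.cong)
      (auto simp: sylvester_poly_def smult_monom simp flip: mult_smult_left)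
  finally show ?thesis by (simp add: sum_distrib_right)
qed

lemma sylvester_det_comb:
  fixes P G :: "'a::idom poly"
  assumes "degree P + degree G > 0"
  shows "\<exists>A B. A * P + B * G = [:sylvester_det P G:]"
  using coeff_mat_det_comb[of "degree P + degree G" "sylvester_poly P G", OF sylvester_poly_degree assms] unfolding sylvester_poly_sum sylvester_det_def by blast

lemma coeff_sum_monom: "coeff (\<Sum>l<n. monom (v l) l) i = (if i < n then v i else 0)"
  by (simp add: coeff_sum)

text \<open>A kernel vector of the Sylvester matrix is a relation \<open>U * P + V * G = 0\<close>
  with small cofactors. Here \<open>V = 0\<close> would give \<open>U * P = 0\<close>, hence
  \<open>U = 0\<close> and a zero kernel vector.\<close>

lemma sylvester_det_eq_0:
  fixes P G :: "'a::idom poly"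
  assumes "degree P > 0" "sylvester_det P G = 0" "G \<noteq> 0"
  shows "\<exists>U V. V \<noteq> 0 \<and> degree V < degree P \<and> U * P = V * G"
proof -
  have pos: "degree P + degree G > 0" using assms by simp
  obtain v where v: "\<exists>l<degree P + degree G. v l \<noteq> 0" "(\<Sum>l<degree P + degree G. smult (v l) (sylvester_poly P G l)) = 0"
    using coeff_mat_det_0[of "degree P + degree G" "sylvester_poly P G", OF sylvester_poly_degree pos] assms(2) unfolding sylvester_det_def by blast
  define U where "U = (\<Sum>l<degree G. monom (v l) l)"
  define V where "V = (\<Sum>l<degree P. monom (v (l + degree G)) l)"
  have eq: "U * P + V * G = 0" using v(2) unfolding sylvester_poly_sum U_def V_def .
  have cV: "coeff V i = (if i < degree P then v (i + degree G) else 0)" for i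
    unfolding V_def by (rule coeff_sum_monom[where v="\<lambda>l. v (l + degree G)"])
  have cU: "coeff U i = (if i < degree G then v i else 0)" for i
    unfolding U_def by (rule coeff_sum_monom)
  have "V \<noteq> 0"
  proof
    assume V0: "V = 0"
    then have "U = 0" using eq assms(1) by auto
    obtain l where l: "l < degree P + degree G" "v l \<noteq> 0" using v by blast
    show False
    proof (cases "l < degree G")
      case True
      then show ?thesis using cU[of l] \<open>U = 0\<close> l by simp
    next
      case False
      then have "l - degree G < degree P" "l - degree G + degree G = l" using l by auto
      then show ?thesis using cV[of "l - degree G"] V0 l by simp
    qed
  qed
  moreover have "degree V < degree P"
    by (rule degree_lessI) (use assms cV in auto)
  moreover have "(- U) * P = V * G" using eq by (simp add: add_eq_0_iff)
  ultimately show ?thesis by blast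
qed

context filtration
begin

lemma sylvester_det_bound:
  assumes "\<And>i. coeff P i \<in> F e" "\<And>i. coeff G i \<in> F e"
  shows "sylvester_det P G \<in> F (int (degree P + degree G) * e)"
proof -
  have *: "coeff (monom 1 k * Q) i \<in> F e" if "\<And>i. coeff Q i \<in> F e" for Q k i
    using that zero by (simp add: coeff_monom_mult)
  have "sylvester_det P G \<in> F ((\<Sum>i<degree P + degree G. e) + (\<Sum>j<degree P + degree G. 0))"
    unfolding sylvester_det_def by (rule det[OF coeff_mat_carrier]) (auto simp: coeff_mat_def sylvester_poly_def intro!: * assms)
  then show ?thesis by simp
qed

text \<open>Row \<open>i\<close> gets weight \<open>- i\<close>, a column the level of its shifted
  polynomial. The triangular sums of the shifts cancel except for the product of the two degrees.
  For \<open>a = degree P\<close> what remains is Bezout's \<open>degree P * b\<close>.\<close>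

lemma sylvester_det_graded_bound:
  assumes "\<And>i. coeff P i \<in> F (a - int i)" "\<And>i. coeff G i \<in> F (b - int i)"
  shows "sylvester_det P G \<in> F (int (degree G) * a + int (degree P) * b - int (degree G) * int (degree P))"
proof -
  define d e where "d = degree P" and "e = degree G"
  define c where "c l = (if l < e then a + int l else b + int (l - e))" for l
  have *: "coeff (monom 1 k * Q) i \<in> F (a + int k - int i)" if "\<And>i. coeff Q i \<in> F (a - int i)" for Q k i a
  proof (cases "k \<le> i")
    case True
    then have "a + int k - int i = a - int (i - k)" by (simp add: of_nat_diff)
    then show ?thesis using that[of "i - k"] True by (simp only: coeff_monom_mult) simp
  next
    case False
    then show ?thesis by (simp add: coeff_monom_mult zero)
  qed
  have "sylvester_det P G \<in> F ((\<Sum>i<d + e. - int i) + (\<Sum>j<d + e. c j))"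
    unfolding sylvester_det_def d_def[symmetric] e_def[symmetric]
  proof (rule det[OF coeff_mat_carrier])
    fix i j assume "i < d + e" "j < d + e"
    then show "coeff_mat (d + e) (sylvester_poly P G) $$ (i, j) \<in> F (- int i + c j)"
      using *[of P a j i] *[of G b "j - e" i] assms
      by (auto simp: coeff_mat_def sylvester_poly_def c_def e_def)
  qed
  also have "(\<Sum>j<d + e. c j) = (\<Sum>j<e. a + int j) + (\<Sum>j<d. b + int j)"
  proof (induction d)
    case 0
    show ?case by (simp add: c_def)
  next
    case (Suc d)
    then show ?case by (simp add: c_def)
  qed
  also have "(\<Sum>i<d + e. - int i) + ((\<Sum>j<e. a + int j) + (\<Sum>j<d. b + int j)) = int e * a + int d * b - int e * int d"
    by (induction d) (auto simp: sum.distrib sum_negf algebra_simps)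
  finally show ?thesis by (simp add: d_def e_def)
qed

end

section \<open>Minors, degrees and zeros\<close>

text \<open>A nonzero minor is enlarged one row at a time. Expanded along its last row
  \<open>r\<close>, the larger determinant is a combination of the entries of row \<open>r\<close>
  with cofactors independent of \<open>r\<close>. The last cofactor is the smaller minor, so
  independence of the columns supplies a row where the combination is nonzero.\<close>

lemma nonzero_minor:
  fixes c :: "nat \<Rightarrow> nat \<Rightarrow> 'a::idom"
  assumes "\<And>v. \<exists>l<M. v l \<noteq> 0 \<Longrightarrow> \<exists>r<R. (\<Sum>l<M. v l * c l r) \<noteq> 0"
  shows "\<exists>\<rho>. inj_on \<rho> {..<M} \<and> \<rho> ` {..<M} \<subseteq> {..<R} \<and> det (mat M M (\<lambda>(i, l). c l (\<rho> i))) \<noteq> 0"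
  using assms
proof (induction M)
  case 0
  then show ?case by (intro exI[of _ id]) (auto simp: det_dim_zero)
next
  case (Suc M)
  have "\<exists>r<R. (\<Sum>l<M. v l * c l r) \<noteq> 0" if "\<exists>l<M. v l \<noteq> 0" for v
  proof -
    have "\<exists>l<Suc M. (v(M := 0)) l \<noteq> 0" using that by (auto intro: less_SucI)
    from Suc.prems[OF this] obtain r where "r < R" "(\<Sum>l<Suc M. (v(M := 0)) l * c l r) \<noteq> 0" by blast
    moreover have "(\<Sum>l<Suc M. (v(M := 0)) l * c l r) = (\<Sum>l<M. v l * c l r)"
      unfolding sum.lessThan_Suc by (simp cong: sum.cong_simp)
    ultimately show ?thesis by auto
  qed
  then obtain \<rho> where \<rho>: "inj_on \<rho> {..<M}" "\<rho> ` {..<M} \<subseteq> {..<R}" "det (mat M M (\<lambda>(i, l). c l (\<rho> i))) \<noteq> 0"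
    using Suc.IH by blast
  define A where "A r = mat (Suc M) (Suc M) (\<lambda>(i, l). c l (if i < M then \<rho> i else r))" for r
  define v where "v l = cofactor (A 0) M l" for l
  have A: "A r \<in> carrier_mat (Suc M) (Suc M)" for r by (simp add: A_def)
  have cof: "cofactor (A r) M l = v l" if "l < Suc M" for r l
    unfolding v_def cofactor_def mat_delete_def by (intro arg_cong[where f="\<lambda>x. _ * det x"] eq_matI) (use that in \<open>auto simp: A_def\<close>)
  have entry: "A r $$ (M, l) = c l r" if "l < Suc M" for l r
    using that by (simp add: A_def)
  have detA: "det (A r) = (\<Sum>l<Suc M. v l * c l r)" for r
  proof -
    have "det (A r) = (\<Sum>l<Suc M. A r $$ (M, l) * cofactor (A r) M l)"
      by (rule laplace_expansion_row[OF A]) simp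
    also have "\<dots> = (\<Sum>l<Suc M. v l * c l r)"
      using entry by (intro sum.cong refl) (simp add: cof mult.commute)
    finally show ?thesis .
  qed
  have "v M = det (mat M M (\<lambda>(i, l). c l (\<rho> i)))"
  proof -
    have "mat_delete (A 0) M M = mat M M (\<lambda>(i, l). c l (\<rho> i))"
      unfolding mat_delete_def by (rule eq_matI) (auto simp: A_def)
    then show ?thesis by (simp add: v_def cofactor_def)
  qed
  then have "\<exists>l<Suc M. v l \<noteq> 0" using \<rho> by auto
  from Suc.prems[OF this] obtain r where r: "r < R" "det (A r) \<noteq> 0" by (auto simp: detA)
  have "r \<notin> \<rho> ` {..<M}"
  proof
    assume "r \<in> \<rho> ` {..<M}"
    then obtain i where i: "i < M" "r = \<rho> i" by auto
    have "row (A r) i = row (A r) M" using i by (intro eq_vecI) (auto simp: A_def)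
    then have "det (A r) = 0" using det_identical_rows[OF A, of i M] i by auto
    then show False using r by simp
  qed
  then have h1: "inj_on (\<rho>(M := r)) {..<Suc M}" using \<rho> by (auto simp: lessThan_Suc inj_on_def)
  have h2: "(\<rho>(M := r)) ` {..<Suc M} \<subseteq> {..<R}" using \<rho> r by (auto simp: lessThan_Suc)
  have h3: "mat (Suc M) (Suc M) (\<lambda>(i, l). c l ((\<rho>(M := r)) i)) = A r"
    unfolding A_def by (rule cong_mat) auto
  show ?case using h1 h2 r(2) unfolding h3[symmetric] by blast
qed

text \<open>The extreme case is \<open>R + (R - 1) + ...\<close> with \<open>M\<close> terms.
  Removing the maximum \<open>m\<close> leaves numbers bounded by \<open>m - 1\<close>;
  \<open>m = 0\<close> is separate because of truncated subtraction.\<close>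

lemma sum_distinct_le:
  assumes "inj_on \<rho> {..<M}" "\<rho> ` {..<M} \<subseteq> {..<Suc R}"
  shows "2 * (\<Sum>i<M. int (\<rho> i)) \<le> 2 * int M * int R - int M * (int M - 1)"
proof -
  have "2 * (\<Sum>x\<in>S. int x) \<le> 2 * int (card S) * int R - int (card S) * (int (card S) - 1)"
    if "finite S" "S \<subseteq> {..<Suc R}" for S R
    using that
  proof (induction "card S" arbitrary: S R)
    case 0
    then show ?case by simp
  next
    case (Suc n)
    then have "S \<noteq> {}" by auto
    define m where "m = Max S"
    have m: "m \<in> S" using Suc \<open>S \<noteq> {}\<close> by (simp add: m_def)
    have lt: "x < m" if "x \<in> S - {m}" for x
      using that Suc.prems(1) unfolding m_def by (metis DiffE Max_ge insertI1 nless_le)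
    have mR: "m \<le> R" using m Suc.prems by auto
    have c: "card (S - {m}) = n" using Suc m by simp
    have sum: "(\<Sum>x\<in>S. int x) = int m + (\<Sum>x\<in>S - {m}. int x)"
      using m Suc.prems by (subst sum.remove[of S m]) auto
    show ?case
    proof (cases "m = 0")
      case True
      have "x \<notin> S - {m}" for x using lt[of x] True by linarith
      then have "S - {m} = {}" by blast
      then have "S = {0}" using m True by auto
      then show ?thesis by simp
    next
      case False
      then have "S - {m} \<subseteq> {..<Suc (m - 1)}" using lt by auto
      from Suc.hyps(1)[of "S - {m}" "m - 1", OF c[symmetric] _ this] Suc.prems
      have "2 * (\<Sum>x\<in>S - {m}. int x) \<le> 2 * int n * (int m - 1) - int n * (int n - 1)"
        using c False by (simp add: of_nat_diff)
      moreover have "int n * int m \<le> int n * int R" "int m \<le> int R" using mR by (auto intro: mult_left_mono)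
      ultimately show ?thesis
        unfolding sum using Suc.hyps(2)[symmetric] by (simp add: algebra_simps)
    qed
  qed
  from this[of "\<rho> ` {..<M}" R] assms show ?thesis
    by (simp add: card_image sum.reindex)
qed

text \<open>Membership means that \<open>scale UNIV p\<close> has degree at most \<open>n\<close> in
  \<open>T\<close>, so the axioms are inherited from \<open>degree_filtration\<close>.\<close>

lemma FT_filtration: "filtration (\<lambda>n. {p :: ('i, 'c::comm_ring_1) mpoly. \<forall>m\<in>keys p. int (monom_degree m) \<le> n})"
proof -
  interpret D: filtration "degree_upto :: int \<Rightarrow> ('i, 'c) mpoly poly set" by (rule degree_filtration)
  have *: "(\<forall>m\<in>keys p. int (monom_degree m) \<le> n) \<longleftrightarrow> scale UNIV p \<in> degree_upto n" (is "?L \<longleftrightarrow> ?R")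
    for p :: "('i, 'c) mpoly" and n
  proof
    assume ?L
    then have "lookup p k = 0" if "n < int (monom_degree k)" for k
      using that by (metis in_keys_iff not_le)
    then show ?R
      by (auto intro!: poly_mapping_eqI simp: lookup_coeff_scale)
  next
    assume ?R
    show ?L
    proof
      fix m assume "m \<in> keys p"
      then have "coeff (scale UNIV p) (monom_degree m) \<noteq> 0"
        using lookup_coeff_scale[of p "monom_degree m" m] by (auto simp: in_keys_iff)
      moreover have "coeff (scale UNIV p) (monom_degree m) = 0" if "int (monom_degree m) > n"
        using that \<open>?R\<close> by blast
      ultimately show "int (monom_degree m) \<le> n" by linarith
    qed
  qed
  interpret comm_ring_hom "scale (UNIV :: 'i set) :: ('i, 'c) mpoly \<Rightarrow> _" by (rule scale_hom)
  show ?thesis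
    unfolding *
  proof
    fix m n :: int assume "m \<le> n"
    then show "{p. scale UNIV p \<in> degree_upto m} \<subseteq> {p::('i, 'c) mpoly. scale UNIV p \<in> degree_upto n}"
      by auto
  next
    fix a b :: "('i, 'c) mpoly" and m n
    assume "a \<in> {p. scale UNIV p \<in> degree_upto m}" "b \<in> {p. scale UNIV p \<in> degree_upto n}"
    then show "a * b \<in> {p. scale UNIV p \<in> degree_upto (m + n)}"
      using D.mult[of "scale UNIV a" m "scale UNIV b" n] by (simp add: hom_mult)
  qed (auto simp: hom_add hom_uminus coeff_1)
qed

definition FT :: "int \<Rightarrow> ('i, 'c::comm_ring_1) mpoly set" where
  "FT n = {p. \<forall>m\<in>keys p. int (monom_degree m) \<le> n}"

interpretation FT: filtration FT
  unfolding FT_def by (rule FT_filtration)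

lemma FT_tdeg: "p \<in> FT (int (tdeg p))"
  unfolding FT_def using monom_degree_le_tdeg by auto

lemma tdeg_le: "p \<in> FT (int e) \<Longrightarrow> tdeg p \<le> e"
  unfolding FT_def tdeg_eq_total_degree total_degree_def by (auto simp: Max_le_iff)

lemma FT_negative: "p \<in> FT n \<Longrightarrow> n < 0 \<Longrightarrow> p = 0"
proof (rule ccontr)
  assume "p \<in> FT n" "n < 0" "p \<noteq> 0"
  then obtain m where "m \<in> keys p" using keys_eq_empty[of p] by blast
  then have "int (monom_degree m) \<le> n" using \<open>p \<in> FT n\<close> by (auto simp: FT_def)
  then show False using \<open>n < 0\<close> by simp
qed

lemma Const_FT [simp]: "Const c \<in> FT 0"
  by (auto simp: FT_def Const_def monom_degree_def)

lemma Var_FT [simp]: "Var i \<in> FT 1"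
  by (auto simp: FT_def Var_def monom_degree_def)

definition FTS :: "'i set \<Rightarrow> int \<Rightarrow> ('i, 'c::comm_ring_1) mpoly set" where
  "FTS S n = {p \<in> FT n. kill S p = p}"

interpretation FTS: filtration "FTS S"
proof -
  interpret comm_ring_hom "kill S" by (rule kill_hom)
  show "filtration (FTS S)"
    by unfold_locales (use FT.mono in \<open>auto simp: FTS_def hom_add hom_mult hom_uminus intro: FT.zero FT.one FT.add FT.mult FT.uminus\<close>)
qed

lemma Const_FTS [simp]: "Const c \<in> FTS S 0"
  by (simp add: FTS_def)

lemma Var_FTS: "i \<notin> S \<Longrightarrow> Var i \<in> FTS S 1"
  by (simp add: FTS_def)

lemma hom_kill:
  assumes "comm_ring_hom h"
  shows "h (kill S p) = meval (\<lambda>a. h (Const a)) (\<lambda>i. if i \<in> S then 0 else h (Var i)) p"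
proof -
  interpret comm_ring_hom h by fact
  show ?thesis
    unfolding kill_def by (subst meval_comp[OF Const_hom assms]) (simp add: if_distrib[of h] cong: if_cong)
qed

text \<open>This carries degree bounds through substitutions: only the images of constants and of
  the variables outside \<open>S\<close> have to be inspected.\<close>

lemma (in filtration) hom_FTS:
  assumes "comm_ring_hom h" "\<And>c. h (Const c) \<in> F 0" "\<And>i. i \<notin> S \<Longrightarrow> h (Var i) \<in> F 1" "p \<in> FTS S e"
  shows "h p \<in> F e"
proof -
  have "h p = meval (\<lambda>a. h (Const a)) (\<lambda>i. if i \<in> S then 0 else h (Var i)) p"
    using hom_kill[OF assms(1), of S p] assms(4) by (simp add: FTS_def)
  also have "\<dots> \<in> F e"
    unfolding meval_def
  proof (rule sum)
    fix m assume "m \<in> keys p"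
    then have m: "int (monom_degree m) \<le> e" using assms(4) by (auto simp: FTS_def FT_def)
    have *: "(if i \<in> S then 0 else h (Var i)) \<in> F 1" for i
      using assms(3) zero by auto
    have "mon_eval (\<lambda>i. if i \<in> S then 0 else h (Var i)) m \<in> F (\<Sum>i\<in>keys m. int (lookup m i))"
      unfolding mon_eval_def by (rule prod) (use power[OF *] in simp)
    then have "mon_eval (\<lambda>i. if i \<in> S then 0 else h (Var i)) m \<in> F (int (monom_degree m))" by (simp add: monom_degree_def)
    from mult[OF assms(2) this]
    show "h (Const (lookup p m)) * mon_eval (\<lambda>i. if i \<in> S then 0 else h (Var i)) m \<in> F e"
      using mono[OF m] by auto
  qed
  finally show ?thesis .
qed

lemma (in filtration) hom_FT:
  assumes "comm_ring_hom h" "\<And>c. h (Const c) \<in> F 0" "\<And>i. h (Var i) \<in> F 1" "p \<in> FT e"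
  shows "h p \<in> F e"
proof -
  have k: "kill {} p = p" unfolding kill_def by (simp add: meval_id)
  show ?thesis
  proof (rule hom_FTS[where S = "{}" and h = h])
    show "p \<in> FTS {} e" using k assms(4) by (simp add: FTS_def)
  qed (rule assms)+
qed

section \<open>Evaluation at points and the Schwartz-Zippel bound\<close>

definition ev :: "('i \<Rightarrow> 'c) \<Rightarrow> ('i, 'c::comm_ring_1) mpoly \<Rightarrow> 'c" where
  "ev x = meval (\<lambda>a. a) x"

lemma ev_hom: "comm_ring_hom (ev x)"
  unfolding ev_def by (rule meval_hom[OF comm_ring_hom_id])

lemma ev_Const [simp]: "ev x (Const a) = a"
  by (simp add: ev_def meval_Const' comm_ring_hom_id)

lemma ev_Var [simp]: "ev x (Var i) = x i"
  by (simp add: ev_def meval_Var' comm_ring_hom_id)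

lemma ev_Theta: "ev x p = poly (map_poly (ev (\<lambda>i. x (Suc i))) (Theta p)) (x 0)"
proof -
  interpret e: comm_ring_hom "ev (\<lambda>i. x (Suc i))" by (rule ev_hom)
  have V: "ev x (Var i) = poly (map_poly (ev (\<lambda>i. x (Suc i))) (Theta (Var i))) (x 0)" for i
    by (cases i) (simp_all add: e.map_poly_pCons_hom)
  have h: "comm_ring_hom (\<lambda>p. poly (map_poly (ev (\<lambda>i. x (Suc i))) (Theta p)) (x 0))"
    by (rule comm_ring_hom_comp[OF Theta_hom comm_ring_hom_comp[OF map_poly_hom[OF ev_hom] poly_at_hom]])
  have "ev x = (\<lambda>p. poly (map_poly (ev (\<lambda>i. x (Suc i))) (Theta p)) (x 0))"
    by (rule hom_ext[OF ev_hom h _ V]) (simp add: e.map_poly_pCons_hom)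
  then show ?thesis by (rule fun_cong)
qed

lemma Theta_graded: "p \<in> FT e \<Longrightarrow> coeff (Theta p) i \<in> FT (e - int i)"
proof -
  interpret P: filtration "\<lambda>n. {P :: (nat, 'a) mpoly poly. \<forall>i. coeff P i \<in> FT (n - int i)}"
    by (rule FT.poly_filtration)
  have V: "Theta (Var j) \<in> {P. \<forall>i. coeff P i \<in> FT (1 - int i)}" for j
    by (cases j) (auto simp: coeff_pCons FT.zero FT.one split: nat.splits)
  show "p \<in> FT e \<Longrightarrow> ?thesis"
    using P.hom_FT[OF Theta_hom _ V] by (auto simp: coeff_pCons FT.zero split: nat.splits)
qed

text \<open>The extra factor \<open>card A\<close> replaces the exponent \<open>N - 1\<close>, so
  \<open>N = 0\<close> fits. Let \<open>i\<close> be the degree in \<open>x_0\<close> and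
  \<open>c\<close> the leading coefficient, of degree at most \<open>e - i\<close>. Tails where
  \<open>c\<close> vanishes are counted by induction and allow any \<open>x_0\<close>; every other
  tail allows at most \<open>i\<close> values of \<open>x_0\<close>.\<close>

lemma schwartz_zippel:
  fixes p :: "(nat, 'c::field) mpoly"
  assumes "kill {N..} p = p" "p \<noteq> 0" "p \<in> FT (int e)" "finite A"
  shows "card {xs. length xs = N \<and> set xs \<subseteq> A \<and> ev ((!) xs) p = 0} * card A \<le> e * card A ^ N"
  using assms(1-3)
proof (induction N arbitrary: p e)
  case 0
  have "{0..} = (UNIV :: nat set)" by auto
  then obtain c where c: "p = Const c" using 0(1) kill_UNIV[of p] by auto
  then have "c \<noteq> 0" using 0(2) by (auto simp: Const_def)
  then have "{xs. length xs = 0 \<and> set xs \<subseteq> A \<and> ev ((!) xs) p = 0} = {}" using c by auto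
  then show ?case by (simp only: card.empty)
next
  case (Suc N)
  define P where "P = Theta p"
  define i where "i = degree P"
  define c where "c = lead_coeff P"
  have "P \<noteq> 0" unfolding P_def
    using Theta_inv_Theta[of p] Suc.prems(2) comm_ring_hom.meval_0[OF Const_hom] by (auto simp: Theta_inv_def)
  then have c0: "c \<noteq> 0" by (simp add: c_def)
  have cF: "c \<in> FT (int e - int i)"
    unfolding c_def i_def P_def by (rule Theta_graded[OF Suc.prems(3)])
  then have ie: "i \<le> e" using FT_negative[OF cF] c0 by force
  have cF': "c \<in> FT (int (e - i))" using cF ie by (simp add: of_nat_diff)
  interpret k: comm_ring_hom "kill {N..} :: (nat, 'c) mpoly \<Rightarrow> _" by (rule kill_hom)
  have "map_poly (kill {N..}) P = P" using Theta_kill[of N p] Suc.prems(1) by (simp add: P_def)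
  then have ck: "kill {N..} c = c"
    unfolding c_def using k.coeff_map_poly_hom[of P "degree P"] by simp
  let ?L = "{xs. length xs = N \<and> set xs \<subseteq> A}"
  define Z where "Z = {xs. length xs = N \<and> set xs \<subseteq> A \<and> ev ((!) xs) c = 0}"
  define r where "r ys = {a. poly (map_poly (ev ((!) ys)) P) a = 0}" for ys
  have finL: "finite ?L" using finite_lists_length_eq[OF assms(4), of N] by (simp add: conj_commute)
  have cardL: "card ?L = card A ^ N" using card_lists_length_eq[OF assms(4), of N] by (simp add: conj_commute)
  have ZL: "Z \<subseteq> ?L" by (auto simp: Z_def)
  have rc: "finite (r ys) \<and> card (r ys) \<le> i" if "ys \<in> ?L - Z" for ys
  proof -
    interpret e: comm_ring_hom "ev ((!) ys) :: (nat, 'c) mpoly \<Rightarrow> _" by (rule ev_hom)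
    have "coeff (map_poly (ev ((!) ys)) P) i \<noteq> 0"
      using that by (simp add: Z_def c_def i_def)
    then have "map_poly (ev ((!) ys)) P \<noteq> 0" by (metis coeff_0)
    moreover have "degree (map_poly (ev ((!) ys)) P) \<le> i" unfolding i_def by (rule degree_map_poly_le)
    ultimately show ?thesis
      unfolding r_def using card_poly_roots_bound[of "map_poly (ev ((!) ys)) P"] poly_roots_finite by fastforce
  qed
  have sub: "{xs. length xs = Suc N \<and> set xs \<subseteq> A \<and> ev ((!) xs) p = 0} \<subseteq>
      (\<lambda>(a, ys). a # ys) ` (A \<times> Z) \<union> (\<Union>ys\<in>?L - Z. (\<lambda>a. a # ys) ` r ys)" (is "?B \<subseteq> ?C \<union> ?D")
  proof
    fix xs assume xs: "xs \<in> ?B"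
    then obtain a ys where ays: "xs = a # ys" by (cases xs) auto
    have "poly (map_poly (ev ((!) ys)) P) a = 0"
      using xs ev_Theta[of "(!) xs" p] unfolding P_def ays by simp
    then show "xs \<in> ?C \<union> ?D"
      using xs ays by (cases "ys \<in> Z") (auto simp: r_def Z_def)
  qed
  have "card ?B \<le> card ?C + card ?D"
    using sub ZL finL assms(4) rc
    by (intro order_trans[OF card_mono card_Un_le]) (auto intro: finite_subset)
  also have "card ?C \<le> card A * card Z"
    using card_image_le[of "A \<times> Z" "\<lambda>(a, ys). a # ys"] ZL finL assms(4) by (auto simp: card_cartesian_product intro: finite_subset)
  also have "card ?D \<le> (\<Sum>ys\<in>?L - Z. card ((\<lambda>a. a # ys) ` r ys))"
    by (rule card_UN_le) (use finL in auto)
  also have "\<dots> \<le> (\<Sum>ys\<in>?L - Z. i)"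
    by (rule sum_mono) (use rc card_image_le in \<open>blast intro: order_trans\<close>)
  also have "\<dots> \<le> i * card A ^ N"
    using card_mono[OF finL, of "?L - Z"] cardL by (simp add: mult.commute mult_le_mono2)
  finally have "card ?B \<le> card A * card Z + i * card A ^ N" by simp
  then have "card ?B * card A \<le> (card A * card Z + i * card A ^ N) * card A" by (rule mult_le_mono1)
  also have "\<dots> = card A * (card Z * card A) + i * card A ^ Suc N" by (simp add: algebra_simps)
  also have "\<dots> \<le> card A * ((e - i) * card A ^ N) + i * card A ^ Suc N"
    using Suc.IH[OF ck c0 cF'] unfolding Z_def by (intro add_mono mult_le_mono2) auto
  also have "\<dots> = ((e - i) + i) * card A ^ Suc N" by (simp add: algebra_simps)
  also have "\<dots> = e * card A ^ Suc N" using ie by simp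
  finally show ?case .
qed

section \<open>Hensel's lemma for power series\<close>

lemma poly_taylor:
  fixes p :: "'a::idom poly"
  shows "\<exists>q. poly p (x + h) = poly p x + h * poly (pderiv p) x + h\<^sup>2 * q"
proof (induction p rule: pCons_induct)
  case (pCons a p)
  then obtain q where "poly p (x + h) = poly p x + h * poly (pderiv p) x + h\<^sup>2 * q" by blast
  then have "poly (pCons a p) (x + h) = poly (pCons a p) x + h * poly (pderiv (pCons a p)) x
      + h\<^sup>2 * (x * q + h * q + poly (pderiv p) x)"
    by (simp add: pderiv_pCons algebra_simps power2_eq_square)
  then show ?case by blast
qed auto

lemma poly_diff_dvd:
  fixes p :: "'a::idom poly"
  shows "\<exists>q. poly p x = poly p y + (x - y) * q"
proof -
  obtain q where "poly p (y + (x - y)) = poly p y + (x - y) * poly (pderiv p) y + (x - y)\<^sup>2 * q"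
    using poly_taylor by blast
  then have "poly p x = poly p y + (x - y) * (poly (pderiv p) y + (x - y) * q)"
    by (simp add: algebra_simps power2_eq_square)
  then show ?thesis by blast
qed

lemma fps_mult_nth_eq_0:
  fixes x y :: "'a::comm_ring_1 fps"
  shows "(\<And>k. k \<le> n \<Longrightarrow> fps_nth x k = 0) \<Longrightarrow> m \<le> n \<Longrightarrow> fps_nth (x * y) m = 0"
  by (auto simp: fps_mult_nth intro!: sum.neutral)

lemma poly_fps_cong:
  fixes p :: "'a::idom fps poly"
  assumes "\<And>k. k \<le> n \<Longrightarrow> fps_nth x k = fps_nth y k" "m \<le> n"
  shows "fps_nth (poly p x) m = fps_nth (poly p y) m"
proof -
  obtain q where q: "poly p x = poly p y + (x - y) * q" using poly_diff_dvd by blast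
  have "fps_nth ((x - y) * q) m = 0"
    by (rule fps_mult_nth_eq_0[of n]) (use assms in auto)
  then show ?thesis using q by simp
qed

lemma (in filtration) poly_mem: "(\<And>i. coeff p i \<in> F 0) \<Longrightarrow> x \<in> F 0 \<Longrightarrow> poly p x \<in> F 0"
  unfolding poly_altdef using mult[of _ 0 _ 0] power[of x 0] by (intro sum) auto

text \<open>Newton's iteration, correcting one coefficient per step and always using the inverse
  \<open>u\<close> of the derivative at the starting point. Since \<open>u\<close> has level
  \<open>0\<close>, the new coefficient at \<open>Suc n\<close> has the level of the error it
  removes.\<close>

lemma hensel:
  fixes p :: "'a::idom fps poly"
  assumes "filtration F" and z: "z \<in> F 0" "u \<in> F 0" and p: "\<And>i n. fps_nth (coeff p i) n \<in> F (int n)"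
    and root: "fps_nth (poly p (fps_const z)) 0 = 0"
    and simple: "u * fps_nth (poly (pderiv p) (fps_const z)) 0 = 1"
  shows "\<exists>x. fps_nth x 0 = z \<and> poly p x = 0 \<and> (\<forall>n. fps_nth x n \<in> F (int n))"
proof -
  interpret filtration F by fact
  interpret G: filtration "graded_fps F" by (rule fps_filtration)
  define b where "b n x = - u * fps_nth (poly p x) (Suc n)" for n x
  define S where "S = rec_nat (fps_const z) (\<lambda>n x. x + fps_const (b n x) * fps_X ^ Suc n)"
  have S0: "S 0 = fps_const z" and SS: "S (Suc n) = S n + fps_const (b n (S n)) * fps_X ^ Suc n" for n
    by (simp_all add: S_def)
  have low: "fps_nth (fps_const a * fps_X ^ Suc n) m = (if m = Suc n then a else 0)" for a :: 'a and n m
    by (simp add: fps_X_power_nth del: power_Suc)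
  have agree: "fps_nth (S (Suc n)) m = fps_nth (S n) m" if "m \<le> n" for n m
    unfolding SS fps_add_nth low using that by simp
  have S_nth_0: "fps_nth (S n) 0 = z" for n
    by (induction n) (simp_all add: S0 agree)
  have der: "u * fps_nth (poly (pderiv p) (S n)) 0 = 1" for n
    using poly_fps_cong[of 0 "S n" "fps_const z" 0 "pderiv p"] simple S_nth_0 by simp
  have vanish: "fps_nth (poly p (S n)) m = 0" if "m \<le> n" for n m
    using that
  proof (induction n arbitrary: m)
    case 0
    then show ?case using root by (simp add: S0)
  next
    case (Suc n)
    define h where "h = fps_const (b n (S n)) * fps_X ^ Suc n"
    have h: "fps_nth h k = (if k = Suc n then b n (S n) else 0)" for k unfolding h_def by (rule low)
    obtain q where q: "poly p (S n + h) = poly p (S n) + h * poly (pderiv p) (S n) + h\<^sup>2 * q"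
      using poly_taylor by blast
    \<comment> \<open>The square of the correction starts at exponent \<open>2 * Suc n\<close>,
      beyond every \<open>m \<le> Suc n\<close>.\<close>
    have hh: "fps_nth (h\<^sup>2 * q) m = 0"
    proof -
      have 0: "fps_nth (h * q) 0 = 0" by (simp add: h)
      have "fps_nth h k * fps_nth (h * q) (m - k) = 0" for k
        using 0 Suc.prems by (cases "k = Suc n") (simp_all add: h)
      then have "fps_nth (h * (h * q)) m = 0"
        unfolding fps_mult_nth[of h "h * q"] by (intro sum.neutral) blast
      then show ?thesis by (simp add: power2_eq_square mult.assoc)
    qed
    show ?case
    proof (cases "m = Suc n")
      case False
      then have "m \<le> n" using Suc.prems by simp
      moreover have "fps_nth (h * poly (pderiv p) (S n)) m = 0"
        by (rule fps_mult_nth_eq_0[of n]) (use \<open>m \<le> n\<close> h in auto)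
      ultimately show ?thesis using Suc.IH hh q unfolding SS h_def[symmetric] by simp
    next
      case True
      have "fps_nth (h * poly (pderiv p) (S n)) (Suc n) = (\<Sum>k=0..Suc n. fps_nth h k * fps_nth (poly (pderiv p) (S n)) (Suc n - k))"
        by (rule fps_mult_nth)
      also have "\<dots> = (\<Sum>k\<in>{Suc n}. fps_nth h k * fps_nth (poly (pderiv p) (S n)) (Suc n - k))"
        by (rule sum.mono_neutral_right) (auto simp: h)
      also have "\<dots> = b n (S n) * fps_nth (poly (pderiv p) (S n)) 0" by (simp add: h)
      also have "\<dots> = - (fps_nth (poly p (S n)) (Suc n)) * (u * fps_nth (poly (pderiv p) (S n)) 0)"
        by (simp add: b_def algebra_simps)
      finally have "fps_nth (h * poly (pderiv p) (S n)) (Suc n) = - fps_nth (poly p (S n)) (Suc n)"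
        by (simp add: der)
      then show ?thesis using hh q True unfolding SS h_def[symmetric] by simp
    qed
  qed
  have graded: "S n \<in> graded_fps F 0" for n
  proof (induction n)
    case 0
    then show ?case using z zero by (auto simp: S0)
  next
    case (Suc n)
    have "poly p (S n) \<in> graded_fps F 0"
      by (rule G.poly_mem[OF _ Suc.IH]) (use p in auto)
    then have "fps_nth (poly p (S n)) (Suc n) \<in> F (0 + int (Suc n))" by blast
    then have "b n (S n) \<in> F (int (Suc n))"
      unfolding b_def using mult[OF uminus[OF z(2)], of "fps_nth (poly p (S n)) (Suc n)" "int (Suc n)"] by simp
    then have "fps_const (b n (S n)) * fps_X ^ Suc n \<in> graded_fps F 0"
      using zero by (simp add: low del: power_Suc fps_const_mult_apply_left)
    from G.add[OF Suc.IH this] show ?case unfolding SS .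
  qed
  \<comment> \<open>Coefficient \<open>n\<close> no longer changes after stage \<open>n\<close>, so
    the diagonal is the limit.\<close>
  define x where "x = Abs_fps (\<lambda>n. fps_nth (S n) n)"
  have stable: "fps_nth (S n) m = fps_nth (S m) m" if "m \<le> n" for n m
    using that by (induction n rule: dec_induct) (simp_all add: agree)
  have x: "fps_nth x m = fps_nth (S n) m" if "m \<le> n" for m n
    using stable[OF that] by (simp add: x_def)
  have "poly p x = 0"
  proof (rule fps_ext)
    fix n
    have "fps_nth (poly p x) n = fps_nth (poly p (S n)) n"
      by (rule poly_fps_cong[of n]) (use x in auto)
    then show "fps_nth (poly p x) n = fps_nth 0 n" using vanish[of n n] by simp
  qed
  moreover have "fps_nth x 0 = z" by (simp add: x_def S0)
  moreover have "fps_nth x n \<in> F (int n)" for n using graded[of n] by (simp add: x_def)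
  ultimately show ?thesis by blast
qed

section \<open>Generic lines\<close>

lemma infinite_alg_closed: "infinite (UNIV :: 'c::alg_closed_field set)"
proof
  assume fin: "finite (UNIV :: 'c set)"
  define p where "p = (\<Prod>a\<in>(UNIV :: 'c set). [:- a, 1:]) + 1"
  have "degree (\<Prod>a\<in>(UNIV :: 'c set). [:- a, 1:]) = card (UNIV :: 'c set)"
    by (subst degree_prod_eq_sum_degree) auto
  moreover have "card (UNIV :: 'c set) > 0" using fin by (simp add: card_gt_0_iff)
  ultimately have "degree p > 0" unfolding p_def by (subst degree_add_eq_left) auto
  then obtain x where "poly p x = 0" using alg_closed_imp_poly_has_root by blast
  moreover have "poly (\<Prod>a\<in>(UNIV :: 'c set). [:- a, 1:]) x = 0"
    unfolding poly_prod using fin by (intro prod_zero bexI[of _ x]) auto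
  ultimately show False by (simp add: p_def)
qed

text \<open>By \<open>schwartz_zippel\<close> a nonzero polynomial cannot vanish on a whole grid of
  side \<open>tdeg p + 1\<close>, and an algebraically closed field is large enough to contain
  one.\<close>

lemma ev_nonzero_point:
  fixes p :: "(nat, 'c::alg_closed_field) mpoly"
  assumes "p \<noteq> 0"
  shows "\<exists>x. ev x p \<noteq> 0"
proof (rule ccontr)
  assume "\<not> ?thesis"
  then have z: "ev x p = 0" for x by auto
  obtain N where N: "kill {N..} p = p" using kill_cofinite[of p] by blast
  obtain A :: "'c set" where A: "finite A" "card A = Suc (tdeg p)"
    using infinite_arbitrarily_large[OF infinite_alg_closed] by blast
  have "card {xs. length xs = N \<and> set xs \<subseteq> A \<and> ev ((!) xs) p = 0} * card A \<le> tdeg p * card A ^ N"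
    by (rule schwartz_zippel[OF N assms FT_tdeg A(1)])
  moreover have "{xs. length xs = N \<and> set xs \<subseteq> A \<and> ev ((!) xs) p = 0} = {xs. set xs \<subseteq> A \<and> length xs = N}"
    using z by auto
  ultimately have "card A ^ N * card A \<le> tdeg p * card A ^ N"
    using card_lists_length_eq[OF A(1), of N] by simp
  then have "card A ^ N * Suc (tdeg p) \<le> card A ^ N * tdeg p" by (simp add: A(2) mult.commute)
  then show False using A(2) by simp
qed

lemma meval_cong:
  assumes "comm_ring_hom c" "kill S p = p" "\<And>i. i \<notin> S \<Longrightarrow> s i = t i"
  shows "meval c s p = meval c t p"
proof -
  have *: "meval c s p = meval c (\<lambda>i. if i \<in> S then 0 else s i) p" for s
    using hom_kill[OF meval_hom[OF assms(1)], of s S p]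
    by (simp only: meval_Const'[OF assms(1)] meval_Var'[OF assms(1)] assms(2))
  have "(\<lambda>i. if i \<in> S then 0 else s i) = (\<lambda>i. if i \<in> S then 0 else t i)" using assms(3) by auto
  then show ?thesis using *[of s] *[of t] by simp
qed

text \<open>The coefficient ring is left open for three uses: with indeterminate coordinates this is
  the generic line, with coordinates linear in \<open>Y\<close> a plane, and its coefficient of
  \<open>X\<close> is the derivative at \<open>v\<close> along \<open>u\<close>.\<close>

definition line_subst :: "('c::comm_ring_1 \<Rightarrow> 'b::comm_ring_1) \<Rightarrow> ('i \<Rightarrow> 'b) \<Rightarrow> ('i \<Rightarrow> 'b) \<Rightarrow> ('i, 'c) mpoly \<Rightarrow> 'b poly" where
  "line_subst c v u = meval (\<lambda>a. [:c a:]) (\<lambda>i. [:v i, u i:])"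

lemma const_comp_hom: "comm_ring_hom c \<Longrightarrow> comm_ring_hom (\<lambda>a. [:c a:])"
  by (rule comm_ring_hom_comp[OF _ const_poly_hom])

lemma line_subst_hom: "comm_ring_hom c \<Longrightarrow> comm_ring_hom (line_subst c v u)"
  unfolding line_subst_def by (rule meval_hom[OF const_comp_hom])

lemma line_subst_Const: "comm_ring_hom c \<Longrightarrow> line_subst c v u (Const a) = [:c a:]"
  by (simp add: line_subst_def meval_Const' const_comp_hom)

lemma line_subst_Var: "comm_ring_hom c \<Longrightarrow> line_subst c v u (Var i) = [:v i, u i:]"
  by (simp add: line_subst_def meval_Var' const_comp_hom)

lemma map_poly_line_subst:
  assumes "comm_ring_hom c" "comm_ring_hom h"
  shows "map_poly h (line_subst c v u p) = line_subst (\<lambda>a. h (c a)) (\<lambda>i. h (v i)) (\<lambda>i. h (u i)) p"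
proof -
  interpret h: comm_ring_hom h by fact
  show ?thesis
    unfolding line_subst_def
    by (subst meval_comp[OF const_comp_hom[OF assms(1)] map_poly_hom[OF assms(2)]]) (simp add: h.map_poly_pCons_hom)
qed

lemma line_subst_cong:
  assumes "comm_ring_hom c" "kill S p = p" "\<And>i. i \<notin> S \<Longrightarrow> v i = v' i" "\<And>i. i \<notin> S \<Longrightarrow> u i = u' i"
  shows "line_subst c v u p = line_subst c v' u' p"
  unfolding line_subst_def by (rule meval_cong[OF const_comp_hom[OF assms(1)] assms(2)]) (simp add: assms)

lemma coeff_mult_1: "coeff (p * q) (Suc 0) = coeff p 0 * coeff q (Suc 0) + coeff p (Suc 0) * coeff q 0"
  by (simp add: coeff_mult)

lemma mpoly_ring_induct [case_names Const Var add mult]: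
  fixes p :: "('i, 'c::comm_ring_1) mpoly"
  assumes "\<And>a. P (Const a)" "\<And>i. P (Var i)" "\<And>p q. P p \<Longrightarrow> P q \<Longrightarrow> P (p + q)" "\<And>p q. P p \<Longrightarrow> P q \<Longrightarrow> P (p * q)"
  shows "P p"
proof (induction p rule: mpoly_induct)
  case (single m c)
  have one: "P 1" using assms(1)[of 1] by (simp add: Const_def single_one)
  have pw: "P (Var i ^ k)" for i k by (induction k) (auto intro: one assms)
  have "P (\<Prod>i\<in>A. Var i ^ lookup m i)" for A
    by (induction A rule: infinite_finite_induct) (auto intro: one assms pw)
  then show ?case unfolding single_eq_Const_mon_eval[of m c] mon_eval_def by (intro assms(4) assms(1))
qed (rule assms(3))

text \<open>A directional derivative is additive in the direction. The induction must carry the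
  constant terms along, because the product rule multiplies them with the first-order terms.\<close>

lemma line_subst_deriv_add:
  assumes "comm_ring_hom c"
  shows "coeff (line_subst c v (\<lambda>i. u i + u' i) p) 1 = coeff (line_subst c v u p) 1 + coeff (line_subst c v u' p) 1"
proof -
  interpret a: comm_ring_hom "line_subst c v (\<lambda>i. u i + u' i)" by (rule line_subst_hom[OF assms])
  interpret b: comm_ring_hom "line_subst c v u" by (rule line_subst_hom[OF assms])
  interpret c: comm_ring_hom "line_subst c v u'" by (rule line_subst_hom[OF assms])
  have "coeff (line_subst c v (\<lambda>i. u i + u' i) p) 0 = coeff (line_subst c v u p) 0 \<and> coeff (line_subst c v u' p) 0 = coeff (line_subst c v u p) 0
    \<and> coeff (line_subst c v (\<lambda>i. u i + u' i) p) 1 = coeff (line_subst c v u p) 1 + coeff (line_subst c v u' p) 1"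
  proof (induction p rule: mpoly_ring_induct)
    case (mult p q)
    then show ?case
      unfolding a.hom_mult b.hom_mult c.hom_mult by (simp add: coeff_mult_1 coeff_mult_0 algebra_simps)
  qed (simp_all add: line_subst_Const[OF assms] line_subst_Var[OF assms] a.hom_add b.hom_add c.hom_add algebra_simps)
  then show ?thesis by blast
qed

lemma coeff_linear_power_1: "coeff ([:x, 1:] ^ k) 1 = of_nat k * x ^ (k - 1)" for x :: "'a::comm_ring_1"
proof -
  have 0: "coeff ([:x, 1:] ^ k) 0 = x ^ k" for k
    by (induction k) (simp_all add: coeff_mult_0)
  show ?thesis
  proof (induction k)
    case (Suc k)
    have "coeff ([:x, 1:] ^ Suc k) 1 = x * coeff ([:x, 1:] ^ k) 1 + coeff ([:x, 1:] ^ k) 0"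
      by (simp add: coeff_mult_1)
    then show ?case using Suc 0[of k] by (cases k) (simp_all add: algebra_simps)
  qed simp
qed

text \<open>At the generic point and along the \<open>i\<close>-th unit vector the coefficient of
  \<open>X\<close> is the formal partial derivative; the monomial \<open>m'\<close> arises only from
  \<open>m' + single i 1\<close>, with the exponent of \<open>x_i\<close> as factor.\<close>

lemma lookup_partial_derivative:
  fixes p :: "('i, 'c::comm_ring_1) mpoly"
  shows "lookup (coeff (line_subst Const Var (\<lambda>j. if j = i then 1 else 0) p) 1) m' =
    of_nat (Suc (lookup m' i)) * lookup p (m' + single i 1)"
proof (induction p rule: mpoly_induct)
  case (single m a)
  interpret cp: comm_ring_hom "\<lambda>a :: ('i, 'c) mpoly. [:a:]" by (rule const_poly_hom)
  define k where "k = lookup m i"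
  define m2 where "m2 = m - single i k"
  have m: "m = single i k + m2"
    by (rule poly_mapping_eqI) (auto simp: m2_def k_def lookup_add lookup_minus lookup_single when_def)
  have "i \<notin> keys m2" by (auto simp: m2_def k_def lookup_minus in_keys_iff)
  then have "mon_eval (\<lambda>j. [:Var j, if j = i then 1 else 0:]) m2 = mon_eval (\<lambda>j. [:Var j :: ('i, 'c) mpoly:]) m2"
    unfolding mon_eval_def by (intro prod.cong) auto
  also have "\<dots> = [:mon_eval Var m2:]"
    by (rule cp.hom_mon_eval[symmetric])
  finally have "line_subst Const Var (\<lambda>j. if j = i then 1 else 0) (single m a) =
      [:Const a:] * ([:Var i, 1:] ^ k * [:mon_eval Var m2:])"
    unfolding line_subst_def by (simp only: comm_ring_hom.meval_single[OF Const_poly_hom] m mon_eval_add mon_eval_single simp_thms if_True)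
  also have "\<dots> = smult (Const a * mon_eval Var m2) ([:Var i, 1:] ^ k)" by (simp add: mult.commute)
  finally have c: "coeff (line_subst Const Var (\<lambda>j. if j = i then 1 else 0) (single m a)) 1
    = Const a * mon_eval Var m2 * (of_nat k * Var i ^ (k - 1))"
    by (simp only: coeff_smult coeff_linear_power_1)
  show ?case
  proof (cases "k = 0")
    case True
    then have "m \<noteq> m' + single i 1"
      unfolding k_def by (metis Suc_eq_plus1 lookup_add lookup_single_eq nat.distinct(1))
    then show ?thesis unfolding c using True by (simp add: lookup_single when_def)
  next
    case False
    define n0 where "n0 = m2 + single i (k - 1)"
    have mn: "m = n0 + single i 1"
    proof -
      have "single i k = single i (k - 1) + single i 1"
        using False by (simp flip: single_add)
      then show ?thesis unfolding n0_def m by (simp only: ac_simps)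
    qed
    have "Const a * mon_eval Var m2 * (of_nat k * Var i ^ (k - 1)) = (of_nat k :: ('i, 'c) mpoly) * (Const a * mon_eval Var n0)"
      unfolding n0_def by (simp add: mon_eval_add algebra_simps)
    also have "\<dots> = of_nat k * single n0 a" by (simp only: single_eq_Const_mon_eval)
    also have "\<dots> = single n0 (of_nat k * a)"
      by (induction k) (simp_all add: algebra_simps single_add)
    finally have "coeff (line_subst Const Var (\<lambda>j. if j = i then 1 else 0) (single m a)) 1 = single n0 (of_nat k * a)"
      using c by simp
    moreover have "k = Suc (lookup n0 i)" using mn by (simp add: k_def lookup_add)
    ultimately show ?thesis unfolding mn by (auto simp: lookup_single when_def)
  qed
next
  case (add p q)
  interpret comm_ring_hom "line_subst Const Var (\<lambda>j. if j = i then 1 else 0) :: ('i, 'c) mpoly \<Rightarrow> _"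
    by (rule line_subst_hom[OF Const_hom])
  show ?case using add by (simp add: hom_add lookup_add algebra_simps)
qed

text \<open>
  Variable \<open>i < n\<close> is the base point coordinate \<open>V\<^sub>i\<close> and variable \<open>n - 1 + i\<close> with \<open>1 \<le> i < n\<close> the
  direction coordinate \<open>W\<^sub>i\<close>; the direction is \<open>(1, W\<^sub>1, \<dots>)\<close>.
\<close>

definition dir_var :: "nat \<Rightarrow> nat \<Rightarrow> (nat, 'c::comm_ring_1) mpoly" where
  "dir_var n i = (if i = 0 then 1 else Var (n - 1 + i))"

text \<open>The substitution extends to an isomorphism \<open>h\<close> onto the polynomials in
  \<open>X\<close>: the variables from \<open>n\<close> on, absent from \<open>f\<close>, are used
  to supply \<open>V_0\<close> and the \<open>W_i\<close>. The inverse is read off from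
  \<open>X = x_0 - V_0\<close> and \<open>V_j = x_j - W_j X\<close>.\<close>

lemma generic_line_prime:
  fixes f :: "(nat, 'c::field) mpoly"
  assumes f: "irreducible f" "kill {n..} f = f" and n: "n > 0"
  shows "prime_elem (line_subst Const Var (dir_var n) f)"
proof -
  define h where "h = line_subst Const (\<lambda>i. if i < n then Var i else if i = n then Var 0 else Var (i - 1)) (\<lambda>i. if i < n then dir_var n i else (0 :: (nat, 'c) mpoly))"
  define g0 :: "(nat, 'c) mpoly \<Rightarrow> (nat, 'c) mpoly" where
    "g0 = meval Const (\<lambda>j. if j = 0 then Var n else if j < n then Var j - Var (n + j) * (Var 0 - Var n) else Var (Suc j))"
  define g where "g = plift g0 (Var 0 - Var n)"
  have h_hom: "comm_ring_hom h" unfolding h_def by (rule line_subst_hom[OF Const_hom])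
  have g0_hom: "comm_ring_hom g0" unfolding g0_def by (rule meval_hom[OF Const_hom])
  have g_hom: "comm_ring_hom g" unfolding g_def by (rule plift_hom[OF g0_hom])
  interpret h: comm_ring_hom h by (rule h_hom)
  interpret g0: comm_ring_hom g0 by (rule g0_hom)
  interpret g: comm_ring_hom g by (rule g_hom)
  have hC: "h (Const a) = [:Const a:]" for a unfolding h_def by (rule line_subst_Const[OF Const_hom])
  have hV: "h (Var i) = [:if i < n then Var i else if i = n then Var 0 else Var (i - 1), if i < n then dir_var n i else 0:]" for i
    unfolding h_def by (rule line_subst_Var[OF Const_hom])
  have g0C: "g0 (Const a) = Const a" for a by (simp add: g0_def meval_Const' Const_hom)
  have g0V: "g0 (Var j) = (if j = 0 then Var n else if j < n then Var j - Var (n + j) * (Var 0 - Var n) else Var (Suc j))" for j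
    by (simp add: g0_def meval_Var' Const_hom)
  have gp: "g [:a, b:] = g0 a + (Var 0 - Var n) * g0 b" for a b
    unfolding g_def by simp
  have gc: "g [:a:] = g0 a" for a
    unfolding g_def by simp
  have idx: "0 < i \<Longrightarrow> \<not> (n + i - Suc 0 < n)" "n < i \<Longrightarrow> \<not> (i - Suc 0 < n)" for i by linarith+
  have gh: "(\<lambda>p. g (h p)) = (\<lambda>p. p)"
  proof (rule hom_ext[OF comm_ring_hom_comp[OF h_hom g_hom] comm_ring_hom_id])
    fix i
    consider "i = 0" | "0 < i" "i < n" | "i = n" | "i > n" by linarith
    then show "g (h (Var i)) = Var i"
      by cases (use n in \<open>simp_all add: hV gp gc g0V dir_var_def idx\<close>)
  qed (simp add: hC gc g0C)
  have hg0: "(\<lambda>p. h (g0 p)) = (\<lambda>p. [:p:])"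
  proof (rule hom_ext[OF comm_ring_hom_comp[OF g0_hom h_hom] const_poly_hom])
    fix i
    consider "i = 0" | "0 < i" "i < n" | "i \<ge> n" "i > 0" using n by linarith
    then show "h (g0 (Var i)) = [:Var i:]"
      by cases (use n in \<open>simp_all add: hV g0V dir_var_def idx h.hom_minus h.hom_mult\<close>)
  qed (simp add: hC g0C)
  have hg: "(\<lambda>p. h (g p)) = (\<lambda>p. p)"
  proof (rule poly_hom_ext[OF comm_ring_hom_comp[OF g_hom h_hom] comm_ring_hom_id])
    show "h (g [:a:]) = [:a:]" for a using fun_cong[OF hg0, of a] by (simp add: gc)
    show "h (g [:0, 1:]) = [:0, 1:]" using n by (simp add: gp h.hom_minus hV dir_var_def)
  qed
  have "prime_elem (h f)"
    using fun_cong[OF gh] fun_cong[OF hg]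
    by (intro prime_elem_iso[OF h_hom g_hom _ _ irreducible_imp_prime_mpoly[OF f(1)]]) auto
  also have "h f = line_subst Const Var (dir_var n) f"
    unfolding h_def by (rule line_subst_cong[OF Const_hom f(2)]) auto
  finally show ?thesis .
qed

lemma (in filtration) flat_poly_filtration: "filtration (flat_poly F)"
proof
  fix P Q m n
  assume P: "P \<in> flat_poly F m" and Q: "Q \<in> flat_poly F n"
  then show "P * Q \<in> flat_poly F (m + n)"
    by (auto simp: coeff_mult intro!: sum mult)
next
  show "1 \<in> flat_poly F 0" using one zero by (auto simp: coeff_1)
next
  fix m n :: int assume "m \<le> n"
  then have "F m \<subseteq> F n" by (rule mono)
  then show "flat_poly F m \<subseteq> flat_poly F n" by blast
qed (auto intro: zero add uminus)

lemma line_subst_degree: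
  assumes "comm_ring_hom c"
  shows "degree (line_subst c v u p) \<le> tdeg p"
proof -
  interpret D: filtration "degree_upto :: int \<Rightarrow> 'b poly set" by (rule degree_filtration)
  have "line_subst c v u p \<in> degree_upto (int (tdeg p))"
    by (rule D.hom_FT[OF line_subst_hom[OF assms] _ _ FT_tdeg])
      (auto simp: line_subst_Const[OF assms] line_subst_Var[OF assms] coeff_pCons split: nat.splits)
  then show ?thesis by (intro degree_le) auto
qed

lemma line_subst_bidegree:
  fixes c :: "'c::comm_ring_1 \<Rightarrow> 'b::comm_ring_1"
  assumes c: "comm_ring_hom c" and ij: "i + j > tdeg p"
  shows "coeff (coeff (line_subst (\<lambda>a. [:c a:]) (\<lambda>i. [:a i, b i:]) (\<lambda>i. [:u i:]) p) i) j = 0"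
proof -
  interpret D: filtration "degree_upto :: int \<Rightarrow> 'b poly set" by (rule degree_filtration)
  interpret DP: filtration "graded_poly (degree_upto :: int \<Rightarrow> 'b poly set)" by (rule D.poly_filtration)
  have "line_subst (\<lambda>a. [:c a:]) (\<lambda>i. [:a i, b i:]) (\<lambda>i. [:u i:]) p \<in> graded_poly degree_upto (int (tdeg p))"
    by (rule DP.hom_FT[OF line_subst_hom[OF const_comp_hom[OF c]] _ _ FT_tdeg])
      (auto simp: line_subst_Const[OF const_comp_hom[OF c]] line_subst_Var[OF const_comp_hom[OF c]] coeff_pCons split: nat.splits)
  then show ?thesis using ij by auto
qed

text \<open>With \<open>X\<close> in level \<open>0\<close>, the \<open>V_j\<close>, the
  \<open>W_j\<close> and the constant direction entry \<open>1\<close> all lie in level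
  \<open>1\<close>, so every coefficient inherits the total degree of \<open>f\<close>. The
  \<open>2 * n - 1\<close> variables are \<open>V_0, ..., V_(n-1)\<close> and
  \<open>W_1, ..., W_(n-1)\<close>.\<close>

lemma generic_line_coeff_FTS:
  assumes f: "kill {n..} f = f" and n: "n > 0"
  shows "coeff (line_subst Const Var (dir_var n) f) i \<in> FTS {2 * n - 1..} (int (tdeg f))"
proof -
  let ?F = "FTS {2 * n - 1..} :: int \<Rightarrow> (nat, 'a) mpoly set"
  interpret P: filtration "flat_poly ?F" by (rule FTS.flat_poly_filtration)
  have V: "Var j \<in> ?F 1" if "j < 2 * n - 1" for j
    by (rule Var_FTS) (use that in auto)
  have one: "1 \<in> ?F 1" using FTS.mono[of 0 1] FTS.one by auto
  have "line_subst Const Var (dir_var n) f \<in> {P. \<forall>i. coeff P i \<in> ?F (int (tdeg f))}"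
  proof (rule P.hom_FTS[OF line_subst_hom[OF Const_hom], where S = "{n..}"])
    show "f \<in> FTS {n..} (int (tdeg f))" using f FT_tdeg by (auto simp: FTS_def)
    show "line_subst Const Var (dir_var n) (Const c) \<in> flat_poly ?F 0" for c
      by (auto simp: line_subst_Const[OF Const_hom] coeff_pCons FTS.zero split: nat.splits)
    fix i assume "i \<notin> {n..}"
    then show "line_subst Const Var (dir_var n) (Var i) \<in> {P. \<forall>i. coeff P i \<in> ?F 1}"
      using n by (auto simp: line_subst_Var[OF Const_hom] coeff_pCons FTS.zero dir_var_def one simp del: One_nat_def intro!: V split: nat.splits)
  qed
  then show ?thesis by blast
qed

lemma coeff_pcompose_scale: "coeff (pcompose p [:0, c:]) k = c ^ k * coeff p k" for c :: "'a::comm_ring_1"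
proof (induction p arbitrary: k rule: pCons_induct)
  case (pCons a p)
  have "pcompose (pCons a p) [:0, c:] = pCons a (smult c (pcompose p [:0, c:]))"
    by (simp add: pcompose_pCons)
  then show ?case using pCons by (cases k) (simp_all add: algebra_simps)
qed simp

text \<open>This coefficient is the top form \<open>H\<close> of \<open>f\<close> at the direction
  \<open>(1, W)\<close>. At some point \<open>a\<close> both \<open>H\<close> and the first
  coordinate are nonzero; dividing \<open>a\<close> by that coordinate gives an admissible direction
  and merely rescales \<open>X\<close>.\<close>

lemma generic_line_lead_coeff:
  fixes f :: "(nat, 'c::alg_closed_field) mpoly"
  assumes f: "kill {n..} f = f" "f \<noteq> 0" and n: "n > 0"
  shows "coeff (line_subst Const Var (dir_var n) f) (tdeg f) \<noteq> 0"
proof -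
  define H where "H = coeff (scale UNIV f) (tdeg f)"
  have "H \<noteq> 0" unfolding H_def tdeg_def using f(2) by (simp add: scale_eq_0_iff)
  moreover have "(Var 0 :: (nat, 'c) mpoly) \<noteq> 0"
    unfolding Var_def by (metis lookup_single_eq lookup_zero zero_neq_one)
  ultimately have "H * Var 0 \<noteq> 0" by simp
  then obtain a where "ev a (H * Var 0) \<noteq> 0" using ev_nonzero_point by blast
  then have a: "ev a H \<noteq> 0" "a 0 \<noteq> 0"
    by (simp_all add: ev_def comm_ring_hom.meval_mult[OF comm_ring_hom_id] meval_Var' comm_ring_hom_id)
  define y where "y j = (if j < n then 0 else a (j - (n - 1)) / a 0)" for j
  interpret y: comm_ring_hom "ev y :: (nat, 'c) mpoly \<Rightarrow> _" by (rule ev_hom)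
  interpret a: comm_ring_hom "ev a :: (nat, 'c) mpoly \<Rightarrow> _" by (rule ev_hom)
  have 1: "map_poly (ev y) (line_subst Const Var (dir_var n) f) = line_subst (\<lambda>a. a) (\<lambda>i. 0) (\<lambda>i. a i / a 0) f"
    unfolding map_poly_line_subst[OF Const_hom ev_hom] ev_Const
    by (rule line_subst_cong[OF comm_ring_hom_id f(1)]) (use n a in \<open>auto simp: y_def dir_var_def\<close>)
  have 2: "pcompose (line_subst (\<lambda>a. a) (\<lambda>i. 0) (\<lambda>i. a i / a 0) f) [:0, a 0:] = map_poly (ev a) (scale UNIV f)"
  proof -
    have "pcompose (line_subst (\<lambda>a. a) (\<lambda>i. 0) (\<lambda>i. a i / a 0) f) [:0, a 0:] = line_subst (\<lambda>a. a) (\<lambda>i. 0) a f"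
      unfolding line_subst_def
      by (subst meval_comp[OF const_comp_hom[OF comm_ring_hom_id] pcompose_hom.comm_ring_hom_axioms])
        (use a in \<open>simp add: pcompose_pCons\<close>)
    moreover have "map_poly (ev a) (scale UNIV f) = line_subst (\<lambda>a. a) (\<lambda>i. 0) a f"
      unfolding scale_def line_subst_def
      by (subst meval_comp[OF Const_poly_hom map_poly_hom[OF ev_hom]]) (simp add: a.map_poly_pCons_hom)
    ultimately show ?thesis by simp
  qed
  have "ev a H = coeff (map_poly (ev a) (scale UNIV f)) (tdeg f)" by (simp add: H_def)
  also have "\<dots> = a 0 ^ tdeg f * ev y (coeff (line_subst Const Var (dir_var n) f) (tdeg f))"
    unfolding 2[symmetric] 1[symmetric] coeff_pcompose_scale by simp
  finally show ?thesis using a by auto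
qed

lemma CHAR_mpoly: "CHAR(('i, 'c::comm_ring_1) mpoly) = CHAR('c)"
proof (rule CHAR_eqI)
  interpret comm_ring_hom "Const :: 'c \<Rightarrow> ('i, 'c) mpoly" by (rule Const_hom)
  have *: "of_nat n = (Const (of_nat n) :: ('i, 'c) mpoly)" for n by (simp add: hom_of_nat)
  have inj: "Const c = (0 :: ('i, 'c) mpoly) \<longleftrightarrow> c = 0" for c
    unfolding Const_def by (metis lookup_single_eq lookup_zero single_zero)
  show "of_nat CHAR('c) = (0 :: ('i, 'c) mpoly)" unfolding * by (simp add: inj)
  fix k assume "of_nat k = (0 :: ('i, 'c) mpoly)"
  then show "CHAR('c) dvd k" unfolding * inj by (simp add: of_nat_eq_0_iff_char_dvd)
qed

text \<open>Every exponent in \<open>f\<close> is divisible by \<open>p\<close>. Dividing the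
  exponents by \<open>p\<close> and taking \<open>p\<close>-th roots of the coefficients, available
  over an algebraically closed field, gives \<open>g\<close> because Frobenius is additive.\<close>

lemma partials_zero_imp_power:
  fixes f :: "('i, 'c::alg_closed_field) mpoly"
  assumes "CHAR('c) > 0" and z: "\<And>i. coeff (line_subst Const Var (\<lambda>j. if j = i then 1 else 0) f) 1 = 0"
  shows "\<exists>g. f = g ^ CHAR('c)"
proof -
  define p where "p = CHAR('c)"
  have "prime p" unfolding p_def using assms(1) by (rule prime_CHAR_semidom)
  have dvd: "p dvd lookup m i" if "m \<in> keys f" for m i
  proof (cases "lookup m i")
    case (Suc k)
    define m' where "m' = m - single i 1"
    have m: "m = m' + single i 1"
      by (rule poly_mapping_eqI) (use Suc in \<open>auto simp: m'_def lookup_add lookup_minus lookup_single when_def\<close>)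
    have "of_nat (lookup m i) * lookup f m = 0"
      using lookup_partial_derivative[of i f m'] z[of i] unfolding m by (simp add: lookup_add)
    then have "of_nat (lookup m i) = (0::'c)" using that by (auto simp: in_keys_iff)
    then show ?thesis unfolding p_def by (simp add: of_nat_eq_0_iff_char_dvd)
  qed auto
  have "\<exists>b. b ^ p = a" for a :: 'c
    using nth_root_exists[of p a] \<open>prime p\<close> prime_gt_0_nat by blast
  then obtain b where b: "b a ^ p = a" for a :: 'c by metis
  define g :: "('i, 'c) mpoly" where "g = (\<Sum>m\<in>keys f. Const (b (lookup f m)) *
    (\<Prod>i\<in>keys m. Var i ^ (lookup m i div p)))"
  interpret C: comm_ring_hom "Const :: 'c \<Rightarrow> ('i, 'c) mpoly" by (rule Const_hom)
  have "g ^ p = (\<Sum>m\<in>keys f. (Const (b (lookup f m)) *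
    (\<Prod>i\<in>keys m. Var i ^ (lookup m i div p))) ^ p)"
    unfolding g_def by (rule freshmans_dream_sum) (use \<open>prime p\<close> in \<open>simp_all add: CHAR_mpoly p_def\<close>)
  also have "\<dots> = (\<Sum>m\<in>keys f. single m (lookup f m))"
  proof (rule sum.cong[OF refl])
    fix m assume m: "m \<in> keys f"
    have "(\<Prod>i\<in>keys m. Var i ^ (lookup m i div p)) ^ p = (mon_eval Var m :: ('i, 'c) mpoly)"
      unfolding mon_eval_def prod_power_distrib
      by (rule prod.cong[OF refl]) (simp add: dvd_div_mult_self[OF dvd[OF m]] flip: power_mult)
    then show "(Const (b (lookup f m)) *
      (\<Prod>i\<in>keys m. Var i ^ (lookup m i div p))) ^ p = single m (lookup f m)"
      by (simp add: power_mult_distrib b single_eq_Const_mon_eval flip: C.hom_power)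
  qed
  also have "\<dots> = f" by (rule mpoly_as_sum[symmetric])
  finally show ?thesis unfolding p_def by metis
qed

text \<open>The coefficient of \<open>X\<close> is the derivative of \<open>f\<close> along
  \<open>(1, W)\<close>. Specializing \<open>W\<close> to zero and to the unit vectors isolates each
  partial derivative, so a vanishing derivative in \<open>X\<close> would make \<open>f\<close> a
  \<open>p\<close>-th power, contrary to irreducibility.\<close>

lemma generic_line_pderiv:
  fixes f :: "(nat, 'c::alg_closed_field) mpoly"
  assumes f: "irreducible f" "kill {n..} f = f" and n: "n > 0" and char: "CHAR('c) > 0"
  shows "pderiv (line_subst Const Var (dir_var n) f) \<noteq> 0"
proof
  assume "pderiv (line_subst Const Var (dir_var n) f) = 0"
  then have c1: "coeff (line_subst Const Var (dir_var n) f) 1 = 0"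
    using coeff_pderiv[of "line_subst Const Var (dir_var n) f" 0] by simp
  define e where "e i = (\<lambda>j. if j = i then 1 else (0 :: (nat, 'c) mpoly))" for i :: nat
  have D: "coeff (line_subst Const Var (\<lambda>j. e 0 j + (if i = 0 then 0 else e i j)) f) 1 = 0" for i
  proof -
    define s where "s j = (if j < n then Var j else if j = n - 1 + i \<and> i > 0 then 1 else (0 :: (nat, 'c) mpoly))" for j
    interpret s: comm_ring_hom "meval Const s" by (rule meval_hom[OF Const_hom])
    have "map_poly (meval Const s) (line_subst Const Var (dir_var n) f) = line_subst Const Var (\<lambda>j. e 0 j + (if i = 0 then 0 else e i j)) f"
      unfolding map_poly_line_subst[OF Const_hom meval_hom[OF Const_hom]] meval_Const'[OF Const_hom]
      by (rule line_subst_cong[OF Const_hom f(2)])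
        (use n in \<open>auto simp: meval_Var' Const_hom s_def dir_var_def e_def\<close>)
    from arg_cong[OF this, of "\<lambda>p. coeff p 1"] show ?thesis using c1 by simp
  qed
  have "coeff (line_subst Const Var (e i) f) 1 = 0" for i
  proof (cases "i = 0")
    case True
    then show ?thesis using D[of 0] by simp
  next
    case False
    have "coeff (line_subst Const Var (\<lambda>j. e 0 j + e i j) f) 1 = coeff (line_subst Const Var (e 0) f) 1 + coeff (line_subst Const Var (e i) f) 1"
      by (rule line_subst_deriv_add[OF Const_hom])
    then show ?thesis using D[of 0] D[of i] False by simp
  qed
  then obtain g where g: "f = g ^ CHAR('c)" using partials_zero_imp_power[OF char] unfolding e_def by blast
  have "prime CHAR('c)" using char by (rule prime_CHAR_semidom)
  then obtain k where k: "CHAR('c) = Suc (Suc k)" using prime_ge_2_nat by (metis Suc_diff_Suc add_2_eq_Suc le_Suc_ex)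
  have "f = g * g ^ Suc k" using g k by simp
  then have "g dvd 1 \<or> g ^ Suc k dvd 1" using f(1) comm_semiring_1_class.irreducibleD by blast
  then have "g dvd 1" by (metis dvd_mult_left power_Suc)
  then have "f dvd 1" unfolding g by (metis dvd_power_same power_one)
  then show False using f(1) by (simp add: comm_semiring_1_class.irreducible_def)
qed

theorem generic_line_good:
  fixes f :: "(nat, 'c::alg_closed_field) mpoly"
  assumes f: "irreducible f" "kill {n..} f = f" and n: "n > 0" and char: "CHAR('c) > 0"
    and d: "tdeg f > 0"
  shows "\<exists>B. B \<noteq> 0 \<and> B \<in> FTS {2 * n - 1..} (2 * int (tdeg f) ^ 2) \<and>
    (\<forall>y. ev y B \<noteq> 0 \<longrightarrow> (let p = line_subst (\<lambda>a. a) y (\<lambda>i. if i = 0 then 1 else y (n - 1 + i)) f in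
      coeff p (tdeg f) \<noteq> 0 \<and> (\<forall>x. poly p x = 0 \<longrightarrow> poly (pderiv p) x \<noteq> 0)))"
proof -
  define P where "P = line_subst Const Var (dir_var n) f"
  define L where "L = coeff P (tdeg f)"
  define R where "R = sylvester_det P (pderiv P)"
  have f0: "f \<noteq> 0" using f by auto
  have L0: "L \<noteq> 0" unfolding L_def P_def by (rule generic_line_lead_coeff[OF f(2) f0 n])
  have "degree P \<le> tdeg f" unfolding P_def by (rule line_subst_degree[OF Const_hom])
  moreover have "degree P \<ge> tdeg f" using L0 unfolding L_def by (rule le_degree)
  ultimately have degP: "degree P = tdeg f" by simp
  have P': "pderiv P \<noteq> 0" unfolding P_def by (rule generic_line_pderiv[OF f n char])
  have degP': "degree (pderiv P) < degree P"
    using degree_pderiv_le[of P] d degP by (simp add: less_eq_Suc_le le_diff_conv2 order.strict_trans1)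
  have R0: "R \<noteq> 0"
  proof
    assume "R = 0"
    then obtain U V where UV: "V \<noteq> 0" "degree V < degree P" "U * P = V * pderiv P"
      using sylvester_det_eq_0[of P "pderiv P"] degP d P' unfolding R_def by auto
    have "P dvd V * pderiv P" using UV(3) by (metis dvd_triv_right)
    then have "P dvd V \<or> P dvd pderiv P"
      using generic_line_prime[OF f n] unfolding P_def[symmetric] by (simp add: prime_elem_dvd_mult_iff)
    then show False using UV(1,2) P' degP' dvd_imp_degree_le by (metis leD)
  qed
  let ?F = "FTS {2 * n - 1..} :: int \<Rightarrow> (nat, 'c) mpoly set"
  have PF: "coeff P i \<in> ?F (int (tdeg f))" for i unfolding P_def by (rule generic_line_coeff_FTS[OF f(2) n])
  have "of_nat k * a \<in> ?F m" if "a \<in> ?F m" for a m k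
    by (induction k) (use that in \<open>auto simp: algebra_simps intro: FTS.zero FTS.add\<close>)
  then have PF': "coeff (pderiv P) i \<in> ?F (int (tdeg f))" for i
    unfolding coeff_pderiv using PF by blast
  have "R \<in> ?F (int (degree P + degree (pderiv P)) * int (tdeg f))"
    unfolding R_def by (rule FTS.sylvester_det_bound[OF PF PF'])
  from FTS.mult[OF this PF[of "tdeg f"]]
  have "R * L \<in> ?F (int (degree P + degree (pderiv P)) * int (tdeg f) + int (tdeg f))" unfolding L_def .
  moreover have "int (degree P + degree (pderiv P)) * int (tdeg f) + int (tdeg f) \<le> 2 * int (tdeg f) ^ 2"
  proof -
    have "int (degree P + degree (pderiv P)) + 1 \<le> 2 * int (tdeg f)" using degP' degP by linarith
    from mult_right_mono[OF this, of "int (tdeg f)"] show ?thesis by (simp add: algebra_simps power2_eq_square)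
  qed
  ultimately have "R * L \<in> ?F (2 * int (tdeg f) ^ 2)" using FTS.mono by blast
  moreover have "R * L \<noteq> 0" using R0 L0 by simp
  moreover have "let p = line_subst (\<lambda>a. a) y (\<lambda>i. if i = 0 then 1 else y (n - 1 + i)) f in
      coeff p (tdeg f) \<noteq> 0 \<and> (\<forall>x. poly p x = 0 \<longrightarrow> poly (pderiv p) x \<noteq> 0)" if "ev y (R * L) \<noteq> 0" for y
  proof -
    interpret y: comm_ring_hom "ev y :: (nat, 'c) mpoly \<Rightarrow> _" by (rule ev_hom)
    interpret y: idom_hom "ev y :: (nat, 'c) mpoly \<Rightarrow> _" ..
    interpret my: comm_ring_hom "map_poly (ev y) :: (nat, 'c) mpoly poly \<Rightarrow> _" by (rule map_poly_hom[OF ev_hom])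
    define p where "p = line_subst (\<lambda>a. a) y (\<lambda>i. if i = 0 then 1 else y (n - 1 + i)) f"
    have p: "map_poly (ev y) P = p"
    proof -
      have "(\<lambda>i. ev y (dir_var n i)) = (\<lambda>i. if i = 0 then 1 else y (n - 1 + i))" by (auto simp: dir_var_def)
      then show ?thesis unfolding P_def p_def map_poly_line_subst[OF Const_hom ev_hom] by simp
    qed
    have RL: "ev y R \<noteq> 0" "ev y L \<noteq> 0" using that by (auto simp: y.hom_mult)
    have "coeff p (tdeg f) \<noteq> 0" using RL(2) by (simp add: L_def flip: p)
    moreover have "poly (pderiv p) x \<noteq> 0" if "poly p x = 0" for x
    proof
      assume x: "poly (pderiv p) x = 0"
      \<comment> \<open>The identity \<open>A * P + B * pderiv P = [:R:]\<close> survives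
        evaluation, so no Sylvester matrices have to be compared before and after
        specialization.\<close>
      have "degree P + degree (pderiv P) > 0" using degP d by simp
      then have "\<exists>A B. A * P + B * pderiv P = [:R:]" unfolding R_def by (rule sylvester_det_comb)
      then obtain A B where AB: "A * P + B * pderiv P = [:R:]" by (elim exE)
      have "map_poly (ev y) A * p + map_poly (ev y) B * pderiv p = [:ev y R:]"
        using arg_cong[OF AB, of "map_poly (ev y)"]
        by (simp add: my.hom_add my.hom_mult p y.map_poly_pderiv y.map_poly_pCons_hom)
      from arg_cong[OF this, of "\<lambda>q. poly q x"] show False using x that RL(1) by simp
    qed
    ultimately show ?thesis unfolding p_def[symmetric] Let_def by blast
  qed
  ultimately show ?thesis by blast
qed

section \<open>Planes through a fixed line\<close>

lemma Const_1: "Const 1 = 1"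
  by (simp add: Const_def single_one)

text \<open>
  The second spanning vector of the plane is \<open>(0, z\<^sub>1, \<dots>)\<close>, and \<open>z\<close>\<open>\<^sub>i\<^sub>+\<^sub>1\<close> is variable \<open>i\<close>.
\<close>

definition off_var :: "nat \<Rightarrow> (nat, 'c::comm_ring_1) mpoly" where
  "off_var i = (if i = 0 then 0 else Var (i - 1))"

text \<open>This is the plane section at \<open>Y = 1\<close>. Because \<open>u 0 = 1\<close>, the
  substitution is a change of coordinates: \<open>X = x_0 - v_0\<close>, and \<open>z_i\<close> is
  recovered from \<open>x_i = v_i + z_i + u_i X\<close>.\<close>

lemma line_prime:
  fixes f :: "(nat, 'c::field) mpoly"
  assumes f: "irreducible f" and u: "u 0 = 1"
  shows "prime_elem (line_subst Const (\<lambda>i. Const (v i) + off_var i) (\<lambda>i. Const (u i)) f)"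
proof -
  define h where "h = line_subst Const (\<lambda>i. Const (v i) + off_var i) (\<lambda>i. Const (u i))"
  define g0 :: "(nat, 'c) mpoly \<Rightarrow> (nat, 'c) mpoly" where
    "g0 = meval Const (\<lambda>j. Var (Suc j) - Const (v (Suc j)) - Const (u (Suc j)) * (Var 0 - Const (v 0)))"
  define g where "g = plift g0 (Var 0 - Const (v 0))"
  have h_hom: "comm_ring_hom h" unfolding h_def by (rule line_subst_hom[OF Const_hom])
  have g0_hom: "comm_ring_hom g0" unfolding g0_def by (rule meval_hom[OF Const_hom])
  have g_hom: "comm_ring_hom g" unfolding g_def by (rule plift_hom[OF g0_hom])
  interpret h: comm_ring_hom h by (rule h_hom)
  interpret g0: comm_ring_hom g0 by (rule g0_hom)
  interpret g: comm_ring_hom g by (rule g_hom)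
  have hC: "h (Const a) = [:Const a:]" for a unfolding h_def by (rule line_subst_Const[OF Const_hom])
  have hV: "h (Var i) = [:Const (v i) + off_var i, Const (u i):]" for i
    unfolding h_def by (rule line_subst_Var[OF Const_hom])
  have g0C: "g0 (Const a) = Const a" for a by (simp add: g0_def meval_Const' Const_hom)
  have g0V: "g0 (Var j) = Var (Suc j) - Const (v (Suc j)) - Const (u (Suc j)) * (Var 0 - Const (v 0))" for j
    by (simp add: g0_def meval_Var' Const_hom)
  have gp: "g [:a, b:] = g0 a + (Var 0 - Const (v 0)) * g0 b" for a b
    unfolding g_def by simp
  have gc: "g [:a:] = g0 a" for a
    unfolding g_def by simp
  have gh: "(\<lambda>p. g (h p)) = (\<lambda>p. p)"
  proof (rule hom_ext[OF comm_ring_hom_comp[OF h_hom g_hom] comm_ring_hom_id])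
    fix i
    show "g (h (Var i)) = Var i"
      by (cases i) (simp_all add: hV gp gc g0V g0C off_var_def u Const_1 g0.hom_add algebra_simps)
  qed (simp add: hC gc g0C)
  have hg0: "(\<lambda>p. h (g0 p)) = (\<lambda>p. [:p:])"
  proof (rule hom_ext[OF comm_ring_hom_comp[OF g0_hom h_hom] const_poly_hom])
    fix i
    show "h (g0 (Var i)) = [:Var i:]"
      by (simp add: hV hC g0V off_var_def u Const_1 h.hom_minus h.hom_mult)
  qed (simp add: hC g0C)
  have hg: "(\<lambda>p. h (g p)) = (\<lambda>p. p)"
  proof (rule poly_hom_ext[OF comm_ring_hom_comp[OF g_hom h_hom] comm_ring_hom_id])
    show "h (g [:a:]) = [:a:]" for a using fun_cong[OF hg0, of a] by (simp add: gc)
    show "h (g [:0, 1:]) = [:0, 1:]" by (simp add: gp h.hom_minus hV hC off_var_def u Const_1)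
  qed
  show ?thesis
    unfolding h_def[symmetric] using fun_cong[OF gh] fun_cong[OF hg]
    by (intro prime_elem_iso[OF h_hom g_hom _ _ irreducible_imp_prime_mpoly[OF f]]) auto
qed

abbreviation eval_coeffs :: "'a::comm_ring_1 \<Rightarrow> 'a poly poly \<Rightarrow> 'a poly" where
  "eval_coeffs a \<equiv> map_poly (\<lambda>c. poly c a)"

lemma smult_cancelD:
  fixes p q :: "'a::idom poly"
  assumes "smult c p = smult c q" "c \<noteq> 0"
  shows "p = q"
proof (rule poly_eqI)
  fix i
  show "coeff p i = coeff q i" using arg_cong[OF assms(1), of "\<lambda>p. coeff p i"] assms(2) by simp
qed

text \<open>Each division by \<open>Y - 1\<close> lowers the degree of the leading coefficient by
  one, so it must stop at a polynomial that survives \<open>Y = 1\<close>.\<close>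

lemma strip_Y_minus_1:
  fixes G :: "'a::idom poly poly"
  assumes "G \<noteq> 0"
  shows "\<exists>k G1. G = smult ([:-1, 1:] ^ k) G1 \<and> eval_coeffs 1 G1 \<noteq> 0"
  using assms
proof (induction "degree (lead_coeff G)" arbitrary: G rule: less_induct)
  case less
  show ?case
  proof (cases "eval_coeffs 1 G = 0")
    case False
    then show ?thesis by (intro exI[of _ 0] exI[of _ G]) simp
  next
    case True
    have "poly (coeff G i) 1 = 0" for i
      using arg_cong[OF True, of "\<lambda>p. coeff p i"] by simp
    then have "[:[:-1, 1:]:] dvd G" by (simp add: const_poly_dvd_iff poly_eq_0_iff_dvd)
    then obtain G' where G': "G = smult [:-1, 1:] G'" by (auto simp: dvd_def)
    then have "G' \<noteq> 0" using less.prems by auto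
    then have "degree (lead_coeff G) = Suc (degree (lead_coeff G'))"
      unfolding G' by (simp add: degree_mult_eq del: mult_pCons_left)
    then obtain k G1 where "G' = smult ([:-1, 1:] ^ k) G1" "eval_coeffs 1 G1 \<noteq> 0"
      using less.hyps[of G'] \<open>G' \<noteq> 0\<close> by auto
    then show ?thesis unfolding G' by (intro exI[of _ "Suc k"] exI[of _ G1]) simp
  qed
qed

text \<open>
  Only the specialization \<open>Y = 1\<close> of \<open>P\<close> is known to be prime; the powers of \<open>Y - 1\<close> that this
  specialization would kill are divided out first.
\<close>

lemma no_small_multiple:
  fixes P :: "'a::idom poly poly"
  assumes F: "prime_elem (eval_coeffs 1 P)"
    and deg: "degree V < degree (eval_coeffs 1 P)" "degree G < degree (eval_coeffs 1 P)"
    and nz: "V \<noteq> 0" "G \<noteq> 0" and eq: "U * P = V * G"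
  shows False
proof -
  define E where "E = map_poly (\<lambda>c. poly c (1::'a))"
  define t where "t = [:-1, 1::'a:]"
  have E_hom: "comm_ring_hom E" unfolding E_def by (rule map_poly_hom[OF poly_at_hom])
  interpret E: comm_ring_hom E by (rule E_hom)
  have t0: "t \<noteq> 0" by (simp add: t_def)
  have Et: "E (smult (t ^ k) Q) = (if k = 0 then E Q else 0)" for k Q
    unfolding E_def t_def by (rule poly_eqI) (auto simp: coeff_map_poly)
  have "U \<noteq> 0" using nz eq by auto
  obtain a U1 where U1: "U = smult (t ^ a) U1" "E U1 \<noteq> 0"
    using strip_Y_minus_1[OF \<open>U \<noteq> 0\<close>] unfolding t_def E_def by blast
  obtain b V1 where V1: "V = smult (t ^ b) V1" "E V1 \<noteq> 0"
    using strip_Y_minus_1[OF nz(1)] unfolding t_def E_def by blast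
  obtain c G1 where G1: "G = smult (t ^ c) G1" "E G1 \<noteq> 0"
    using strip_Y_minus_1[OF nz(2)] unfolding t_def E_def by blast
  have EP: "E P \<noteq> 0" using F unfolding E_def by auto
  have eq': "smult (t ^ a) (U1 * P) = smult (t ^ (b + c)) (V1 * G1)"
    using eq unfolding U1(1) V1(1) G1(1) by (simp add: power_add mult.commute)
  \<comment> \<open>The powers of \<open>Y - 1\<close> on both sides are compared. With more of them
    on the right, cancelling and setting \<open>Y = 1\<close> makes \<open>E U1 * E P\<close> zero.
    Otherwise \<open>E P\<close> divides the nonzero product \<open>E V1 * E G1\<close>, so by
    primality one of its factors, both of smaller degree.\<close>
  show False
  proof (cases "a < b + c")
    case True
    then obtain k where k: "b + c = a + Suc k" by (metis add_Suc_right less_imp_Suc_add)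
    have "smult (t ^ a) (U1 * P) = smult (t ^ a) (smult (t ^ Suc k) (V1 * G1))"
      unfolding eq' k power_add by simp
    then have "U1 * P = smult (t ^ Suc k) (V1 * G1)" by (rule smult_cancelD) (simp add: t0)
    then have "E U1 * E P = 0" by (metis E.hom_mult Et nat.distinct(1))
    then show False using U1 EP by simp
  next
    case False
    then obtain k where k: "a = (b + c) + k" by (metis le_Suc_ex not_less)
    have "smult (t ^ (b + c)) (smult (t ^ k) U1 * P) = smult (t ^ a) (U1 * P)"
      by (simp add: k power_add)
    also note eq'
    finally have "smult (t ^ (b + c)) (smult (t ^ k) U1 * P) = smult (t ^ (b + c)) (V1 * G1)" .
    then have "smult (t ^ k) U1 * P = V1 * G1" by (rule smult_cancelD) (simp add: t0)
    then have "E (smult (t ^ k) U1) * E P = E V1 * E G1" by (metis E.hom_mult)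
    then have "E P dvd E V1 * E G1" by (metis dvd_triv_right)
    then have "E P dvd E V1 \<or> E P dvd E G1" using F unfolding E_def by (simp add: prime_elem_dvd_mult_iff)
    then have "degree (E P) \<le> degree (E V1) \<or> degree (E P) \<le> degree (E G1)"
      using V1 G1 dvd_imp_degree_le by blast
    moreover have "degree (E V1) \<le> degree V" "degree (E G1) \<le> degree G"
      using t0 unfolding E_def V1(1) G1(1) by (simp_all add: degree_map_poly_le)
    ultimately show False using deg unfolding E_def by linarith
  qed
qed

section \<open>Bivariate polynomials at power series\<close>

lemma fps_of_poly_hom: "comm_ring_hom (fps_of_poly :: 'a::comm_ring_1 poly \<Rightarrow> 'a fps)"
  by unfold_locales (simp_all add: fps_of_poly_add fps_of_poly_mult)

definition fps_at :: "'a::comm_ring_1 fps \<Rightarrow> 'a poly poly \<Rightarrow> 'a fps" where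
  "fps_at x G = poly (map_poly fps_of_poly G) x"

lemma fps_at_hom: "comm_ring_hom (fps_at x)"
  using plift_hom[OF fps_of_poly_hom, of x] unfolding plift_def fps_at_def .

lemma fps_at_monom: "fps_at x (monom (monom a j) i) = fps_const a * (x ^ i * fps_X ^ j)"
proof -
  interpret comm_ring_hom "fps_of_poly :: 'a poly \<Rightarrow> 'a fps" by (rule fps_of_poly_hom)
  show ?thesis by (simp add: fps_at_def poly_monom fps_of_poly_monom mult_ac)
qed

text \<open>A pair \<open>(s, j)\<close> stands for the monomial \<open>X^(s - j) Y^j\<close> of
  total degree \<open>s\<close>.\<close>

definition triangle :: "nat \<Rightarrow> (nat \<times> nat) set" where
  "triangle D = Sigma {..D} (\<lambda>s. {..s})"

lemma finite_triangle [simp]: "finite (triangle D)"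
  by (simp add: triangle_def)

lemma card_triangle: "2 * card (triangle D) = (D + 1) * (D + 2)"
  unfolding triangle_def by (induction D) (simp_all add: card_SigmaI)

lemma poly_poly_expand:
  fixes G :: "'a::comm_ring_1 poly poly"
  assumes "\<And>i j. i + j > D \<Longrightarrow> coeff (coeff G i) j = 0"
  shows "G = (\<Sum>p\<in>triangle D. monom (monom (coeff (coeff G (fst p - snd p)) (snd p)) (snd p)) (fst p - snd p))"
proof (intro poly_eqI)
  fix i j
  have "coeff (coeff (\<Sum>p\<in>triangle D. monom (monom (coeff (coeff G (fst p - snd p)) (snd p)) (snd p)) (fst p - snd p)) i) j
    = (\<Sum>p\<in>triangle D. if p = (i + j, j) then coeff (coeff G i) j else 0)"
    unfolding coeff_sum
    by (rule sum.cong[OF refl]) (auto simp: triangle_def)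
  also have "\<dots> = (if (i + j, j) \<in> triangle D then coeff (coeff G i) j else 0)" by simp
  also have "\<dots> = coeff (coeff G i) j" using assms[of i j] by (auto simp: triangle_def not_le)
  finally show "coeff (coeff G i) j = coeff (coeff (\<Sum>p\<in>triangle D. monom (monom (coeff (coeff G (fst p - snd p)) (snd p)) (snd p)) (fst p - snd p)) i) j"
    by simp
qed

definition triangle_col :: "'a::comm_ring_1 fps \<Rightarrow> nat \<times> nat \<Rightarrow> nat \<Rightarrow> 'a" where
  "triangle_col x p r = fps_nth (x ^ (fst p - snd p) * fps_X ^ snd p) r"

lemma fps_at_expand:
  assumes "\<And>i j. i + j > D \<Longrightarrow> coeff (coeff G i) j = 0"
  shows "fps_nth (fps_at x G) r = (\<Sum>p\<in>triangle D. coeff (coeff G (fst p - snd p)) (snd p) * triangle_col x p r)"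
proof -
  interpret comm_ring_hom "fps_at x" by (rule fps_at_hom)
  have "fps_at x G = (\<Sum>p\<in>triangle D. fps_const (coeff (coeff G (fst p - snd p)) (snd p)) * (x ^ (fst p - snd p) * fps_X ^ snd p))"
    by (subst poly_poly_expand[OF assms]) (simp_all only: hom_sum fps_at_monom)
  then show ?thesis by (simp add: fps_sum_nth triangle_col_def)
qed

text \<open>Eliminating \<open>X\<close> gives \<open>A * P + B * G = R(Y)\<close>, and at the root
  \<open>x\<close> only \<open>B(x) G(x)\<close> is left. If \<open>G(x)\<close> vanished up to
  \<open>Y^(d D)\<close>, so would \<open>R\<close>, whose degree is at most \<open>d D\<close> by
  Bezout; then \<open>R = 0\<close>, which \<open>no_small_multiple\<close> excludes. The condition
  \<open>D < d\<close> keeps \<open>G\<close> below the degree of \<open>P\<close>.\<close>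

lemma fps_at_nonzero:
  fixes P G :: "'a::idom poly poly"
  assumes F: "prime_elem (eval_coeffs 1 P)" "degree (eval_coeffs 1 P) = d" "degree P = d"
    and P: "\<And>i j. i + j > d \<Longrightarrow> coeff (coeff P i) j = 0"
    and G: "\<And>i j. i + j > D \<Longrightarrow> coeff (coeff G i) j = 0" "G \<noteq> 0" and D: "D < d"
    and x: "fps_at x P = 0"
  shows "\<exists>r\<le>d * D. fps_nth (fps_at x G) r \<noteq> 0"
proof (rule ccontr)
  assume "\<not> ?thesis"
  then have van: "fps_nth (fps_at x G) r = 0" if "r \<le> d * D" for r using that by blast
  interpret comm_ring_hom "fps_at x" by (rule fps_at_hom)
  interpret Dg: filtration "degree_upto :: int \<Rightarrow> 'a poly set" by (rule degree_filtration)
  have "degree G \<le> D"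
  proof (rule degree_le, intro allI impI)
    fix i assume "D < i"
    then show "coeff G i = 0" using G(1)[of i] by (intro poly_eqI) auto
  qed
  then have dG: "degree G < d" using D by simp
  have "sylvester_det P G \<in> degree_upto (int (degree G) * int d + int (degree P) * int D - int (degree G) * int (degree P))"
    by (rule Dg.sylvester_det_graded_bound) (use P G in auto)
  then have R: "coeff (sylvester_det P G) r = 0" if "r > d * D" for r
    using that F(3) by (simp flip: of_nat_mult)
  have "sylvester_det P G \<noteq> 0"
  proof
    assume "sylvester_det P G = 0"
    then obtain U V where "V \<noteq> 0" "degree V < degree P" "U * P = V * G"
      using sylvester_det_eq_0[of P G] G(2) D F(3) by auto
    then show False using no_small_multiple[OF F(1), of V G U] F dG G(2) by auto
  qed
  have "degree P + degree G > 0" using F(3) D by simp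
  then have "\<exists>A B. A * P + B * G = [:sylvester_det P G:]" by (rule sylvester_det_comb)
  then obtain A B where AB: "A * P + B * G = [:sylvester_det P G:]" by (elim exE)
  interpret fp: comm_ring_hom "fps_of_poly :: 'a poly \<Rightarrow> 'a fps" by (rule fps_of_poly_hom)
  have "fps_at x [:sylvester_det P G:] = fps_of_poly (sylvester_det P G)"
    by (simp add: fps_at_def fp.map_poly_pCons_hom)
  then have "fps_of_poly (sylvester_det P G) = fps_at x B * fps_at x G"
    using arg_cong[OF AB, of "fps_at x"] x by (simp add: hom_add hom_mult)
  then have "coeff (sylvester_det P G) r = fps_nth (fps_at x G * fps_at x B) r" for r
    by (metis fps_of_poly_nth mult.commute)
  moreover have "fps_nth (fps_at x G * fps_at x B) r = 0" if "r \<le> d * D" for r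
    by (rule fps_mult_nth_eq_0[of "d * D"]) (use van that in auto)
  ultimately have "coeff (sylvester_det P G) r = 0" for r using R[of r] by (cases "r \<le> d * D") auto
  then have "sylvester_det P G = 0" by (intro poly_eqI) simp
  then show False using \<open>sylvester_det P G \<noteq> 0\<close> by simp
qed

lemma (in filtration) const_filtration: "filtration (\<lambda>_. F 0)"
  by unfold_locales (use mult[of _ 0 _ 0] in \<open>auto intro: zero one add uminus\<close>)

lemma fps_nth_0_hom: "comm_ring_hom (\<lambda>x :: 'a::comm_ring_1 fps. fps_nth x 0)"
  by unfold_locales simp_all

locale good_line =
  fixes f :: "(nat, 'c::field) mpoly" and n d :: nat and v u :: "nat \<Rightarrow> 'c" and z :: 'c
  assumes f: "irreducible f" "kill {n..} f = f" "tdeg f = d"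
    and n: "n > 0" and u: "u 0 = 1"
    and lc: "coeff (line_subst (\<lambda>a. a) v u f) d \<noteq> 0"
    and root: "poly (line_subst (\<lambda>a. a) v u f) z = 0" "poly (pderiv (line_subst (\<lambda>a. a) v u f)) z \<noteq> 0"
begin

text \<open>The section with symbolic \<open>z\<close>, in \<open>X\<close> over polynomials in
  \<open>Y\<close>. Each \<open>z_i\<close> comes multiplied by \<open>Y\<close>: this yields both
  the degree bounds in \<open>z\<close> and the reduction of primality to
  \<open>Y = 1\<close>.\<close>

definition P :: "(nat, 'c) mpoly poly poly" where
  "P = line_subst (\<lambda>a. [:Const a:]) (\<lambda>i. [:Const (v i), off_var i:]) (\<lambda>i. [:Const (u i):]) f"

lemma P_at_1: "eval_coeffs 1 P = line_subst Const (\<lambda>i. Const (v i) + off_var i) (\<lambda>i. Const (u i)) f"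
  unfolding P_def map_poly_line_subst[OF Const_poly_hom poly_at_hom] by simp

lemma P_at_0: "eval_coeffs 0 P = map_poly Const (line_subst (\<lambda>a. a) v u f)"
  unfolding P_def map_poly_line_subst[OF Const_poly_hom poly_at_hom] map_poly_line_subst[OF comm_ring_hom_id Const_hom] by simp

lemma P_coeff: "i + j > d \<Longrightarrow> coeff (coeff P i) j = 0"
  unfolding P_def f(3)[symmetric] by (rule line_subst_bidegree[OF Const_hom])

lemma coeff_P_d: "coeff P d \<noteq> 0"
proof -
  interpret comm_ring_hom "Const :: 'c \<Rightarrow> (nat, 'c) mpoly" by (rule Const_hom)
  have "Const (coeff (line_subst (\<lambda>a. a) v u f) d) \<noteq> (0 :: (nat, 'c) mpoly)"
    using lc unfolding Const_def by (metis lookup_single_eq lookup_zero)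
  then have "coeff (eval_coeffs 0 P) d \<noteq> 0" unfolding P_at_0 by simp
  then show ?thesis by auto
qed

lemma degree_P: "degree P = d"
proof (rule antisym)
  show "degree P \<le> d" unfolding P_def using line_subst_degree[OF Const_poly_hom, of _ _ f] f(3) by simp
  show "d \<le> degree P" by (rule le_degree[OF coeff_P_d])
qed

text \<open>The total degree in \<open>X\<close> and \<open>Y\<close> is at most \<open>d\<close>,
  so the coefficient of \<open>X^d\<close> is free of \<open>Y\<close> and survives
  \<open>Y = 1\<close>.\<close>

lemma degree_P_at_1: "degree (eval_coeffs 1 P) = d"
proof (rule antisym)
  show "degree (eval_coeffs 1 P) \<le> d" using degree_map_poly_le[of _ P] degree_P by simp
  have *: "coeff P d = [:coeff (coeff P d) 0:]"
    using P_coeff[of d] by (intro poly_eqI) (simp add: coeff_pCons split: nat.splits)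
  then have "coeff (coeff P d) 0 \<noteq> 0" using coeff_P_d by auto
  moreover have "poly (coeff P d) 1 = coeff (coeff P d) 0" by (subst *) simp
  ultimately have "coeff (eval_coeffs 1 P) d \<noteq> 0" by simp
  then show "d \<le> degree (eval_coeffs 1 P)" by (rule le_degree)
qed

lemma root_exists:
  "\<exists>x. fps_nth x 0 = Const z \<and> fps_at x P = 0 \<and> (\<forall>j. fps_nth x j \<in> FTS {n - 1..} (int j))"
  unfolding fps_at_def
proof (rule hensel[where u = "Const (inverse (poly (pderiv (line_subst (\<lambda>a. a) v u f)) z))"])
  let ?F = "FTS {n - 1..} :: int \<Rightarrow> (nat, 'c) mpoly set"
  interpret fp: comm_ring_hom "fps_of_poly :: (nat, 'c) mpoly poly \<Rightarrow> _" by (rule fps_of_poly_hom)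
  interpret n0: comm_ring_hom "\<lambda>x :: (nat, 'c) mpoly fps. fps_nth x 0" by (rule fps_nth_0_hom)
  interpret n0: idom_hom "\<lambda>x :: (nat, 'c) mpoly fps. fps_nth x 0" ..
  interpret C: comm_ring_hom "Const :: 'c \<Rightarrow> (nat, 'c) mpoly" by (rule Const_hom)
  interpret C: idom_hom "Const :: 'c \<Rightarrow> (nat, 'c) mpoly" ..
  show "filtration ?F" by (rule FTS.filtration_axioms)
  show "Const z \<in> ?F 0" "Const (inverse (poly (pderiv (line_subst (\<lambda>a. a) v u f)) z)) \<in> ?F 0" by simp_all
  define Pf where "Pf = map_poly fps_of_poly P"
  have Pf0: "map_poly (\<lambda>x. fps_nth x 0) Pf = map_poly Const (line_subst (\<lambda>a. a) v u f)"
    unfolding Pf_def P_at_0[symmetric] by (rule poly_eqI) (simp add: coeff_map_poly poly_0_coeff_0)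
  have ev0: "fps_nth (poly Q (fps_const (Const z))) 0 = poly (map_poly (\<lambda>x. fps_nth x 0) Q) (Const z)" for Q :: "(nat, 'c) mpoly fps poly"
    using n0.poly_map_poly[of Q "fps_const (Const z)"] by simp
  show "fps_nth (poly (map_poly fps_of_poly P) (fps_const (Const z))) 0 = 0"
    unfolding Pf_def[symmetric] ev0 Pf0 by (simp add: root)
  show "Const (inverse (poly (pderiv (line_subst (\<lambda>a. a) v u f)) z)) *
      fps_nth (poly (pderiv (map_poly fps_of_poly P)) (fps_const (Const z))) 0 = 1"
    unfolding Pf_def[symmetric] ev0 n0.map_poly_pderiv Pf0 C.map_poly_pderiv[symmetric] C.poly_map_poly
    using root(2) by (simp add: Const_1 flip: C.hom_mult)
  interpret Fp: filtration "graded_fps ?F" by (rule FTS.fps_filtration)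
  interpret Fc: filtration "\<lambda>_. graded_fps ?F 0" by (rule Fp.const_filtration)
  \<comment> \<open>\<open>X\<close> carries no weight and the coefficient of \<open>Y^j\<close> has
    level \<open>j\<close>; in these terms the hypothesis of \<open>hensel\<close> says that all
    coefficients of \<open>Pf\<close> lie in level \<open>0\<close>.\<close>
  interpret Fl: filtration "\<lambda>_. {Q. \<forall>i. coeff Q i \<in> graded_fps ?F 0}" by (rule Fc.flat_poly_filtration)
  have Pf_line: "Pf = line_subst (\<lambda>a. fps_of_poly [:Const a:]) (\<lambda>i. fps_of_poly [:Const (v i), off_var i:]) (\<lambda>i. fps_of_poly [:Const (u i):]) f"
    unfolding Pf_def P_def by (rule map_poly_line_subst[OF Const_poly_hom fps_of_poly_hom])
  have hom: "comm_ring_hom (\<lambda>a. fps_of_poly [:Const a :: (nat, 'c) mpoly:])"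
    by (rule comm_ring_hom_comp[OF Const_poly_hom fps_of_poly_hom])
  have mem: "Const a \<in> ?F (int i)" for a i
  proof -
    have "?F 0 \<subseteq> ?F (int i)" by (rule FTS.mono) simp
    then show ?thesis using Const_FTS by blast
  qed
  have zm: "off_var i \<in> ?F 1" if "i < n" for i
  proof (cases "i = 0")
    case False
    then have "i - 1 \<notin> {n - 1..}" using that by auto
    then have "Var (i - 1) \<in> ?F 1" by (rule Var_FTS)
    then show ?thesis using False by (simp add: off_var_def)
  qed (simp add: off_var_def FTS.zero)
  have "Pf \<in> {Q. \<forall>i. coeff Q i \<in> graded_fps ?F 0}"
    unfolding Pf_line
  proof (rule Fl.hom_FTS[OF line_subst_hom[OF hom], where S = "{n..}"])
    show "f \<in> FTS {n..} (int d)" using f FT_tdeg[of f] by (auto simp: FTS_def)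
    fix i assume "i \<notin> {n..}"
    then have "off_var i \<in> ?F 1" by (intro zm) simp
    then show "line_subst (\<lambda>a. fps_of_poly [:Const a:]) (\<lambda>i. fps_of_poly [:Const (v i), off_var i:]) (\<lambda>i. fps_of_poly [:Const (u i):]) (Var i)
        \<in> {Q. \<forall>i. coeff Q i \<in> graded_fps ?F 0}"
      using mem[of _ 0] by (auto simp: line_subst_Var[OF hom] coeff_pCons FTS.zero simp del: fps_of_poly_pCons fps_of_poly_const split: nat.splits)
  qed (use mem[of _ 0] in \<open>auto simp: line_subst_Const[OF hom] coeff_pCons FTS.zero simp del: fps_of_poly_pCons fps_of_poly_const split: nat.splits\<close>)
  then show "fps_nth (coeff (map_poly fps_of_poly P) i) m \<in> ?F (int m)" for i m
    unfolding Pf_def[symmetric] by auto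
qed

text \<open>Weights on the monomials are the coefficients of a polynomial \<open>G\<close> of total
  degree at most \<open>D\<close>, and the weighted columns add up to \<open>G(x)\<close>; so this
  is \<open>fps_at_nonzero\<close>.\<close>

lemma triangle_col_independent:
  assumes x: "fps_at x P = 0" and D: "D < d" and w: "\<exists>p\<in>triangle D. w p \<noteq> 0"
  shows "\<exists>r<Suc (d * D). (\<Sum>p\<in>triangle D. w p * triangle_col x p r) \<noteq> 0"
proof -
  define G where "G = (\<Sum>p\<in>triangle D. monom (monom (w p) (snd p)) (fst p - snd p))"
  have cG: "coeff (coeff G i) j = (if i + j \<le> D then w (i + j, j) else 0)" for i j
  proof -
    have "coeff (coeff G i) j = (\<Sum>p\<in>triangle D. if p = (i + j, j) then w p else 0)"
      unfolding G_def coeff_sum by (rule sum.cong[OF refl]) (auto simp: triangle_def)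
    then show ?thesis by (simp add: triangle_def)
  qed
  have G0: "coeff (coeff G i) j = 0" if "i + j > D" for i j using that by (simp add: cG)
  have wG: "coeff (coeff G (fst p - snd p)) (snd p) = w p" if "p \<in> triangle D" for p
    using that by (auto simp: cG triangle_def)
  obtain p where p: "p \<in> triangle D" "w p \<noteq> 0" using w by blast
  then have "coeff (coeff G (fst p - snd p)) (snd p) \<noteq> 0" using wG by simp
  then have "G \<noteq> 0" by auto
  have "\<exists>r\<le>d * D. fps_nth (fps_at x G) r \<noteq> 0"
    by (rule fps_at_nonzero[OF _ degree_P_at_1 degree_P P_coeff G0 \<open>G \<noteq> 0\<close> D x])
      (unfold P_at_1, rule line_prime[where u = u, OF f(1) u])
  moreover have "fps_nth (fps_at x G) r = (\<Sum>p\<in>triangle D. w p * triangle_col x p r)" for r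
    by (subst fps_at_expand[of D G, OF G0]) (auto simp: wG intro: sum.cong)
  ultimately show ?thesis by (auto simp: less_Suc_eq_le)
qed

lemma triangle_col_FTS:
  assumes "\<And>j. fps_nth x j \<in> FTS S (int j)"
  shows "triangle_col x p r \<in> FTS S (int r)"
proof -
  interpret Fp: filtration "graded_fps (FTS S)" by (rule FTS.fps_filtration)
  have "fps_X \<in> graded_fps (FTS S) 0"
  proof -
    have "FTS S 0 \<subseteq> FTS S 1" by (rule FTS.mono) simp
    then have "1 \<in> FTS S 1" using FTS.one by blast
    then show ?thesis using FTS.zero by (auto simp: fps_X_def)
  qed
  moreover have "x \<in> graded_fps (FTS S) 0" using assms by simp
  ultimately have "x ^ (fst p - snd p) * fps_X ^ snd p \<in> graded_fps (FTS S) 0"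
    using Fp.mult[OF Fp.power Fp.power, of x 0 fps_X 0] by simp
  then show ?thesis unfolding triangle_col_def by simp
qed

definition plane :: "(nat \<Rightarrow> 'c) \<Rightarrow> 'c poly poly" where
  "plane y = line_subst (\<lambda>a. [:a:]) (\<lambda>i. [:v i, if i = 0 then 0 else y (i - 1):]) (\<lambda>i. [:u i:]) f"

text \<open>\<open>B\<close> is a nonzero maximal minor of the matrix of the series
  \<open>x^i Y^j\<close>. If the section at \<open>y\<close> has a factor \<open>g\<close> through
  the root, the coefficients of \<open>g\<close> form a nonzero kernel vector of that matrix
  evaluated at \<open>y\<close>, so the minor vanishes there.\<close>

theorem minor_exists:
  assumes D: "D < d"
  shows "\<exists>B b. B \<noteq> 0 \<and> B \<in> FTS {n - 1..} (int b) \<and>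
    8 * int b \<le> 4 * (int D + 1) * (int D + 2) * int d * int D - (int D + 1) * (int D + 2) * ((int D + 1) * (int D + 2) - 2) \<and>
    (\<forall>y g h. plane y = g * h \<longrightarrow> poly (eval_coeffs 0 g) z = 0 \<longrightarrow>
      (\<forall>i j. i + j > D \<longrightarrow> coeff (coeff g i) j = 0) \<longrightarrow> ev y B = 0)"
proof -
  obtain x where x: "fps_nth x 0 = Const z" "fps_at x P = 0" "\<And>j. fps_nth x j \<in> FTS {n - 1..} (int j)"
    using root_exists by blast
  define M where "M = card (triangle D)"
  obtain e where e: "bij_betw e {..<M} (triangle D)"
    using ex_bij_betw_nat_finite[OF finite_triangle[of D]] by (auto simp: M_def atLeast0LessThan)
  define c where "c l r = triangle_col x (e l) r" for l r
  have "\<exists>r<Suc (d * D). (\<Sum>l<M. w l * c l r) \<noteq> 0" if w: "\<exists>l<M. w l \<noteq> 0" for w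
  proof -
    obtain l where l: "l < M" "w l \<noteq> 0" using w by blast
    define w' where "w' p = w (the_inv_into {..<M} e p)" for p
    have w'e: "w' (e l) = w l" if "l < M" for l
      using that e unfolding w'_def by (simp add: the_inv_into_f_f bij_betw_def)
    have "\<exists>p\<in>triangle D. w' p \<noteq> 0"
      using l w'e[of l] e by (intro bexI[of _ "e l"]) (auto simp: bij_betw_def)
    from triangle_col_independent[OF x(2) D this]
    obtain r where "r < Suc (d * D)" "(\<Sum>p\<in>triangle D. w' p * triangle_col x p r) \<noteq> 0" by blast
    moreover have "(\<Sum>p\<in>triangle D. w' p * triangle_col x p r) = (\<Sum>l<M. w l * c l r)"
      unfolding sum.reindex_bij_betw[OF e, symmetric] by (rule sum.cong[OF refl]) (simp add: w'e c_def)
    ultimately show ?thesis by auto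
  qed
  then obtain \<rho> where \<rho>: "inj_on \<rho> {..<M}" "\<rho> ` {..<M} \<subseteq> {..<Suc (d * D)}" "det (mat M M (\<lambda>(i, l). c l (\<rho> i))) \<noteq> 0"
    using nonzero_minor[of M "Suc (d * D)" c] by blast
  define A where "A = mat M M (\<lambda>(i, l). c l (\<rho> i))"
  define b where "b = (\<Sum>i<M. \<rho> i)"
  have A: "A \<in> carrier_mat M M" by (simp add: A_def)
  have "det A \<in> FTS {n - 1..} ((\<Sum>i<M. int (\<rho> i)) + (\<Sum>j<M. 0))"
    by (rule FTS.det[OF A]) (use triangle_col_FTS[OF x(3)] in \<open>simp add: A_def c_def\<close>)
  then have "det A \<in> FTS {n - 1..} (int b)" by (simp add: b_def)
  moreover have "8 * int b \<le> 4 * (int D + 1) * (int D + 2) * int d * int D - (int D + 1) * (int D + 2) * ((int D + 1) * (int D + 2) - 2)"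
  proof -
    have m: "2 * int M = (int D + 1) * (int D + 2)"
      using arg_cong[OF card_triangle[of D], of int] unfolding M_def by (simp add: algebra_simps)
    have "2 * int b \<le> 2 * int M * int (d * D) - int M * (int M - 1)"
      using sum_distinct_le[OF \<rho>(1,2)] by (simp add: b_def)
    then have "8 * int b \<le> 4 * (2 * int M) * int d * int D - (2 * int M) * (2 * int M - 2)"
      by (simp add: algebra_simps)
    then show ?thesis unfolding m by (simp only: mult.assoc)
  qed
  moreover have "ev y (det A) = 0"
    if g: "plane y = g * h" "poly (eval_coeffs 0 g) z = 0" "\<And>i j. i + j > D \<Longrightarrow> coeff (coeff g i) j = 0" for y g h
  proof -
    interpret E: comm_ring_hom "ev y :: (nat, 'c) mpoly \<Rightarrow> _" by (rule ev_hom)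
    define xi where "xi = Abs_fps (\<lambda>j. ev y (fps_nth x j))"
    \<comment> \<open>Coefficientwise evaluation of \<open>z\<close> at \<open>y\<close> is a ring
      homomorphism of power series and carries the generic root to a root of the specialized
      section.\<close>
    define em where "em = (\<lambda>t. Abs_fps (\<lambda>j. ev y (fps_nth t j)))"
    have em_hom: "comm_ring_hom em"
      by unfold_locales (auto simp: em_def fps_eq_iff E.hom_add E.hom_mult E.hom_sum fps_mult_nth)
    interpret em: comm_ring_hom em by (rule em_hom)
    have xi: "em x = xi" by (simp add: em_def xi_def)
    have em_fps: "em (fps_of_poly q) = fps_of_poly (map_poly (ev y) q)" for q
      by (simp add: em_def fps_eq_iff)
    have emP: "em (fps_at x Q) = fps_at xi (map_poly (map_poly (ev y)) Q)" for Q
    proof -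
      have "map_poly em (map_poly fps_of_poly Q) = map_poly fps_of_poly (map_poly (map_poly (ev y)) Q)"
        by (rule poly_eqI) (simp add: coeff_map_poly em_fps)
      then show ?thesis unfolding fps_at_def using em.poly_map_poly[of "map_poly fps_of_poly Q" x] by (simp add: xi)
    qed
    have Py: "map_poly (map_poly (ev y)) P = plane y"
    proof -
      have "(\<lambda>i. map_poly (ev y) [:Const (v i), off_var i:]) = (\<lambda>i. [:v i, if i = 0 then 0 else y (i - 1):])"
        by (auto simp: E.map_poly_pCons_hom off_var_def)
      then show ?thesis
        unfolding P_def plane_def map_poly_line_subst[OF Const_poly_hom map_poly_hom[OF ev_hom]]
        by (simp add: E.map_poly_pCons_hom)
    qed
    interpret at: comm_ring_hom "fps_at xi" by (rule fps_at_hom)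
    interpret p0: comm_ring_hom "map_poly (\<lambda>c :: 'c poly. poly c 0)" by (rule map_poly_hom[OF poly_at_hom])
    have prod0: "fps_at xi g * fps_at xi h = 0"
      using emP[of P] x(2) Py g(1) by (simp add: at.hom_mult)
    have nth0: "fps_nth (fps_at xi q) 0 = poly (eval_coeffs 0 q) z" for q
    proof -
      interpret n0: comm_ring_hom "\<lambda>x :: 'c fps. fps_nth x 0" by (rule fps_nth_0_hom)
      have "map_poly (\<lambda>x. fps_nth x 0) (map_poly fps_of_poly q) = eval_coeffs 0 q"
        by (rule poly_eqI) (simp add: coeff_map_poly poly_0_coeff_0)
      moreover have "fps_nth xi 0 = z" using x(1) by (simp add: xi_def)
      ultimately show ?thesis unfolding fps_at_def
        using n0.poly_map_poly[of "map_poly fps_of_poly q" xi] by simp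
    qed
    have "eval_coeffs 0 (plane y) = line_subst (\<lambda>a. a) v u f"
      unfolding plane_def map_poly_line_subst[OF const_poly_hom poly_at_hom] by simp
    then have lin_gh: "line_subst (\<lambda>a. a) v u f = eval_coeffs 0 g * eval_coeffs 0 h"
      using g(1) by (simp add: p0.hom_mult)
    \<comment> \<open>The root is simple, so by the product rule \<open>g\<close> and
      \<open>h\<close> cannot both vanish at it. Hence \<open>h(xi)\<close> has a nonzero constant
      term, and the zero product must come from \<open>g(xi)\<close>.\<close>
    have "poly (eval_coeffs 0 h) z \<noteq> 0"
      using root(2) g(2) unfolding lin_gh by (auto simp: pderiv_mult)
    then have "fps_at xi h \<noteq> 0" using nth0[of h] by auto
    then have g0: "fps_at xi g = 0" using prod0 by simp
    have "plane y \<noteq> 0"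
    proof
      assume "plane y = 0"
      then have "line_subst (\<lambda>a. a) v u f = 0" unfolding lin_gh using g(1) by (metis mult_zero_left mult_zero_right mult_eq_0_iff p0.hom_mult p0.hom_zero)
      then show False using lc by simp
    qed
    then have "g \<noteq> 0" using g(1) by auto
    define a where "a = vec M (\<lambda>l. coeff (coeff g (fst (e l) - snd (e l))) (snd (e l)))"
    have av: "a \<in> carrier_vec M" by (simp add: a_def)
    have "a \<noteq> 0\<^sub>v M"
    proof
      assume a0: "a = 0\<^sub>v M"
      have z0: "coeff (coeff g (fst p - snd p)) (snd p) = 0" if "p \<in> triangle D" for p
      proof -
        have "p \<in> e ` {..<M}" using that e by (simp add: bij_betw_def)
        then obtain l where "l < M" "p = e l" by auto
        then show ?thesis using arg_cong[OF a0, of "\<lambda>a. a $ l"] by (simp add: a_def)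
      qed
      have "g = 0" using poly_poly_expand[of D g, OF g(3)] by (simp add: z0 cong: sum.cong_simp)
      then show False using \<open>g \<noteq> 0\<close> by simp
    qed
    moreover have "map_mat (ev y) A *\<^sub>v a = 0\<^sub>v M"
    proof (rule eq_vecI)
      fix i assume i: "i < dim_vec (0\<^sub>v M)"
      have ec: "ev y (c l r) = triangle_col xi (e l) r" for l r
      proof -
        have "em (x ^ k * fps_X ^ j) = xi ^ k * fps_X ^ j" for k j
        proof -
          have "em fps_X = fps_X" by (auto simp: em_def fps_eq_iff fps_X_def)
          then show ?thesis by (simp add: em.hom_mult em.hom_power xi)
        qed
        from arg_cong[OF this, of "\<lambda>t. fps_nth t r"] show ?thesis
          unfolding c_def triangle_col_def em_def by simp
      qed
      have "(map_mat (ev y) A *\<^sub>v a) $ i = (\<Sum>l<M. ev y (c l (\<rho> i)) * coeff (coeff g (fst (e l) - snd (e l))) (snd (e l)))"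
        using i by (simp add: A_def a_def scalar_prod_def atLeast0LessThan)
      also have "\<dots> = (\<Sum>p\<in>triangle D. coeff (coeff g (fst p - snd p)) (snd p) * triangle_col xi p (\<rho> i))"
        unfolding sum.reindex_bij_betw[OF e, symmetric] by (simp add: ec mult.commute)
      also have "\<dots> = fps_nth (fps_at xi g) (\<rho> i)" by (rule fps_at_expand[OF g(3), symmetric])
      finally show "(map_mat (ev y) A *\<^sub>v a) $ i = 0\<^sub>v M $ i" using i g0 by simp
    qed (simp add: A_def)
    ultimately have "det (map_mat (ev y) A) = 0"
      using det_0_iff_vec_prod_zero[of "map_mat (ev y) A" M] A av by auto
    then show ?thesis by (simp add: E.hom_det)
  qed
  ultimately show ?thesis using \<rho>(3) unfolding A_def[symmetric] by blast
qed

end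

section \<open>Plane sections\<close>

lemma to_ac_hom: "comm_ring_hom (to_ac :: 'a::field \<Rightarrow> 'a alg_closure)"
  by unfold_locales simp_all

lemma Const_to_ac_hom: "comm_ring_hom (\<lambda>a::'a::field. Const (to_ac a) :: ('i, 'a alg_closure) mpoly)"
  by (rule comm_ring_hom_comp[OF to_ac_hom Const_hom])

lemma keys_to_closure: "keys (to_closure p) = keys p"
  by (auto simp: to_closure_def in_keys_iff Poly_Mapping.map.rep_eq when_def)

lemma lookup_to_closure: "lookup (to_closure p) m = to_ac (lookup p m)"
  by (auto simp: to_closure_def Poly_Mapping.map.rep_eq when_def)

lemma total_degree_to_closure: "total_degree (to_closure p) = total_degree p"
  by (simp add: total_degree_def keys_to_closure)

lemma to_closure_eq_meval: "to_closure p = meval (\<lambda>a. Const (to_ac a)) Var p"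
proof -
  have "to_closure p = (\<Sum>m\<in>keys p. single m (to_ac (lookup p m)))"
    by (subst mpoly_as_sum) (simp add: keys_to_closure lookup_to_closure)
  then show ?thesis by (simp add: meval_def single_eq_Const_mon_eval)
qed

lemma to_closure_hom: "comm_ring_hom (to_closure :: ('i, 'a::field) mpoly \<Rightarrow> _)"
  using meval_hom[OF Const_to_ac_hom, of Var] unfolding to_closure_eq_meval[abs_def] .

lemma substitute_eq_meval: "substitute s p = meval Const s p"
  by (simp add: substitute_def meval_def mon_eval_def)

lemma meval_to_closure: "comm_ring_hom h \<Longrightarrow> meval h s (to_closure p) = meval (\<lambda>a. h (to_ac a)) s p"
proof -
  assume h: "comm_ring_hom h"
  interpret m: comm_ring_hom "meval h s" by (rule meval_hom[OF h])
  show ?thesis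
    unfolding to_closure_eq_meval
    by (subst meval_comp[OF Const_to_ac_hom m.comm_ring_hom_axioms]) (simp add: meval_Const'[OF h] meval_Var'[OF h])
qed

lemma tdeg_hom_le:
  assumes "comm_ring_hom h" "\<And>c. h (Const c) = Const c" "\<And>i. h (Var i) \<in> FT 1"
  shows "tdeg (h p) \<le> tdeg p"
  by (rule tdeg_le) (rule FT.hom_FT[OF assms(1) _ assms(3) FT_tdeg], simp add: assms(2))

text \<open>By \<open>kill_factor\<close> a factorization of \<open>q\<close> stays within the first
  \<open>n\<close> variables, so the inverse renaming carries it back to \<open>p\<close>.\<close>

lemma rename:
  fixes p :: "('i, 'c::field) mpoly" and \<iota> :: "'i \<Rightarrow> nat" and \<kappa> :: "nat \<Rightarrow> 'i"
  assumes \<iota>: "\<And>i. \<iota> i < n" "\<And>i. \<kappa> (\<iota> i) = i" "\<And>j. j < n \<Longrightarrow> \<iota> (\<kappa> j) = j"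
  defines "q \<equiv> meval Const (\<lambda>i. Var (\<iota> i)) p :: (nat, 'c) mpoly"
  shows "kill {n..} q = q" "tdeg q = tdeg p"
    "irreducible p \<Longrightarrow> irreducible q"
proof -
  define R where "R = (meval Const (\<lambda>i. Var (\<iota> i)) :: ('i, 'c) mpoly \<Rightarrow> (nat, 'c) mpoly)"
  define Q where "Q = (meval Const (\<lambda>j. if j < n then Var (\<kappa> j) else 0) :: (nat, 'c) mpoly \<Rightarrow> ('i, 'c) mpoly)"
  have R_hom: "comm_ring_hom R" unfolding R_def by (rule meval_hom[OF Const_hom])
  have Q_hom: "comm_ring_hom Q" unfolding Q_def by (rule meval_hom[OF Const_hom])
  interpret R: comm_ring_hom R by (rule R_hom)
  interpret Q: comm_ring_hom Q by (rule Q_hom)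
  have RC: "R (Const c) = Const c" and RV: "R (Var i) = Var (\<iota> i)" for c i
    by (simp_all add: R_def meval_Const' meval_Var' Const_hom)
  have QC: "Q (Const c) = Const c" and QV: "Q (Var j) = (if j < n then Var (\<kappa> j) else 0)" for c j
    by (simp_all add: Q_def meval_Const' meval_Var' Const_hom)
  have QR: "(\<lambda>p. Q (R p)) = (\<lambda>p. p)"
    by (rule hom_ext[OF comm_ring_hom_comp[OF R_hom Q_hom] comm_ring_hom_id]) (simp_all add: RC RV QC QV \<iota>)
  have RQ: "(\<lambda>p. R (Q p)) = kill {n..}"
    by (rule hom_ext[OF comm_ring_hom_comp[OF Q_hom R_hom] kill_hom]) (simp_all add: RC RV QC QV \<iota>)
  have qR: "q = R p" by (simp add: q_def R_def)
  have Qq: "Q q = p" using fun_cong[OF QR, of p] by (simp add: qR)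
  have RQ': "R (Q g) = kill {n..} g" for g using fun_cong[OF RQ, of g] .
  show k: "kill {n..} q = q" using RQ'[of q] Qq qR by simp
  show "tdeg q = tdeg p"
  proof (rule antisym)
    show "tdeg q \<le> tdeg p" unfolding qR by (rule tdeg_hom_le[OF R_hom]) (simp_all add: RC RV)
    have "tdeg (Q q) \<le> tdeg q" by (rule tdeg_hom_le[OF Q_hom]) (simp_all add: QC QV FT.zero)
    then show "tdeg p \<le> tdeg q" unfolding Qq .
  qed
  assume irr: "irreducible p"
  show "irreducible q"
  proof (rule comm_semiring_1_class.irreducibleI)
    show q0: "q \<noteq> 0" using irr Qq by auto
    show "\<not> q dvd 1"
    proof
      assume "q dvd 1"
      then have "Q q dvd 1" by (rule Q.hom_dvd_1)
      then show False using irr by (simp add: Qq comm_semiring_1_class.irreducible_def)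
    qed
    fix a b assume ab: "q = a * b"
    have ka: "kill {n..} a = a" using kill_factor[of "{n..}" a b] k q0 ab by simp
    have kb: "kill {n..} b = b" using kill_factor[of "{n..}" b a] k q0 ab by (simp add: mult.commute)
    have "p = Q a * Q b" using Qq ab by (simp add: Q.hom_mult)
    then have "Q a dvd 1 \<or> Q b dvd 1" using irr comm_semiring_1_class.irreducibleD by blast
    then have "R (Q a) dvd 1 \<or> R (Q b) dvd 1" using R.hom_dvd_1 by blast
    then show "a dvd 1 \<or> b dvd 1" unfolding RQ' ka kb .
  qed
qed

section \<open>Polynomials in X and Y as iterated univariate polynomials\<close>

definition bivariate :: "(xy, 'c::comm_ring_1) mpoly \<Rightarrow> 'c poly poly" where
  "bivariate = meval (\<lambda>a. [:[:a:]:]) (\<lambda>x. case x of XVar \<Rightarrow> [:0, 1:] | YVar \<Rightarrow> [:[:0, 1:]:])"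

lemma const2_hom: "comm_ring_hom (\<lambda>a :: 'c::comm_ring_1. [:[:a:]:])"
  by (rule comm_ring_hom_comp[OF const_poly_hom const_poly_hom])

lemma bivariate_hom: "comm_ring_hom bivariate"
  unfolding bivariate_def by (rule meval_hom[OF const2_hom])

lemma bivariate_Const [simp]: "bivariate (Const a) = [:[:a:]:]"
  by (simp add: bivariate_def meval_Const' const2_hom)

lemma bivariate_Var [simp]: "bivariate (Var XVar) = [:0, 1:]" "bivariate (Var YVar) = [:[:0, 1:]:]"
  by (simp_all add: bivariate_def meval_Var' const2_hom)

lemma bivariate_inj: "bivariate p = bivariate q \<Longrightarrow> p = q"
proof -
  define g where "g = (plift (plift Const (Var YVar)) (Var XVar) :: 'a poly poly \<Rightarrow> (xy, 'a) mpoly)"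
  have g0_hom: "comm_ring_hom (plift Const (Var YVar) :: 'a poly \<Rightarrow> (xy, 'a) mpoly)" by (rule plift_hom[OF Const_hom])
  have g_hom: "comm_ring_hom g" unfolding g_def by (rule plift_hom[OF g0_hom])
  interpret C: comm_ring_hom "Const :: 'a \<Rightarrow> (xy, 'a) mpoly" by (rule Const_hom)
  interpret g0: comm_ring_hom "plift Const (Var YVar) :: 'a poly \<Rightarrow> (xy, 'a) mpoly" by (rule g0_hom)
  have V: "g (bivariate (Var i)) = Var i" for i
    by (cases i) (simp_all add: g_def Const_1)
  have "(\<lambda>p. g (bivariate p)) = (\<lambda>p. p)"
    by (rule hom_ext[OF comm_ring_hom_comp[OF bivariate_hom g_hom] comm_ring_hom_id _ V]) (simp add: g_def)
  then have "g (bivariate p) = p" "g (bivariate q) = q" by (auto dest: fun_cong)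
  then show "bivariate p = bivariate q \<Longrightarrow> p = q" by metis
qed

lemma bivariate_coeff: "i + j > total_degree p \<Longrightarrow> coeff (coeff (bivariate p) i) j = 0" for p :: "(xy, 'c::comm_ring_1) mpoly"
proof -
  interpret D: filtration "degree_upto :: int \<Rightarrow> 'c poly set" by (rule degree_filtration)
  interpret DP: filtration "graded_poly (degree_upto :: int \<Rightarrow> 'c poly set)"
    by (rule D.poly_filtration)
  have V: "bivariate (Var x) \<in> graded_poly degree_upto 1" for x
    by (cases x) (auto simp: coeff_pCons split: nat.splits)
  have "bivariate p \<in> graded_poly degree_upto (int (tdeg p))"
    by (rule DP.hom_FT[OF bivariate_hom _ V FT_tdeg]) (auto simp: coeff_pCons split: nat.splits)
  then show "i + j > total_degree p \<Longrightarrow> ?thesis" by (auto simp: tdeg_eq_total_degree)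
qed

text \<open>Renaming the two variables to \<open>0\<close> and \<open>1\<close> preserves total
  degrees and reduces this to \<open>tdeg_mult\<close>.\<close>

lemma xy_total_degree_mult:
  fixes g h :: "(xy, 'c::field) mpoly"
  assumes "g * h \<noteq> 0"
  shows "total_degree g + total_degree h \<le> total_degree (g * h)"
proof -
  define \<iota> where "\<iota> x = (case x of XVar \<Rightarrow> 0 | YVar \<Rightarrow> (1::nat))" for x
  define \<kappa> where "\<kappa> j = (if j = 0 then XVar else YVar)" for j :: nat
  have 1: "\<iota> i < 2" "\<kappa> (\<iota> i) = i" for i by (cases i; simp add: \<iota>_def \<kappa>_def)+
  have 2: "j < 2 \<Longrightarrow> \<iota> (\<kappa> j) = j" for j by (auto simp: \<iota>_def \<kappa>_def)
  define R where "R = (meval Const (\<lambda>i. Var (\<iota> i)) :: (xy, 'c) mpoly \<Rightarrow> (nat, 'c) mpoly)"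
  have dgR: "tdeg (R p) = tdeg p" for p unfolding R_def by (rule rename(2)[where \<kappa> = \<kappa>]) (use 1 2 in auto)
  interpret R: comm_ring_hom R unfolding R_def by (rule meval_hom[OF Const_hom])
  define Q where "Q = (meval Const (\<lambda>j. Var (\<kappa> j)) :: (nat, 'c) mpoly \<Rightarrow> (xy, 'c) mpoly)"
  interpret Q: comm_ring_hom Q unfolding Q_def by (rule meval_hom[OF Const_hom])
  have "(\<lambda>p. Q (R p)) = (\<lambda>p. p)"
    by (rule hom_ext[OF comm_ring_hom_comp[OF R.comm_ring_hom_axioms Q.comm_ring_hom_axioms] comm_ring_hom_id])
      (simp_all add: R_def Q_def meval_Const' meval_Var' Const_hom 1)
  then have inj: "R p \<noteq> 0" if "p \<noteq> 0" for p using that by (metis Q.hom_zero)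
  have "g \<noteq> 0" "h \<noteq> 0" using assms by auto
  then have "tdeg (R g * R h) = tdeg (R g) + tdeg (R h)"
    by (intro tdeg_mult inj)
  then have "tdeg (g * h) = tdeg g + tdeg h"
    using dgR[of "g * h"] dgR[of g] dgR[of h] by (simp only: R.hom_mult)
  then show ?thesis by (simp add: tdeg_eq_total_degree)
qed

lemma zeros_count:
  fixes p :: "(nat, 'c::field) mpoly" and enc :: "'b \<Rightarrow> 'c list"
  assumes p: "p \<noteq> 0" "p \<in> FTS {N..} (int e)" and A: "finite A"
    and enc: "inj_on enc S" "\<And>x. x \<in> S \<Longrightarrow> length (enc x) = N \<and> set (enc x) \<subseteq> A"
  shows "card {x \<in> S. ev ((!) (enc x)) p = 0} * card A \<le> e * card A ^ N"
proof -
  let ?Z = "{xs. length xs = N \<and> set xs \<subseteq> A \<and> ev ((!) xs) p = 0}"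
  have "finite ?Z"
    by (rule finite_subset[OF _ finite_lists_length_eq[OF A, of N]]) auto
  then have "card {x \<in> S. ev ((!) (enc x)) p = 0} \<le> card ?Z"
    using enc by (intro card_inj_on_le[of enc]) (auto intro: inj_on_subset)
  then have "card {x \<in> S. ev ((!) (enc x)) p = 0} * card A \<le> card ?Z * card A" by (rule mult_le_mono1)
  also have "\<dots> \<le> e * card A ^ N"
    by (rule schwartz_zippel) (use p A in \<open>auto simp: FTS_def\<close>)
  finally show ?thesis .
qed

context good_line
begin

lemma plane_at_0: "eval_coeffs 0 (plane y) = line_subst (\<lambda>a. a) v u f"
  unfolding plane_def map_poly_line_subst[OF const_poly_hom poly_at_hom] by simp

lemma plane_coeff: "i + j > d \<Longrightarrow> coeff (coeff (plane y) i) j = 0"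
  unfolding plane_def f(3)[symmetric] by (rule line_subst_bidegree[OF comm_ring_hom_id])

lemma plane_neq_0: "plane y \<noteq> 0"
  using plane_at_0[of y] lc by auto

lemma lead_plane: "degree (plane y) = d" "degree (lead_coeff (plane y)) = 0"
proof -
  have "coeff (eval_coeffs 0 (plane y)) d \<noteq> 0" unfolding plane_at_0 by (rule lc)
  then have "coeff (plane y) d \<noteq> 0" by auto
  then have "d \<le> degree (plane y)" by (rule le_degree)
  moreover have "degree (plane y) \<le> d"
  proof (rule degree_le, intro allI impI)
    fix i assume "d < i"
    then show "coeff (plane y) i = 0" using plane_coeff[of i] by (intro poly_eqI) auto
  qed
  ultimately show 1: "degree (plane y) = d" by simp
  show "degree (lead_coeff (plane y)) = 0"
    unfolding 1 using plane_coeff[of d] by (intro le_zero_eq[THEN iffD1] degree_le) auto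
qed

text \<open>The leading coefficient of the section in \<open>X\<close> is constant in
  \<open>Y\<close>, hence so is that of its factor \<open>g\<close>. Setting \<open>Y = 0\<close>
  therefore keeps the \<open>X\<close>-degree of \<open>g\<close>, and \<open>X\<close>-degree zero
  would make \<open>g\<close> a nonzero constant.\<close>

lemma factor_degree_at_0:
  assumes "plane y = g * h" "\<not> g dvd 1"
  shows "degree (eval_coeffs 0 g) > 0"
proof -
  have nz: "g \<noteq> 0" "h \<noteq> 0" using assms(1) plane_neq_0[of y] by auto
  then have "lead_coeff (plane y) = lead_coeff g * lead_coeff h"
    using assms(1) by (simp add: lead_coeff_mult)
  then have "degree (lead_coeff g) = 0"
    using lead_plane(2)[of y] nz by (simp add: degree_mult_eq)
  then obtain a where a: "lead_coeff g = [:a:]" by (metis degree_eq_zeroE)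
  then have a0: "a \<noteq> 0" using nz by auto
  have "degree g > 0"
  proof (rule ccontr)
    assume "\<not> ?thesis"
    then have "g = [:lead_coeff g:]" by (metis degree_eq_zeroE coeff_pCons_0 degree_pCons_0 gr0I)
    then have "g = [:[:a:]:]" using a by simp
    then have "[:[:inverse a:]:] * g = 1" using a0 by (simp add: one_pCons)
    then have "g dvd 1" by (metis dvd_triv_right)
    then show False using assms(2) by simp
  qed
  moreover have "coeff (eval_coeffs 0 g) (degree g) \<noteq> 0"
    using a a0 by simp
  ultimately show ?thesis by (meson le_degree order_less_le_trans)
qed

end

lemma bivariate_unit: "bivariate g dvd 1 \<Longrightarrow> g dvd 1" for g :: "(xy, 'c::field) mpoly"
proof -
  assume "bivariate g dvd 1"
  then obtain p where p: "bivariate g = [:p:]" "p dvd 1" by (auto simp: is_unit_poly_iff)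
  then have "degree p = 0" "p \<noteq> 0" by (auto simp: is_unit_poly_iff)
  then obtain c where c: "p = [:c:]" "c \<noteq> 0" by (auto elim: degree_eq_zeroE)
  then have "bivariate g = bivariate (Const c)" using p by simp
  then have "g = Const c" by (rule bivariate_inj)
  then show "g dvd 1" using Const_unit[OF c(2)] by simp
qed

lemma to_closure_Const [simp]: "to_closure (Const a) = Const (to_ac a)"
  by (simp add: to_closure_eq_meval meval_Const' Const_to_ac_hom)

lemma to_closure_Var [simp]: "to_closure (Var i) = Var i"
  by (simp add: to_closure_eq_meval meval_Var' Const_to_ac_hom)

lemma bivariate_plane_section:
  fixes p :: "('n, 'a::field) mpoly"
  shows "bivariate (to_closure (plane_section k p (v, w, z))) =
    meval (\<lambda>a. [:[:to_ac a:]:]) (\<lambda>i. if i = k then [:[:to_ac (v i):], 1:]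
      else [:[:to_ac (v i), to_ac (z i):], [:to_ac (w i):]:]) p"
proof -
  interpret c: comm_ring_hom "to_closure :: (xy, 'a) mpoly \<Rightarrow> _" by (rule to_closure_hom)
  interpret b: comm_ring_hom "bivariate :: (xy, 'a alg_closure) mpoly \<Rightarrow> _" by (rule bivariate_hom)
  have s: "bivariate (to_closure (if i = k then Var XVar + Const (v i)
        else Const (w i) * Var XVar + Const (z i) * Var YVar + Const (v i)))
    = (if i = k then [:[:to_ac (v i):], 1:] else [:[:to_ac (v i), to_ac (z i):], [:to_ac (w i):]:])" for i
    by (simp add: c.hom_add c.hom_mult b.hom_add b.hom_mult)
  show ?thesis
    unfolding plane_section_def prod.case substitute_eq_meval
    by (subst meval_comp[OF Const_hom comm_ring_hom_comp[OF to_closure_hom bivariate_hom]]) (simp only: s to_closure_Const bivariate_Const)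
qed

lemma section_degree:
  fixes p :: "('n, 'a::field) mpoly"
  shows "total_degree (to_closure (plane_section k p t)) \<le> total_degree p"
proof -
  obtain v w z where t: "t = (v, w, z)" by (cases t)
  have m: "Const a * Var x \<in> FT 1" for a :: 'a and x :: xy
    using FT.mult[OF Const_FT Var_FT, of a x] by simp
  have "tdeg (plane_section k p t) \<le> tdeg p"
    unfolding plane_section_def t prod.case substitute_eq_meval
  proof (rule tdeg_le, rule FT.hom_FT[OF meval_hom[OF Const_hom] _ _ FT_tdeg])
    fix i
    have C': "Const (v i) \<in> FT 1" using FT.mono[of 0 1] Const_FT[of "v i"] by auto
    show "meval Const (\<lambda>i. if i = k then Var XVar + Const (v i)
        else Const (w i) * Var XVar + Const (z i) * Var YVar + Const (v i)) (Var i) \<in> FT 1"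
      using C' by (auto simp: meval_Var' Const_hom intro!: FT.add m)
  qed (simp add: meval_Const' Const_hom)
  then show ?thesis by (simp add: total_degree_to_closure tdeg_eq_total_degree)
qed

text \<open>A bad \<open>x\<close> is charged with all of \<open>T\<close>; the good ones are
  charged as if all of \<open>S\<close> were good.\<close>

lemma count_combine:
  fixes R :: "'b \<Rightarrow> 'd \<Rightarrow> bool" and \<beta> :: real
  assumes fin: "finite S" "finite T"
    and bad: "real (card {x \<in> S. \<not> good x}) * q \<le> \<alpha> * real (card S)"
    and good: "\<And>x. x \<in> S \<Longrightarrow> good x \<Longrightarrow> real (card {z \<in> T. R x z}) * q \<le> \<beta> * real (card T)"
    and \<beta>: "\<beta> \<ge> 0" "q \<ge> 0"
  shows "real (card {(x, z) \<in> S \<times> T. R x z}) * q \<le> (\<alpha> + \<beta>) * real (card S) * real (card T)"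
proof -
  let ?B = "{x \<in> S. \<not> good x}" and ?G = "{x \<in> S. good x}"
  have "{(x, z) \<in> S \<times> T. R x z} \<subseteq> ?B \<times> T \<union> (SIGMA x:?G. {z \<in> T. R x z})" by auto
  then have "card {(x, z) \<in> S \<times> T. R x z} \<le> card (?B \<times> T) + card (SIGMA x:?G. {z \<in> T. R x z})"
    using fin by (intro order_trans[OF card_mono card_Un_le]) auto
  also have "\<dots> = card ?B * card T + (\<Sum>x\<in>?G. card {z \<in> T. R x z})"
    using fin by (simp add: card_cartesian_product)
  finally have "real (card {(x, z) \<in> S \<times> T. R x z}) \<le> real (card ?B * card T + (\<Sum>x\<in>?G. card {z \<in> T. R x z}))"
    by (rule of_nat_mono)
  then have "real (card {(x, z) \<in> S \<times> T. R x z}) * q \<le> real (card ?B * card T + (\<Sum>x\<in>?G. card {z \<in> T. R x z})) * q"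
    using \<beta> by (intro mult_right_mono)
  also have "\<dots> = (real (card ?B) * q) * real (card T) + (\<Sum>x\<in>?G. real (card {z \<in> T. R x z}) * q)"
    by (simp add: algebra_simps sum_distrib_left)
  also have "(\<Sum>x\<in>?G. real (card {z \<in> T. R x z}) * q) \<le> (\<Sum>x\<in>?G. \<beta> * real (card T))"
    by (intro sum_mono good) auto
  also have "\<dots> = real (card ?G) * (\<beta> * real (card T))" by simp
  also have "\<dots> \<le> real (card S) * (\<beta> * real (card T))"
    using fin \<beta> by (intro mult_right_mono of_nat_mono card_mono) auto
  also have "(real (card ?B) * q) * real (card T) \<le> (\<alpha> * real (card S)) * real (card T)"
    using bad by (intro mult_right_mono) auto
  finally show ?thesis by (simp add: algebra_simps)
qed

text \<open>Both factors of a proper factorization are nonconstant, so both have degree at most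
  \<open>d - 1\<close>, and the given root lies on one of them.\<close>

lemma (in good_line) reducible_section:
  assumes s: "bivariate s = plane y" "total_degree s \<le> d" "\<not> irreducible s" and d: "d > 0"
  shows "\<exists>g h. plane y = g * h \<and> poly (eval_coeffs 0 g) z = 0 \<and>
    (\<forall>i j. i + j > d - 1 \<longrightarrow> coeff (coeff g i) j = 0)"
proof -
  interpret b: comm_ring_hom "bivariate :: (xy, 'c) mpoly \<Rightarrow> _" by (rule bivariate_hom)
  interpret p0: comm_ring_hom "map_poly (\<lambda>c :: 'c poly. poly c 0)" by (rule map_poly_hom[OF poly_at_hom])
  have "s \<noteq> 0" using s(1) plane_neq_0[of y] by auto
  moreover have "\<not> s dvd 1"
  proof
    assume "s dvd 1"
    then have "plane y dvd 1" using b.hom_dvd_1[of s] s(1) by simp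
    then have "degree (plane y) = 0" by (auto simp: is_unit_poly_iff)
    then show False using lead_plane(1)[of y] d by simp
  qed
  ultimately obtain g h where gh: "s = g * h" "\<not> g dvd 1" "\<not> h dvd 1"
    using s(3) by (auto simp: comm_semiring_1_class.irreducible_def)
  have pos: "total_degree q > 0" if "\<not> q dvd 1" "q \<noteq> 0" for q :: "(xy, 'c) mpoly"
  proof (rule ccontr)
    assume "\<not> ?thesis"
    then obtain c where c: "q = Const c" using tdeg_0_imp_Const[of q] by (auto simp: tdeg_eq_total_degree)
    moreover have "c \<noteq> 0" using c that by (auto simp: Const_def)
    ultimately show False using that Const_unit[of c] by blast
  qed
  have nz: "g \<noteq> 0" "h \<noteq> 0" using gh \<open>s \<noteq> 0\<close> by auto
  have "total_degree g + total_degree h \<le> d"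
    using xy_total_degree_mult[of g h] gh(1) \<open>s \<noteq> 0\<close> s(2) by simp
  then have deg: "total_degree g \<le> d - 1" "total_degree h \<le> d - 1"
    using pos[OF gh(2) nz(1)] pos[OF gh(3) nz(2)] by linarith+
  have eq: "plane y = bivariate g * bivariate h" using s(1) gh(1) by (simp add: b.hom_mult)
  have "line_subst (\<lambda>a. a) v u f = eval_coeffs 0 (bivariate g) * eval_coeffs 0 (bivariate h)"
    using plane_at_0[of y] eq by (simp add: p0.hom_mult)
  then have "poly (eval_coeffs 0 (bivariate g)) z = 0 \<or> poly (eval_coeffs 0 (bivariate h)) z = 0"
    using root(1) by simp
  then show ?thesis
  proof
    assume "poly (eval_coeffs 0 (bivariate g)) z = 0"
    moreover have "coeff (coeff (bivariate g) i) j = 0" if "i + j > d - 1" for i j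
      using that deg by (intro bivariate_coeff) simp
    ultimately show ?thesis using eq by blast
  next
    assume "poly (eval_coeffs 0 (bivariate h)) z = 0"
    moreover have "coeff (coeff (bivariate h) i) j = 0" if "i + j > d - 1" for i j
      using that deg by (intro bivariate_coeff) simp
    moreover have "plane y = bivariate h * bivariate g" using eq by (simp add: mult.commute)
    ultimately show ?thesis by blast
  qed
qed

text \<open>A factor that is not a unit has positive \<open>X\<close>-degree at
  \<open>Y = 0\<close>, so over an algebraically closed field it meets the line in a root
  \<open>z'\<close> of \<open>f\<close>. Which root it is depends on \<open>g\<close>.\<close>

lemma small_factor_section:
  fixes f :: "(nat, 'c::alg_closed_field) mpoly"
  assumes "good_line f n d v u z"
    and s: "bivariate s = good_line.plane f v u y" "irreducible g" "g dvd s" "total_degree g \<le> D"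
  shows "\<exists>z'. poly (line_subst (\<lambda>a. a) v u f) z' = 0 \<and> (\<exists>g h. good_line.plane f v u y = g * h \<and>
    poly (eval_coeffs 0 g) z' = 0 \<and> (\<forall>i j. i + j > D \<longrightarrow> coeff (coeff g i) j = 0))"
proof -
  interpret good_line f n d v u z by fact
  interpret b: comm_ring_hom "bivariate :: (xy, 'c) mpoly \<Rightarrow> _" by (rule bivariate_hom)
  interpret p0: comm_ring_hom "map_poly (\<lambda>c :: 'c poly. poly c 0)" by (rule map_poly_hom[OF poly_at_hom])
  obtain h where h: "s = g * h" using s(3) by (auto simp: dvd_def)
  have eq: "plane y = bivariate g * bivariate h" using s(1) h by (simp add: b.hom_mult)
  have "\<not> bivariate g dvd 1" using bivariate_unit s(2) by (auto simp: comm_semiring_1_class.irreducible_def)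
  then have "degree (eval_coeffs 0 (bivariate g)) > 0" by (rule factor_degree_at_0[OF eq])
  then obtain z' where z': "poly (eval_coeffs 0 (bivariate g)) z' = 0"
    using alg_closed_imp_poly_has_root by blast
  have "line_subst (\<lambda>a. a) v u f = eval_coeffs 0 (bivariate g) * eval_coeffs 0 (bivariate h)"
    using plane_at_0[of y] eq by (simp add: p0.hom_mult)
  then have "poly (line_subst (\<lambda>a. a) v u f) z' = 0" using z' by simp
  moreover have "coeff (coeff (bivariate g) i) j = 0" if "i + j > D" for i j
    using that s(4) by (intro bivariate_coeff) simp
  ultimately show ?thesis using z' eq by blast
qed

text \<open>
  A minor of size \<open>M = (D + 1) (D + 2) / 2\<close> formed from distinct rows \<open>\<le> d D\<close>, row \<open>r\<close> having entries of
  degree \<open>\<le> r\<close>, has degree at most \<open>M d D - M (M - 1) / 2\<close>.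
\<close>

definition minor_bound :: "nat \<Rightarrow> nat \<Rightarrow> real" where
  "minor_bound d D = (4 * (real D + 1) * (real D + 2) * real d * real D
    - (real D + 1) * (real D + 2) * ((real D + 1) * (real D + 2) - 2)) / 8"

lemma minor_zeros:
  fixes f :: "(nat, 'c::field) mpoly" and enc :: "'b \<Rightarrow> 'c list"
  assumes "good_line f n d v u z" and D: "D < d" and A: "finite A" and S: "finite S"
    and enc: "inj_on enc S" "\<And>x. x \<in> S \<Longrightarrow> length (enc x) = n - 1 \<and> set (enc x) \<subseteq> A"
  shows "real (card {x \<in> S. \<exists>g h. good_line.plane f v u ((!) (enc x)) = g * h \<and>
      poly (eval_coeffs 0 g) z = 0 \<and> (\<forall>i j. i + j > D \<longrightarrow> coeff (coeff g i) j = 0)}) * real (card A)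
    \<le> minor_bound d D * real (card A ^ (n - 1))"
    and "minor_bound d D \<ge> 0"
proof -
  interpret good_line f n d v u z by fact
  obtain B b where B: "B \<noteq> 0" "B \<in> FTS {n - 1..} (int b)"
    "8 * int b \<le> 4 * (int D + 1) * (int D + 2) * int d * int D - (int D + 1) * (int D + 2) * ((int D + 1) * (int D + 2) - 2)"
    and z: "\<And>y g h. plane y = g * h \<Longrightarrow> poly (eval_coeffs 0 g) z = 0 \<Longrightarrow>
      (\<forall>i j. i + j > D \<longrightarrow> coeff (coeff g i) j = 0) \<Longrightarrow> ev y B = 0"
    using minor_exists[OF D] by blast
  have "real_of_int (8 * int b) \<le> real_of_int (4 * (int D + 1) * (int D + 2) * int d * int D - (int D + 1) * (int D + 2) * ((int D + 1) * (int D + 2) - 2))"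
    using B(3) by (rule of_int_le_iff[THEN iffD2])
  then have b: "real b \<le> minor_bound d D" unfolding minor_bound_def by simp
  then show "minor_bound d D \<ge> 0" by (rule order_trans[rotated]) simp
  let ?S = "{x \<in> S. \<exists>g h. plane ((!) (enc x)) = g * h \<and>
      poly (eval_coeffs 0 g) z = 0 \<and> (\<forall>i j. i + j > D \<longrightarrow> coeff (coeff g i) j = 0)}"
  have "card ?S \<le> card {x \<in> S. ev ((!) (enc x)) B = 0}"
    using S z by (intro card_mono) auto
  then have "card ?S * card A \<le> card {x \<in> S. ev ((!) (enc x)) B = 0} * card A" by (rule mult_le_mono1)
  also have "\<dots> \<le> b * card A ^ (n - 1)" by (rule zeros_count[OF B(1,2) A enc])
  finally have "real (card ?S * card A) \<le> real (b * card A ^ (n - 1))" by (rule of_nat_mono)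
  then have "real (card ?S) * real (card A) \<le> real b * real (card A ^ (n - 1))" by simp
  also have "\<dots> \<le> minor_bound d D * real (card A ^ (n - 1))" using b by (intro mult_right_mono) auto
  finally show "real (card ?S) * real (card A) \<le> minor_bound d D * real (card A ^ (n - 1))" .
qed

text \<open>Any numbering followed by a transposition gives \<open>k\<close> the number
  \<open>0\<close>, the distinguished index of the constructions above.\<close>

lemma index_map: "\<exists>\<iota> \<kappa>. \<iota> (k :: 'n::finite) = (0::nat) \<and> (\<forall>i. \<iota> i < CARD('n) \<and> \<kappa> (\<iota> i) = i) \<and> (\<forall>j<CARD('n). \<iota> (\<kappa> j) = j)"
proof -
  obtain e where e: "bij_betw e (UNIV :: 'n set) {0..<CARD('n)}"
    using ex_bij_betw_finite_nat[of "UNIV :: 'n set"] by auto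
  have "e k < CARD('n)" using e by (auto simp: bij_betw_def)
  then have "bij_betw (transpose 0 (e k)) {0..<CARD('n)} {0..<CARD('n)}"
    by (intro bij_betw_byWitness[where f' = "transpose 0 (e k)"]) (auto simp: transpose_def)
  then have b: "bij_betw (transpose 0 (e k) \<circ> e) (UNIV :: 'n set) {0..<CARD('n)}"
    using e by (rule bij_betw_trans[rotated])
  define \<iota> where "\<iota> = transpose 0 (e k) \<circ> e"
  have "\<iota> k = 0" by (simp add: \<iota>_def)
  moreover have "\<iota> i < CARD('n)" for i using b by (auto simp: \<iota>_def bij_betw_def)
  moreover have "inv_into UNIV \<iota> (\<iota> i) = i" for i using b by (intro inv_into_f_f) (simp_all add: \<iota>_def bij_betw_def)
  moreover have "\<iota> (inv_into UNIV \<iota> j) = j" if "j < CARD('n)" for j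
  proof (rule f_inv_into_f)
    show "j \<in> range \<iota>" using b that by (simp add: \<iota>_def bij_betw_def)
  qed
  ultimately show ?thesis by blast
qed

lemma section_params_count:
  fixes Q :: "('n \<Rightarrow> 'a) \<times> ('n \<Rightarrow> 'a) \<times> ('n \<Rightarrow> 'a) \<Rightarrow> bool"
  shows "card {t \<in> section_params k. Q t} =
    card {(x, z) \<in> (UNIV \<times> ((UNIV - {k}) \<rightarrow>\<^sub>E UNIV)) \<times> ((UNIV - {k}) \<rightarrow>\<^sub>E UNIV). Q (fst x, snd x, z)}"
proof -
  let ?g = "\<lambda>t :: ('n \<Rightarrow> 'a) \<times> ('n \<Rightarrow> 'a) \<times> ('n \<Rightarrow> 'a). ((fst t, fst (snd t)), snd (snd t))"
  have "{(x, z) \<in> (UNIV \<times> ((UNIV - {k}) \<rightarrow>\<^sub>E UNIV)) \<times> ((UNIV - {k}) \<rightarrow>\<^sub>E UNIV). Q (fst x, snd x, z)}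
    = ?g ` {t \<in> section_params k. Q t}" (is "?R = ?g ` ?L")
  proof (intro subset_antisym subsetI)
    fix y assume y: "y \<in> ?R"
    then have "(fst (fst y), snd (fst y), snd y) \<in> ?L" by (simp add: section_params_def mem_Times_iff case_prod_beta)
    then show "y \<in> ?g ` ?L" by (rule rev_image_eqI) simp
  next
    fix y assume "y \<in> ?g ` ?L"
    then show "y \<in> ?R" by (elim imageE) (simp add: section_params_def mem_Times_iff)
  qed
  moreover have "inj_on ?g ?L" by (rule inj_onI) (simp add: prod_eq_iff)
  ultimately show ?thesis by (simp only: card_image)
qed

section \<open>Counting\<close>

lemma section_counts:
  fixes f :: "('n::finite, 'a::{field, finite}) mpoly" and k :: 'n
  assumes irr: "absolutely_irreducible f"
  defines "n \<equiv> CARD('n)" and "q \<equiv> CARD('a)" and "d \<equiv> total_degree f"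
  defines "W \<equiv> ((UNIV - {k}) \<rightarrow>\<^sub>E UNIV) :: ('n \<Rightarrow> 'a) set"
  shows "\<exists>good. real (card {x \<in> UNIV \<times> W. \<not> good x}) * real q \<le> 2 * (real d)\<^sup>2 * real (card ((UNIV :: ('n \<Rightarrow> 'a) set) \<times> W)) \<and>
    (\<forall>x\<in>UNIV \<times> W. good x \<longrightarrow>
      real (card {z \<in> W. \<not> absolutely_irreducible (plane_section k f (fst x, snd x, z))}) * real q
        \<le> minor_bound d (d - 1) * real (card W) \<and>
      (\<forall>D<d. real (card {z \<in> W. has_abs_irreducible_factor_upto D (plane_section k f (fst x, snd x, z))}) * real q
        \<le> real d * minor_bound d D * real (card W))) \<and> d > 0"
proof -
  obtain \<iota> \<kappa> where \<iota>k: "\<iota> k = (0::nat)" and \<iota>n: "\<And>i. \<iota> i < n" and \<kappa>\<iota>: "\<And>i. \<kappa> (\<iota> i) = i"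
    and \<iota>\<kappa>: "\<And>j. j < n \<Longrightarrow> \<iota> (\<kappa> j) = j"
    using index_map[of k] unfolding n_def by metis
  have n: "n > 0" by (simp add: n_def)
  have \<iota>0: "\<iota> i = 0 \<longleftrightarrow> i = k" for i using \<iota>k \<kappa>\<iota> by metis
  define f' :: "(nat, 'a alg_closure) mpoly" where "f' = meval Const (\<lambda>i. Var (\<iota> i)) (to_closure f)"
  have irr_f: "irreducible (to_closure f)"
    using irr by (simp add: absolutely_irreducible_def)
  have f': "irreducible f'" "kill {n..} f' = f'" "tdeg f' = d"
    using rename[where \<iota> = \<iota> and \<kappa> = \<kappa> and n = n and p = "to_closure f", OF \<iota>n \<kappa>\<iota> \<iota>\<kappa>] irr_f
    by (simp_all add: f'_def d_def tdeg_eq_total_degree total_degree_to_closure)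
  have d: "d > 0"
  proof (rule ccontr)
    assume "\<not> ?thesis"
    then obtain c where c: "f' = Const c" using tdeg_0_imp_Const[of f'] f'(3) by auto
    moreover have "c \<noteq> 0" using c f'(1) by (auto simp: Const_def)
    ultimately have "f' dvd 1" using Const_unit[of c] by simp
    then show False using f'(1) by (simp add: comm_semiring_1_class.irreducible_def)
  qed
  have char: "CHAR('a alg_closure) > 0" using finite_imp_CHAR_pos[where 'a = 'a] by simp
  \<comment> \<open>The copy of the finite field in its closure: parameters range over
    \<open>A\<close>, polynomials have coefficients in the closure.\<close>
  define A :: "'a alg_closure set" where "A = range to_ac"
  have A: "finite A" "card A = q" by (simp_all add: A_def q_def card_image inj_to_ac)
  have q: "q > 0" by (simp add: q_def)
  have cardW: "card W = q ^ (n - 1)"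
    unfolding W_def q_def n_def by (simp add: card_PiE card_Diff_subset)
  have finW: "finite W" unfolding W_def by (intro finite_PiE) auto
  have cardS: "card ((UNIV :: ('n \<Rightarrow> 'a) set) \<times> W) = q ^ (2 * n - 1)"
  proof -
    have "card (UNIV :: ('n \<Rightarrow> 'a) set) = q ^ n" by (simp add: card_fun q_def n_def)
    moreover have "n + (n - 1) = 2 * n - 1" using n by simp
    ultimately show ?thesis by (simp add: card_cartesian_product cardW flip: power_add)
  qed
  obtain B where B: "B \<noteq> 0" "B \<in> FTS {2 * n - 1..} (2 * int d ^ 2)"
    and Bgood: "\<And>y. ev y B \<noteq> 0 \<Longrightarrow> (let p = line_subst (\<lambda>a. a) y (\<lambda>i. if i = 0 then 1 else y (n - 1 + i)) f' in
      coeff p d \<noteq> 0 \<and> (\<forall>x. poly p x = 0 \<longrightarrow> poly (pderiv p) x \<noteq> 0))"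
    using generic_line_good[OF f'(1,2) n char] f'(3) d by auto
  \<comment> \<open>The layout follows the variables of the polynomials to be evaluated:
    \<open>v\<close> fills the positions below \<open>n\<close> and \<open>w_i\<close> sits at
    \<open>n - 1 + i\<close>, without gap because \<open>w\<close> starts at index \<open>1\<close>.
    In \<open>enc2\<close> likewise \<open>z_i\<close> sits at \<open>i - 1\<close>.\<close>
  define enc1 :: "('n \<Rightarrow> 'a) \<times> ('n \<Rightarrow> 'a) \<Rightarrow> 'a alg_closure list" where
    "enc1 x = map (\<lambda>j. if j < n then to_ac (fst x (\<kappa> j)) else to_ac (snd x (\<kappa> (j - (n - 1))))) [0..<2 * n - 1]" for x
  define enc2 :: "('n \<Rightarrow> 'a) \<Rightarrow> 'a alg_closure list" where
    "enc2 z = map (\<lambda>j. to_ac (z (\<kappa> (Suc j)))) [0..<n - 1]" for z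
  have enc1_v: "enc1 x ! \<iota> i = to_ac (fst x i)" for x i
  proof -
    have "\<iota> i < 2 * n - 1" using \<iota>n[of i] n by linarith
    then show ?thesis using \<iota>n[of i] by (simp add: enc1_def \<kappa>\<iota>)
  qed
  have enc1_w: "enc1 x ! (n - 1 + \<iota> i) = to_ac (snd x i)" if "i \<noteq> k" for x i
  proof -
    have "\<iota> i > 0" using \<iota>0[of i] that by simp
    then have "n - 1 + \<iota> i < 2 * n - 1" "\<not> n - 1 + \<iota> i < n" "n - 1 + \<iota> i - (n - 1) = \<iota> i"
      using \<iota>n[of i] by linarith+
    then show ?thesis by (simp add: enc1_def \<kappa>\<iota> del: One_nat_def)
  qed
  have enc2_z: "enc2 z ! (\<iota> i - 1) = to_ac (z i)" if "i \<noteq> k" for z i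
  proof -
    have "\<iota> i > 0" using \<iota>0[of i] that by simp
    then have "\<iota> i - 1 < n - 1" "Suc (\<iota> i - 1) = \<iota> i" using \<iota>n[of i] by linarith+
    then show ?thesis by (simp add: enc2_def \<kappa>\<iota> del: One_nat_def)
  qed
  have ext_W: "w = w'" if "w \<in> W" "w' \<in> W" "\<And>i. i \<noteq> k \<Longrightarrow> w i = w' i" for w w'
    by (rule PiE_ext[of w "UNIV - {k}" "\<lambda>_. UNIV" w']) (use that in \<open>auto simp: W_def\<close>)
  have inj1: "inj_on enc1 (UNIV \<times> W)"
  proof (rule inj_onI)
    fix x y assume xy: "x \<in> UNIV \<times> W" "y \<in> UNIV \<times> W" "enc1 x = enc1 y"
    have "fst x i = fst y i" for i using enc1_v[of x i] enc1_v[of y i] xy(3) by simp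
    moreover have "snd x = snd y"
      by (rule ext_W) (use xy enc1_w[of _ x] enc1_w[of _ y] in auto)
    ultimately show "x = y" by (simp add: prod_eq_iff ext)
  qed
  have inj2: "inj_on enc2 W"
  proof (rule inj_onI)
    fix z z' assume zz: "z \<in> W" "z' \<in> W" "enc2 z = enc2 z'"
    show "z = z'" by (rule ext_W) (use zz enc2_z[of _ z] enc2_z[of _ z'] in auto)
  qed
  have len1: "length (enc1 x) = 2 * n - 1 \<and> set (enc1 x) \<subseteq> A" for x by (auto simp: enc1_def A_def)
  have len2: "length (enc2 x) = n - 1 \<and> set (enc2 x) \<subseteq> A" for x by (auto simp: enc2_def A_def)
  define good where "good x \<longleftrightarrow> ev ((!) (enc1 x)) B \<noteq> 0" for x
  have "card {x \<in> UNIV \<times> W. ev ((!) (enc1 x)) B = 0} * card A \<le> (2 * d ^ 2) * card A ^ (2 * n - 1)"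
    by (rule zeros_count[OF B(1) _ A(1) inj1 len1]) (use B(2) in simp)
  then have "real (card {x \<in> UNIV \<times> W. \<not> good x} * q) \<le> real ((2 * d ^ 2) * q ^ (2 * n - 1))"
    unfolding good_def A(2) not_not by (rule of_nat_mono)
  then have bad: "real (card {x \<in> UNIV \<times> W. \<not> good x}) * real q \<le> 2 * (real d)\<^sup>2 * real (card ((UNIV :: ('n \<Rightarrow> 'a) set) \<times> W))"
    unfolding cardS by simp
  have good: "real (card {z \<in> W. \<not> absolutely_irreducible (plane_section k f (fst x, snd x, z))}) * real q
        \<le> minor_bound d (d - 1) * real (card W) \<and>
      (\<forall>D<d. real (card {z \<in> W. has_abs_irreducible_factor_upto D (plane_section k f (fst x, snd x, z))}) * real q
        \<le> real d * minor_bound d D * real (card W))"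
    if "good x" for x
  proof -
    let ?I = "{z \<in> W. \<not> absolutely_irreducible (plane_section k f (fst x, snd x, z))}"
    let ?H = "\<lambda>D. {z \<in> W. has_abs_irreducible_factor_upto D (plane_section k f (fst x, snd x, z))}"
    define v where "v = (!) (enc1 x)"
    define u where "u i = (if i = 0 then 1 else v (n - 1 + i))" for i
    define p where "p = line_subst (\<lambda>a. a) v u f'"
    have p: "coeff p d \<noteq> 0" "\<And>x. poly p x = 0 \<Longrightarrow> poly (pderiv p) x \<noteq> 0"
      using Bgood[of v] that unfolding good_def v_def[symmetric] u_def[abs_def, symmetric] p_def Let_def by auto
    have line: "good_line f' n d v u r" if "poly p r = 0" for r
      by unfold_locales (use f' n p that in \<open>simp_all add: p_def u_def\<close>)
    have "degree p \<ge> d" using p(1) by (rule le_degree)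
    moreover have "degree p \<le> d" unfolding p_def using line_subst_degree[OF comm_ring_hom_id, of v u f'] f'(3) by simp
    ultimately have degp: "degree p = d" by simp
    then obtain r where r: "poly p r = 0" using alg_closed_imp_poly_has_root[of p] d by auto
    have plane: "bivariate (to_closure (plane_section k f (fst x, snd x, z))) = good_line.plane f' v u ((!) (enc2 z))" for z
    proof -
      let ?v = "\<lambda>i. [:v i, if i = 0 then 0 else enc2 z ! (i - 1):]" and ?u = "\<lambda>i. [:u i:]"
      have "good_line.plane f' v u ((!) (enc2 z)) = line_subst (\<lambda>a. [:a:]) ?v ?u f'"
        by (rule good_line.plane_def[OF line[OF r]])
      also have "\<dots> = meval (\<lambda>a. [:[:a:]:]) (\<lambda>i. [:?v (\<iota> i), ?u (\<iota> i):]) (to_closure f)"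
        unfolding f'_def
        by (subst meval_comp[OF Const_hom line_subst_hom[OF const_poly_hom]])
          (simp only: line_subst_Const[OF const_poly_hom] line_subst_Var[OF const_poly_hom])
      also have "\<dots> = meval (\<lambda>a. [:[:to_ac a:]:]) (\<lambda>i. [:?v (\<iota> i), ?u (\<iota> i):]) f"
        by (rule meval_to_closure[OF const2_hom])
      also have "(\<lambda>i. [:?v (\<iota> i), ?u (\<iota> i):]) = (\<lambda>i. if i = k then [:[:to_ac (fst x i):], 1:]
          else [:[:to_ac (fst x i), to_ac (z i):], [:to_ac (snd x i):]:])"
      proof
        fix i
        show "[:?v (\<iota> i), ?u (\<iota> i):] = (if i = k then [:[:to_ac (fst x i):], 1:]
          else [:[:to_ac (fst x i), to_ac (z i):], [:to_ac (snd x i):]:])"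
          using enc1_v[of x i] enc1_w[of i x] enc2_z[of i z] \<iota>0[of i]
          by (cases "i = k") (simp_all add: u_def v_def one_pCons del: One_nat_def)
      qed
      finally show ?thesis unfolding bivariate_plane_section by simp
    qed
    define Z where "Z r D = {z \<in> W. \<exists>g h. good_line.plane f' v u ((!) (enc2 z)) = g * h \<and>
      poly (eval_coeffs 0 g) r = 0 \<and> (\<forall>i j. i + j > D \<longrightarrow> coeff (coeff g i) j = 0)}" for r D
    have Z: "real (card (Z r D)) * real q \<le> minor_bound d D * real (card W)" "minor_bound d D \<ge> 0"
      if "poly p r = 0" "D < d" for r D
      using minor_zeros[OF line[OF that(1)] that(2) A(1) finW inj2 len2] unfolding Z_def A(2) cardW by auto
    have finZ: "finite (Z r D)" for r D unfolding Z_def using finW by auto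
    have "?I \<subseteq> Z r (d - 1)"
    proof
      fix z assume z: "z \<in> ?I"
      then show "z \<in> Z r (d - 1)"
        using good_line.reducible_section[OF line[OF r] plane[of z] _ _ d] section_degree[of k f "(fst x, snd x, z)"]
        by (simp add: Z_def absolutely_irreducible_def d_def)
    qed
    then have "card ?I \<le> card (Z r (d - 1))"
      by (rule card_mono[OF finZ])
    then have "real (card ?I) * real q
      \<le> real (card (Z r (d - 1))) * real q" by (intro mult_right_mono of_nat_mono) auto
    also have "\<dots> \<le> minor_bound d (d - 1) * real (card W)" using d by (intro Z r) simp
    finally have 1: "real (card ?I) * real q
      \<le> minor_bound d (d - 1) * real (card W)" .
    have 2: "real (card (?H D)) * real q
        \<le> real d * minor_bound d D * real (card W)" if D: "D < d" for D
    proof -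
      let ?R = "{r. poly p r = 0}"
      have "p \<noteq> 0" using p(1) by auto
      then have R: "finite ?R" "card ?R \<le> d" using poly_roots_finite[of p] card_poly_roots_bound[of p] degp by auto
      \<comment> \<open>A small factor may pass through any root of \<open>p\<close>; the union over
        the roots produces the factor \<open>d\<close> in (ii).\<close>
      have "(?H D) \<subseteq> (\<Union>r\<in>?R. Z r D)"
      proof
        fix z assume z: "z \<in> (?H D)"
        then obtain g where "irreducible g" "g dvd to_closure (plane_section k f (fst x, snd x, z))" "total_degree g \<le> D"
          by (auto simp: has_abs_irreducible_factor_upto_def)
        from small_factor_section[OF line[OF r] plane[of z] this] z
        show "z \<in> (\<Union>r\<in>?R. Z r D)" by (auto simp: Z_def p_def)
      qed
      then have "card (?H D) \<le> card (\<Union>r\<in>?R. Z r D)"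
        using R finZ by (intro card_mono) auto
      also have "\<dots> \<le> (\<Sum>r\<in>?R. card (Z r D))" by (rule card_UN_le[OF R(1)])
      finally have "real (card (?H D)) \<le> real (\<Sum>r\<in>?R. card (Z r D))"
        by (rule of_nat_mono)
      then have "real (card (?H D)) * real q
        \<le> (\<Sum>r\<in>?R. real (card (Z r D)) * real q)"
        unfolding of_nat_sum sum_distrib_right[symmetric] by (intro mult_right_mono) auto
      also have "\<dots> \<le> (\<Sum>r\<in>?R. minor_bound d D * real (card W))" using D by (intro sum_mono Z) auto
      also have "\<dots> = real (card ?R) * (minor_bound d D * real (card W))" by simp
      also have "\<dots> \<le> real d * (minor_bound d D * real (card W))"
        using R(2) Z(2)[OF r D] by (intro mult_right_mono) auto
      finally show ?thesis by (simp add: mult.assoc)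
    qed
    show ?thesis using 1 2 by blast
  qed
  show ?thesis using bad good d by blast
qed

text \<open>\<open>minor_zeros\<close> gives this only in the presence of a good line, but
  \<open>count_combine\<close> requires a nonnegative bound in any case. The decisive factor is
  \<open>4 D (d - D - 1) + 3 D^2 + D\<close>.\<close>

lemma minor_bound_nonneg:
  assumes "D < d"
  shows "minor_bound d D \<ge> 0"
proof -
  have "real D + 1 \<le> real d" using assms by simp
  then have "4 * (real D + 1) * real D \<le> 4 * real d * real D" by (intro mult_right_mono) auto
  moreover have "4 * real d * real D - ((real D + 1) * (real D + 2) - 2)
      = (4 * real d * real D - 4 * (real D + 1) * real D) + (3 * (real D * real D) + real D)"
    by (simp add: algebra_simps)
  moreover have "0 \<le> 3 * (real D * real D) + real D" by simp
  ultimately have "0 \<le> 4 * real d * real D - ((real D + 1) * (real D + 2) - 2)" by linarith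
  then have "0 \<le> (real D + 1) * (real D + 2) * (4 * real d * real D - ((real D + 1) * (real D + 2) - 2))"
    by (intro mult_nonneg_nonneg) auto
  then show ?thesis by (simp add: minor_bound_def algebra_simps)
qed

theorem theorem2p1:
  fixes f :: "('n::finite, 'a::{field, finite}) mpoly"
    and k :: 'n
    and q n d :: nat
  assumes "q = CARD('a)"
    and "n = CARD('n)"
    and "d = total_degree f"
    and "absolutely_irreducible f"
  shows "real (card {t \<in> section_params k. \<not> absolutely_irreducible (plane_section k f t)})
           \<le> 1 / 8 * (3 * real d ^ 4 - 2 * real d ^ 3 + 13 * real d ^ 2 + 2 * real d)
              * real q ^ (3 * n - 3)
       \<and> (\<forall>D::nat. 0 < D \<and> D < d \<longrightarrow>
           real (card {t \<in> section_params k. has_abs_irreducible_factor_upto D (plane_section k f t)})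
           \<le> real d / 8 * (- (real D ^ 4) + 4 * real D ^ 3 * real d - 6 * real D ^ 3
                + 12 * real D ^ 2 * real d - 11 * real D ^ 2 + 8 * real D * real d
                - 6 * real D + 16 * real d)
              * real q ^ (3 * n - 3))"
proof -
  define W where "W = ((UNIV - {k}) \<rightarrow>\<^sub>E UNIV :: ('n \<Rightarrow> 'a) set)"
  define S where "S = (UNIV :: ('n \<Rightarrow> 'a) set) \<times> W"
  obtain good where bad: "real (card {x \<in> S. \<not> good x}) * real q \<le> 2 * (real d)\<^sup>2 * real (card S)"
    and irr: "\<And>x. x \<in> S \<Longrightarrow> good x \<Longrightarrow>
      real (card {z \<in> W. \<not> absolutely_irreducible (plane_section k f (fst x, snd x, z))}) * real q
        \<le> minor_bound d (d - 1) * real (card W)"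
    and fac: "\<And>x D. x \<in> S \<Longrightarrow> good x \<Longrightarrow> D < d \<Longrightarrow>
      real (card {z \<in> W. has_abs_irreducible_factor_upto D (plane_section k f (fst x, snd x, z))}) * real q
        \<le> real d * minor_bound d D * real (card W)"
    and d: "d > 0"
    using section_counts[OF assms(4), of k] unfolding assms(1)[symmetric] assms(3)[symmetric] W_def S_def by blast
  have fin: "finite S" "finite W" unfolding S_def W_def by (auto intro!: finite_cartesian_product finite_PiE)
  have n: "n > 0" and q: "q > 0" by (simp_all add: assms)
  have cW: "card W = q ^ (n - 1)" unfolding W_def assms by (simp add: card_PiE card_Diff_subset)
  have SW: "real (card S) * real (card W) = real q * real q ^ (3 * n - 3)"
  proof -
    have "card (UNIV :: ('n \<Rightarrow> 'a) set) = q ^ n" by (simp add: card_fun assms)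
    then have "card S * card W = q ^ (n + (n - 1) + (n - 1))"
      by (simp add: S_def card_cartesian_product cW power_add)
    \<comment> \<open>The parameter space has \<open>q^(3 n - 2)\<close> points; one factor
      \<open>q\<close> is set aside to cancel the one on the left of the counting bounds.\<close>
    also have "n + (n - 1) + (n - 1) = Suc (3 * n - 3)" using n by simp
    finally show ?thesis by (metis of_nat_mult of_nat_power power_Suc)
  qed
  have count: "real (card {t \<in> section_params k. Q t}) \<le> (2 * (real d)\<^sup>2 + \<beta>) * real q ^ (3 * n - 3)"
    if "\<And>x. x \<in> S \<Longrightarrow> good x \<Longrightarrow> real (card {z \<in> W. Q (fst x, snd x, z)}) * real q \<le> \<beta> * real (card W)" "\<beta> \<ge> 0"
    for Q \<beta>
  proof -
    have "real (card {(x, z) \<in> S \<times> W. Q (fst x, snd x, z)}) * real q \<le> (2 * (real d)\<^sup>2 + \<beta>) * real (card S) * real (card W)"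
      by (rule count_combine[OF fin bad that(1) that(2)]) auto
    also have "\<dots> = (2 * (real d)\<^sup>2 + \<beta>) * real q ^ (3 * n - 3) * real q"
      using SW by (simp add: mult.assoc mult.commute)
    finally show ?thesis
      using q section_params_count[of k Q] unfolding S_def W_def by simp
  qed
  have "real (card {t \<in> section_params k. \<not> absolutely_irreducible (plane_section k f t)})
    \<le> (2 * (real d)\<^sup>2 + minor_bound d (d - 1)) * real q ^ (3 * n - 3)"
    by (rule count[OF irr]) (use d in \<open>simp_all add: minor_bound_nonneg\<close>)
  \<comment> \<open>For \<open>D = d - 1\<close> the product \<open>(D + 1) (D + 2)\<close> is
    \<open>d (d + 1)\<close>, and the minor bound becomes
    \<open>d (d^2 - 1) (3 d - 2) / 8\<close>.\<close>
  also have "2 * (real d)\<^sup>2 + minor_bound d (d - 1) = 1 / 8 * (3 * real d ^ 4 - 2 * real d ^ 3 + 13 * real d ^ 2 + 2 * real d)"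
  proof -
    have "real (d - 1) = real d - 1" using d by (simp add: of_nat_diff)
    then show ?thesis unfolding minor_bound_def by (simp add: field_simps power2_eq_square power3_eq_cube power4_eq_xxxx)
  qed
  finally have i: "real (card {t \<in> section_params k. \<not> absolutely_irreducible (plane_section k f t)})
    \<le> 1 / 8 * (3 * real d ^ 4 - 2 * real d ^ 3 + 13 * real d ^ 2 + 2 * real d) * real q ^ (3 * n - 3)" .
  have ii: "real (card {t \<in> section_params k. has_abs_irreducible_factor_upto D (plane_section k f t)})
           \<le> real d / 8 * (- (real D ^ 4) + 4 * real D ^ 3 * real d - 6 * real D ^ 3
                + 12 * real D ^ 2 * real d - 11 * real D ^ 2 + 8 * real D * real d
                - 6 * real D + 16 * real d)
              * real q ^ (3 * n - 3)" if D: "D < d" for D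
  proof -
    have "real (card {t \<in> section_params k. has_abs_irreducible_factor_upto D (plane_section k f t)})
      \<le> (2 * (real d)\<^sup>2 + real d * minor_bound d D) * real q ^ (3 * n - 3)"
      by (rule count[OF fac]) (use D in \<open>simp_all add: minor_bound_nonneg\<close>)
    also have "2 * (real d)\<^sup>2 + real d * minor_bound d D = real d / 8 * (- (real D ^ 4) + 4 * real D ^ 3 * real d - 6 * real D ^ 3
                + 12 * real D ^ 2 * real d - 11 * real D ^ 2 + 8 * real D * real d
                - 6 * real D + 16 * real d)"
      unfolding minor_bound_def by (simp add: field_simps power2_eq_square power3_eq_cube power4_eq_xxxx)
    finally show ?thesis .
  qed
  show ?thesis using i ii by blast
qed

end
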